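(* Suppose that $\theta\in[0,\pi/3]$, and let $\Gamma=\langle S,T\rangle$ and $D$ be as defined in the context. Then $D$ is a fundamental domain for the cosets of $\langle T\rangle$ in $\Gamma$. Moreover, $\Gamma$ is discrete and has the presentation $$\Gamma=\langle S,T\mid S^4=(T^{-1}S)^4=id\rangle .$$
   Context: Let $H=\begin{pmatrix}0&0&1\\0&1&0\\1&0&0\end{pmatrix}$ and $\langle\mathbf z,\mathbf w\rangle=\mathbf w^*H\mathbf z$ on $\mathbb{C}^3$. $\mathbf{H}^2_{\mathbb{C}}$ (resp. $\partial\mathbf{H}^2_{\mathbb{C}}$) is the set of negative (resp. null) complex lines in $\mathbb{C}^3$, with holomorphic isometry group $\mathrm{PU}(2,1)$. The point $q_\infty\in\partial\mathbf{H}^2_{\mathbb{C}}$ has lift $(1,0,0)^T$; every other point of $\mathbf{H}^2_{\mathbb{C}}\cup\partial\mathbf{H}^2_{\mathbb{C}}$ has coordinates $(z,t,u)\in\mathbb{C}\times\mathbb{R}\times\mathbb{R}_{\ge0}$ with lift $\left(\frac{-|z|^2-u+it}{2},z,1\right)^T$; boundary points ($u=0$) are written $[z,t]$. For the parameter $\theta$ let $I_1=\begin{pmatrix}-1&2e^{i\theta}&2\\0&1&2e^{-i\theta}\\0&0&-1\end{pmatrix}$, $I_2=\begin{pmatrix}-1&-2e^{-i\theta}&2\\0&1&-2e^{i\theta}\\0&0&-1\end{pmatrix}$, $I_3=\begin{pmatrix}0&0&1\\0&-1&0\\1&0&0\end{pmatrix}$, $S=I_2I_3$, $T=I_2I_1$,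 $\Gamma=\langle S,T\rangle<\mathrm{PU}(2,1)$. ($T$ is unipotent and fixes $q_\infty$.) For $g\in\mathrm{PU}(2,1)$ not fixing $q_\infty$ (represented in $\mathrm{SU}(2,1)$), the isometric sphere is $\mathcal I(g)=\{p\in\mathbf{H}^2_{\mathbb{C}}\cup\partial\mathbf{H}^2_{\mathbb{C}}:|\langle\mathbf p,\mathbf q_\infty\rangle|=|\langle\mathbf p,g^{-1}(\mathbf q_\infty)\rangle|\}$ with $\mathbf q_\infty=(1,0,0)^T$. If $g^{-1}(q_\infty)=[w,s]$, it is the Cygan sphere with center $[w,s]$ and some radius $r$: the set of $(z,t,u)$ with $\big||z-w|^2+u-i(t-s+2\mathrm{Im}(z\bar w))\big|=r^2$. Its interior is given by $<r^2$, its exterior by $>r^2$ (together with $q_\infty$). For $k\in\mathbb{Z}$ define $\mathcal I_k^+=\mathcal I(T^kST^{-k})$, $\mathcal I_k^-=\mathcal I(T^kS^{-1}T^{-k})$, $\mathcal I_k^\star=\mathcal I(T^kS^2T^{-k})$, $\mathcal I_k^\diamond=\mathcal I(T^k(S^{-1}T)^2T^{-k})$. Their centers and radii are, respectively: $[4k\cos\theta,8k\sin2\theta]$, $\sqrt2$; $[4k\cos\theta+2e^{i\theta},0]$, $\sqrt2$; $[4k\cos\theta+e^{i\theta},4k\sin2\theta]$, $1$; $[4k\cos\theta-e^{-i\theta},4k\sin2\theta]$, $1$. $D$ is the intersection of the closures of the exteriors of all $\mathcal I_k^+,\mathcal I_k^-,\mathcal I_k^\star,\mathcal I_k^\diamond$,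 $k\in\mathbb{Z}$. "Fundamental domain for the cosets of $\langle T\rangle$ in $\Gamma$" means: $D$ is invariant under $\langle T\rangle$, the $\Gamma$-translates of $D$ cover $\mathbf{H}^2_{\mathbb{C}}$, and $g(D)$ and $h(D)$ have disjoint interiors whenever $g,h\in\Gamma$ lie in different left cosets of $\langle T\rangle$. *)

theory Defs
  imports "HOL-Analysis.Analysis" "HOL-Algebra.Generated_Groups"
begin

subsection \<open>Quotient topologies\<close>

definition quotient_topology :: "'a topology \<Rightarrow> ('a \<Rightarrow> 'b) \<Rightarrow> 'b topology" where
  "quotient_topology X f =
     topology (\<lambda>U. U \<subseteq> f ` topspace X \<and> openin X {x \<in> topspace X. f x \<in> U})"

lemma openin_quotient_topology:
  "openin (quotient_topology X f) U \<longleftrightarrow>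
     U \<subseteq> f ` topspace X \<and> openin X {x \<in> topspace X. f x \<in> U}"
proof -
  have "istopology (\<lambda>U. U \<subseteq> f ` topspace X \<and> openin X {x \<in> topspace X. f x \<in> U})"
    (is "istopology ?P")
    unfolding istopology_def
  proof (intro conjI[of "\<forall>U V. ?P U \<longrightarrow> ?P V \<longrightarrow> ?P (U \<inter> V)"] allI impI)
    fix U V
    assume U: "?P U" and V: "?P V"
    then have "openin X ({x \<in> topspace X. f x \<in> U} \<inter> {x \<in> topspace X. f x \<in> V})"
      by (intro openin_Int) (elim conjE, assumption)+
    moreover have "{x \<in> topspace X. f x \<in> U} \<inter> {x \<in> topspace X. f x \<in> V} =
        {x \<in> topspace X. f x \<in> U \<inter> V}"
      by blast
    ultimately show "?P (U \<inter> V)" using U by auto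
  next
    fix \<K>
    assume K: "\<forall>K\<in>\<K>. ?P K"
    then have "openin X (\<Union>K\<in>\<K>. {x \<in> topspace X. f x \<in> K})"
      by (intro openin_Union) auto
    moreover have "(\<Union>K\<in>\<K>. {x \<in> topspace X. f x \<in> K}) = {x \<in> topspace X. f x \<in> \<Union>\<K>}"
      by blast
    moreover have "\<Union>\<K> \<subseteq> f ` topspace X" using K by (intro Union_least) simp
    ultimately show "?P (\<Union>\<K>)" by simp
  qed
  then show ?thesis
    by (simp add: quotient_topology_def)
qed

lemma topspace_quotient_topology: "topspace (quotient_topology X f) = f ` topspace X"
proof
  show "topspace (quotient_topology X f) \<subseteq> f ` topspace X"
    by (metis openin_quotient_topology openin_topspace)
  have "{x \<in> topspace X. f x \<in> f ` topspace X} = topspace X" by blast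
  then have "openin (quotient_topology X f) (f ` topspace X)"
    by (simp add: openin_quotient_topology)
  then show "f ` topspace X \<subseteq> topspace (quotient_topology X f)"
    by (rule openin_subset)
qed

lemma quotient_map_quotient_topology: "quotient_map X (quotient_topology X f) f"
  by (simp add: quotient_map_def topspace_quotient_topology openin_quotient_topology)


subsection \<open>Group presentations\<close>

text \<open>A word is a list of letters; \<open>(x, True)\<close> is the generator \<open>x\<close> and \<open>(x, False)\<close> its
  formal inverse. The presented group consists of the classes of words under the congruence
  generated by free cancellation and by deletion/insertion of the relators.\<close>

type_synonym 'x word = "('x \<times> bool) list"

inductive word_eq :: "'x word set \<Rightarrow> 'x word \<Rightarrow> 'x word \<Rightarrow> bool" for R where
  refl: "word_eq R u u"
| sym: "word_eq R u v \<Longrightarrow> word_eq R v u"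
| trans: "word_eq R u v \<Longrightarrow> word_eq R v w \<Longrightarrow> word_eq R u w"
| cancel: "word_eq R (u @ [(x, b), (x, \<not> b)] @ v) (u @ v)"
| relator: "r \<in> R \<Longrightarrow> word_eq R (u @ r @ v) (u @ v)"

definition word_class :: "'x word set \<Rightarrow> 'x word \<Rightarrow> 'x word set" where
  "word_class R u = {v. word_eq R u v}"

definition presented_group :: "'x word set \<Rightarrow> 'x word set monoid" where
  "presented_group R =
     \<lparr>carrier = range (word_class R),
      mult = (\<lambda>A B. \<Union>u\<in>A. \<Union>v\<in>B. word_class R (u @ v)),
      one = word_class R []\<rparr>"

text \<open>\<open>G\<close> has the presentation with relators \<open>R\<close>, the generator \<open>x\<close> being the element
  \<open>\<iota> x\<close> of \<open>G\<close>.\<close>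

definition has_presentation ::
    "('a, 'b) monoid_scheme \<Rightarrow> ('x \<Rightarrow> 'a) \<Rightarrow> 'x word set \<Rightarrow> bool" where
  "has_presentation G \<iota> R \<longleftrightarrow>
     (\<exists>\<phi>. \<phi> \<in> iso (presented_group R) G \<and> (\<forall>x. \<phi> (word_class R [(x, True)]) = \<iota> x))"

lemma word_class_eq_iff: "word_class R u = word_class R v \<longleftrightarrow> word_eq R u v"
  unfolding word_class_def set_eq_iff mem_Collect_eq
  by (metis word_eq.refl word_eq.sym word_eq.trans)

lemma word_eq_append_right: "word_eq R u v \<Longrightarrow> word_eq R (u @ w) (v @ w)"
proof (induction rule: word_eq.induct)
  case (cancel u x b v)
  show ?case using word_eq.cancel[of R u x b "v @ w"] by simp
next
  case (relator r u v)
  then show ?case using word_eq.relator[of r R u "v @ w"] by simp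
qed (rule word_eq.refl, erule word_eq.sym, erule (1) word_eq.trans)

lemma word_eq_append_left: "word_eq R u v \<Longrightarrow> word_eq R (w @ u) (w @ v)"
proof (induction rule: word_eq.induct)
  case (cancel u x b v)
  show ?case using word_eq.cancel[of R "w @ u" x b v] by simp
next
  case (relator r u v)
  then show ?case using word_eq.relator[of r R "w @ u" v] by simp
qed (rule word_eq.refl, erule word_eq.sym, erule (1) word_eq.trans)

lemma presented_group_mult:
  "word_class R u \<otimes>\<^bsub>presented_group R\<^esub> word_class R v = word_class R (u @ v)"
proof -
  have "word_class R (u' @ v') = word_class R (u @ v)"
    if "u' \<in> word_class R u" "v' \<in> word_class R v" for u' v'
  proof -
    have "word_eq R (u @ v) (u' @ v)" "word_eq R (u' @ v) (u' @ v')"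
      using that word_eq_append_left word_eq_append_right
      unfolding word_class_def by blast+
    then show ?thesis
      unfolding word_class_eq_iff by (blast intro: word_eq.sym word_eq.trans)
  qed
  moreover have "u \<in> word_class R u" "v \<in> word_class R v"
    by (simp_all add: word_class_def word_eq.refl)
  ultimately show ?thesis
    unfolding presented_group_def monoid.simps by blast
qed

lemma word_eq_inverse:
  "word_eq R (rev (map (\<lambda>(x, b). (x, \<not> b)) u) @ u) []"
proof (induction u)
  case Nil
  show ?case by (simp add: word_eq.refl)
next
  case (Cons a u)
  obtain x b where a: "a = (x, b)" by force
  show ?case
    using word_eq.trans[OF word_eq.cancel[of R "rev (map (\<lambda>(x, b). (x, \<not> b)) u)" x "\<not> b" u] Cons]
    by (simp add: a)
qed

lemma group_presented_group: "group (presented_group R)"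
proof (rule groupI)
  fix A assume "A \<in> carrier (presented_group R)"
  then obtain u where A: "A = word_class R u" by (auto simp: presented_group_def)
  have "word_class R (rev (map (\<lambda>(x, b). (x, \<not> b)) u)) \<otimes>\<^bsub>presented_group R\<^esub> A
      = \<one>\<^bsub>presented_group R\<^esub>"
    unfolding A presented_group_mult
    by (simp add: presented_group_def word_class_eq_iff word_eq_inverse)
  then show "\<exists>B\<in>carrier (presented_group R). B \<otimes>\<^bsub>presented_group R\<^esub> A = \<one>\<^bsub>presented_group R\<^esub>"
    by (auto simp: presented_group_def)
next
  fix A assume "A \<in> carrier (presented_group R)"
  then obtain u where A: "A = word_class R u" by (auto simp: presented_group_def)
  have one: "\<one>\<^bsub>presented_group R\<^esub> = word_class R []" by (simp add: presented_group_def)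
  show "\<one>\<^bsub>presented_group R\<^esub> \<otimes>\<^bsub>presented_group R\<^esub> A = A"
    unfolding one A presented_group_mult by simp
next
  fix A B assume "A \<in> carrier (presented_group R)" "B \<in> carrier (presented_group R)"
  then obtain u v where A: "A = word_class R u" and B: "B = word_class R v"
    by (auto simp: presented_group_def)
  show "A \<otimes>\<^bsub>presented_group R\<^esub> B \<in> carrier (presented_group R)"
    unfolding A B presented_group_mult by (simp add: presented_group_def)
next
  fix A B C
  assume "A \<in> carrier (presented_group R)" "B \<in> carrier (presented_group R)"
    "C \<in> carrier (presented_group R)"
  then obtain u v w where A: "A = word_class R u" and B: "B = word_class R v"
    and C: "C = word_class R w"
    by (auto simp: presented_group_def)
  show "A \<otimes>\<^bsub>presented_group R\<^esub> B \<otimes>\<^bsub>presented_group R\<^esub> C =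
      A \<otimes>\<^bsub>presented_group R\<^esub> (B \<otimes>\<^bsub>presented_group R\<^esub> C)"
    unfolding A B C presented_group_mult by simp
qed (simp add: presented_group_def)


subsection \<open>The Hermitian form and complex hyperbolic plane\<close>

definition hermH :: "complex^3^3" where
  "hermH = vector [vector [0, 0, 1], vector [0, 1, 0], vector [1, 0, 0]]"

definition herm :: "complex^3 \<Rightarrow> complex^3 \<Rightarrow> complex" where
  "herm z w = (\<Sum>i\<in>UNIV. cnj (w $ i) * (hermH *v z) $ i)"

text \<open>Points are complex lines in \<open>\<complex>\<^sup>3\<close>, represented as sets of vectors. The value
  \<open>herm v v\<close> is always real, so \<open>Re\<close> only adjusts the type.\<close>

definition cline :: "complex^3 \<Rightarrow> (complex^3) set" where
  "cline v = {c *s v | c. True}"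

definition CP2 :: "(complex^3) set topology" where
  "CP2 = quotient_topology (top_of_set (UNIV - {0})) cline"

definition CH2 :: "(complex^3) set set" where
  "CH2 = {cline v | v. Re (herm v v) < 0}"

definition bd_CH2 :: "(complex^3) set set" where
  "bd_CH2 = {cline v | v. v \<noteq> 0 \<and> herm v v = 0}"

definition cl_CH2 :: "(complex^3) set topology" where
  "cl_CH2 = subtopology CP2 (CH2 \<union> bd_CH2)"

definition q_inf_lift :: "complex^3" where
  "q_inf_lift = vector [1, 0, 0]"

definition q_inf :: "(complex^3) set" where
  "q_inf = cline q_inf_lift"

definition hlift :: "complex \<Rightarrow> real \<Rightarrow> real \<Rightarrow> complex^3" where
  "hlift z t u =
     vector [(- complex_of_real ((cmod z)\<^sup>2) - complex_of_real u + \<i> * complex_of_real t) / 2, z, 1]"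

definition hpoint :: "complex \<Rightarrow> real \<Rightarrow> real \<Rightarrow> (complex^3) set" where
  "hpoint z t u = cline (hlift z t u)"

lemma herm_expand: "herm z w = z $ 3 * cnj (w $ 1) + z $ 2 * cnj (w $ 2) + z $ 1 * cnj (w $ 3)"
  by (simp add: herm_def hermH_def matrix_vector_mult_def sum_3 vector_3 mult.commute)

lemma herm_hlift_self: "herm (hlift z t u) (hlift z t u) = - complex_of_real u"
  by (simp add: herm_expand hlift_def vector_3 complex_eq_iff cmod_power2 field_simps)
      (simp add: power2_eq_square algebra_simps)


subsection \<open>The group PU(2,1)\<close>

definition adjoint_mat :: "complex^3^3 \<Rightarrow> complex^3^3" where
  "adjoint_mat A = map_matrix cnj (transpose A)"

definition SU21 :: "(complex^3^3) monoid" where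
  "SU21 = \<lparr>carrier = {A. adjoint_mat A ** hermH ** A = hermH \<and> det A = 1},
           mult = (**), one = mat 1\<rparr>"

lemma group_SU21: "group SU21"
proof -
  have adj: "adjoint_mat (A ** B) = adjoint_mat B ** adjoint_mat A" for A B
    by (simp add: adjoint_mat_def vec_eq_iff map_matrix_def transpose_def matrix_matrix_mult_def
        mult.commute)
  have HH: "hermH ** hermH = mat 1"
    by (simp add: vec_eq_iff forall_3 hermH_def matrix_matrix_mult_def mat_def sum_3 vector_3)
  have one: "adjoint_mat (mat 1) = mat 1"
    by (auto simp: adjoint_mat_def vec_eq_iff map_matrix_def transpose_def mat_def)
  have adjH: "adjoint_mat hermH = hermH"
    by (simp add: adjoint_mat_def vec_eq_iff forall_3 hermH_def map_matrix_def transpose_def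
        vector_3)
  have adj2: "adjoint_mat (adjoint_mat A) = A" for A
    by (simp add: adjoint_mat_def vec_eq_iff map_matrix_def transpose_def)
  show ?thesis
  proof (rule groupI)
    fix A B assume "A \<in> carrier SU21" "B \<in> carrier SU21"
    then have A: "adjoint_mat A ** hermH ** A = hermH" "det A = 1"
      and B: "adjoint_mat B ** hermH ** B = hermH" "det B = 1"
      by (auto simp: SU21_def)
    have "adjoint_mat (A ** B) ** hermH ** (A ** B)
        = adjoint_mat B ** (adjoint_mat A ** hermH ** A) ** B"
      by (simp add: adj matrix_mul_assoc)
    then show "A \<otimes>\<^bsub>SU21\<^esub> B \<in> carrier SU21"
      using A B by (simp add: SU21_def det_mul)
  next
    fix A assume "A \<in> carrier SU21"
    then have A: "adjoint_mat A ** hermH ** A = hermH" "det A = 1"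
      by (auto simp: SU21_def)
    let ?B = "hermH ** adjoint_mat A ** hermH"
    have BA: "?B ** A = mat 1"
      using A(1) by (metis HH matrix_mul_assoc)
    then have AB: "A ** ?B = mat 1"
      by (simp add: matrix_left_right_inverse)
    have "adjoint_mat ?B ** hermH ** ?B = hermH ** (A ** ?B)"
      by (simp add: adj adjH adj2 matrix_mul_assoc)
        (metis HH matrix_mul_assoc matrix_mul_rid)
    then have "adjoint_mat ?B ** hermH ** ?B = hermH"
      by (simp add: AB)
    moreover have "det ?B = 1"
      using BA A(2) by (metis det_I det_mul mult.right_neutral)
    ultimately show "\<exists>B\<in>carrier SU21. B \<otimes>\<^bsub>SU21\<^esub> A = \<one>\<^bsub>SU21\<^esub>"
      using BA by (auto simp: SU21_def)
  qed (simp_all add: SU21_def matrix_mul_assoc one)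
qed

text \<open>PU(2,1) is SU(2,1) modulo its scalar matrices, which are the cube roots of unity.\<close>

definition SU21_scalars :: "(complex^3^3) set" where
  "SU21_scalars = {mat c | c. c ^ 3 = 1}"

definition PU21 :: "(complex^3^3) set monoid" where
  "PU21 = SU21 Mod SU21_scalars"

lemma mat_mult_left: "mat c ** A = (\<chi> i j. c * A $ i $ j)"
  for A :: "complex^3^3"
  by (simp add: vec_eq_iff matrix_matrix_mult_def mat_def if_distrib if_distribR cong: if_cong)

lemma mat_mult_right: "A ** mat c = (\<chi> i j. c * A $ i $ j)"
  for A :: "complex^3^3"
  by (simp add: vec_eq_iff matrix_matrix_mult_def mat_def if_distrib if_distribR mult.commute
      cong: if_cong)

lemma mat_mult_mat: "mat c ** mat d = (mat (c * d) :: complex^3^3)"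
  unfolding mat_mult_left by (auto simp: vec_eq_iff mat_def)

lemma SU21_scalars_subset: "SU21_scalars \<subseteq> carrier SU21"
proof
  fix A assume "A \<in> SU21_scalars"
  then obtain c where A: "A = mat c" and c: "c ^ 3 = 1" by (auto simp: SU21_scalars_def)
  have "cmod c ^ 3 = 1" using c by (metis norm_one norm_power)
  then have "cmod c = 1" using power_eq_iff_eq_base[of 3 "cmod c" 1] by simp
  then have cc: "cnj c * c = 1"
    by (metis complex_norm_square mult.commute of_real_1 power_one)
  have adjA: "adjoint_mat A = mat (cnj c)"
    by (auto simp: A adjoint_mat_def vec_eq_iff map_matrix_def transpose_def mat_def)
  have "adjoint_mat A ** hermH ** A = (\<chi> i j. (cnj c * c) * hermH $ i $ j)"
    unfolding adjA unfolding A mat_mult_left mat_mult_right by (simp add: vec_eq_iff mult_ac)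
  then have "adjoint_mat A ** hermH ** A = hermH" by (simp add: cc)
  moreover have "det A = 1"
    using c by (simp add: A det_3 mat_def power3_eq_cube)
  ultimately show "A \<in> carrier SU21" by (simp add: SU21_def)
qed

lemma normal_SU21_scalars: "SU21_scalars \<lhd> SU21"
proof -
  interpret group SU21 by (rule group_SU21)
  have "subgroup SU21_scalars SU21"
  proof (rule subgroupI)
    show "SU21_scalars \<noteq> {}"
      unfolding SU21_scalars_def by (metis (mono_tags, lifting) empty_iff mem_Collect_eq power_one)
  next
    fix A assume A: "A \<in> SU21_scalars"
    then obtain c where c: "A = mat c" "c ^ 3 = 1" by (auto simp: SU21_scalars_def)
    have "mat (inverse c) \<in> SU21_scalars"
      using c by (auto simp: SU21_scalars_def power_inverse)
    moreover have "mat (inverse c) ** A = mat 1"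
      using c by (cases "c = 0") (auto simp: mat_mult_mat)
    ultimately have "inv\<^bsub>SU21\<^esub> A = mat (inverse c)"
      using A SU21_scalars_subset by (intro inv_equality) (auto simp: SU21_def)
    with \<open>mat (inverse c) \<in> SU21_scalars\<close> show "inv\<^bsub>SU21\<^esub> A \<in> SU21_scalars" by simp
  next
    fix A B assume "A \<in> SU21_scalars" "B \<in> SU21_scalars"
    then obtain c d where "A = mat c" "c ^ 3 = 1" "B = mat d" "d ^ 3 = 1"
      by (auto simp: SU21_scalars_def)
    then show "A \<otimes>\<^bsub>SU21\<^esub> B \<in> SU21_scalars"
      unfolding SU21_def SU21_scalars_def
      by (auto simp: mat_mult_mat power_mult_distrib intro!: exI[of _ "c * d"])
  qed (rule SU21_scalars_subset)
  then show ?thesis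
  proof (rule normalI)
    show "\<forall>A\<in>carrier SU21. SU21_scalars #>\<^bsub>SU21\<^esub> A = A <#\<^bsub>SU21\<^esub> SU21_scalars"
      by (auto simp: r_coset_def l_coset_def SU21_def SU21_scalars_def mat_mult_left mat_mult_right)
  qed
qed

lemma group_PU21: "group PU21"
  unfolding PU21_def by (rule normal.factorgroup_is_group[OF normal_SU21_scalars])

definition PU_class :: "complex^3^3 \<Rightarrow> (complex^3^3) set" where
  "PU_class A = SU21_scalars #>\<^bsub>SU21\<^esub> A"

definition PU21_topology :: "(complex^3^3) set topology" where
  "PU21_topology = quotient_topology (top_of_set (carrier SU21)) PU_class"

definition discrete_subgroup :: "(complex^3^3) set set \<Rightarrow> bool" where
  "discrete_subgroup \<Gamma> \<longleftrightarrow>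
     subgroup \<Gamma> PU21 \<and> subtopology PU21_topology \<Gamma> = discrete_topology \<Gamma>"

text \<open>All representatives of \<open>g\<close> send a given line to the same line, so the union below is
  that line.\<close>

definition PU_act :: "(complex^3^3) set \<Rightarrow> (complex^3) set \<Rightarrow> (complex^3) set" where
  "PU_act g p = (\<Union>A\<in>g. (*v) A ` p)"


subsection \<open>Isometric spheres and Cygan spheres\<close>

text \<open>The defining condition depends neither on the lift \<open>v\<close> of the point nor on the
  representative \<open>A\<close>, so that quantifying over all of them is harmless.\<close>

definition isometric_sphere :: "(complex^3^3) set \<Rightarrow> (complex^3) set set" where
  "isometric_sphere g =
     {p \<in> CH2 \<union> bd_CH2. \<forall>A\<in>g. \<forall>v\<in>p.
        cmod (herm v q_inf_lift) = cmod (herm v (matrix_inv A *v q_inf_lift))}"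

definition cygan_fun :: "complex \<Rightarrow> real \<Rightarrow> complex \<Rightarrow> real \<Rightarrow> real \<Rightarrow> real" where
  "cygan_fun w s z t u =
     cmod (complex_of_real ((cmod (z - w))\<^sup>2 + u)
           - \<i> * complex_of_real (t - s + 2 * Im (z * cnj w)))"

lemma cmod_herm_hlift: "cmod (herm (hlift z t u) (hlift w s 0)) = cygan_fun w s z t u / 2"
proof -
  have "2 * herm (hlift z t u) (hlift w s 0) =
      - (complex_of_real ((cmod (z - w))\<^sup>2 + u)
         - \<i> * complex_of_real (t - s + 2 * Im (z * cnj w)))"
    by (simp add: herm_expand hlift_def vector_3 complex_eq_iff cmod_power2 field_simps)
      (simp add: power2_eq_square algebra_simps)
  then have "cmod (2 * herm (hlift z t u) (hlift w s 0)) = cygan_fun w s z t u"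
    by (simp only: cygan_fun_def norm_minus_cancel)
  then show ?thesis by (simp add: norm_mult)
qed

definition cygan_sphere :: "complex \<Rightarrow> real \<Rightarrow> real \<Rightarrow> (complex^3) set set" where
  "cygan_sphere w s r = {hpoint z t u | z t u. u \<ge> 0 \<and> cygan_fun w s z t u = r\<^sup>2}"

definition cygan_exterior :: "complex \<Rightarrow> real \<Rightarrow> real \<Rightarrow> (complex^3) set set" where
  "cygan_exterior w s r =
     insert q_inf {hpoint z t u | z t u. u \<ge> 0 \<and> cygan_fun w s z t u > r\<^sup>2}"

text \<open>For \<open>g\<close> not fixing \<open>q_inf\<close>, the isometric sphere is the Cygan sphere centred at
  \<open>g\<inverse>(q_inf)\<close> with a certain radius; this determines \<open>w\<close>, \<open>s\<close> and \<open>r\<close> uniquely.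
  (For \<open>g\<close> fixing \<open>q_inf\<close> there is no such centre and the set below is empty.)\<close>

definition isometric_exterior :: "(complex^3^3) set \<Rightarrow> (complex^3) set set" where
  "isometric_exterior g =
     {p. \<exists>w s r. r > 0 \<and> PU_act (inv\<^bsub>PU21\<^esub> g) q_inf = hpoint w s 0 \<and>
                 isometric_sphere g = cygan_sphere w s r \<and> p \<in> cygan_exterior w s r}"


subsection \<open>The group generated by S and T and the domain D\<close>

definition I1_mat :: "real \<Rightarrow> complex^3^3" where
  "I1_mat \<theta> = vector [vector [- 1, 2 * cis \<theta>, 2],
                       vector [0, 1, 2 * cis (- \<theta>)],
                       vector [0, 0, - 1]]"

definition I2_mat :: "real \<Rightarrow> complex^3^3" where
  "I2_mat \<theta> = vector [vector [- 1, - 2 * cis (- \<theta>), 2],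
                       vector [0, 1, - 2 * cis \<theta>],
                       vector [0, 0, - 1]]"

definition I3_mat :: "complex^3^3" where
  "I3_mat = vector [vector [0, 0, 1], vector [0, - 1, 0], vector [1, 0, 0]]"

lemma I_mats_in_SU21:
  "I1_mat \<theta> \<in> carrier SU21" "I2_mat \<theta> \<in> carrier SU21" "I3_mat \<in> carrier SU21"
  by (simp_all add: SU21_def I1_mat_def I2_mat_def I3_mat_def det_3 vec_eq_iff forall_3
      adjoint_mat_def hermH_def map_matrix_def transpose_def matrix_matrix_mult_def sum_3 vector_3
      cis_cnj cis_mult)

definition S_elt :: "real \<Rightarrow> (complex^3^3) set" where
  "S_elt \<theta> = PU_class (I2_mat \<theta> ** I3_mat)"

definition T_elt :: "real \<Rightarrow> (complex^3^3) set" where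
  "T_elt \<theta> = PU_class (I2_mat \<theta> ** I1_mat \<theta>)"

definition Gamma_grp :: "real \<Rightarrow> (complex^3^3) set set" where
  "Gamma_grp \<theta> = generate PU21 {S_elt \<theta>, T_elt \<theta>}"

definition T_conj :: "real \<Rightarrow> int \<Rightarrow> (complex^3^3) set \<Rightarrow> (complex^3^3) set" where
  "T_conj \<theta> k g =
     T_elt \<theta> [^]\<^bsub>PU21\<^esub> k \<otimes>\<^bsub>PU21\<^esub> g \<otimes>\<^bsub>PU21\<^esub> T_elt \<theta> [^]\<^bsub>PU21\<^esub> (- k)"

text \<open>The elements whose conjugates by powers of \<open>T\<close> define the spheres
  \<open>\<I>\<^sup>+\<close>, \<open>\<I>\<^sup>-\<close>, \<open>\<I>\<^sup>\<star>\<close>, \<open>\<I>\<^sup>\<diamond>\<close>, in this order.\<close>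

definition sphere_elts :: "real \<Rightarrow> (complex^3^3) set set" where
  "sphere_elts \<theta> =
     {S_elt \<theta>,
      inv\<^bsub>PU21\<^esub> (S_elt \<theta>),
      S_elt \<theta> [^]\<^bsub>PU21\<^esub> (2::nat),
      (inv\<^bsub>PU21\<^esub> (S_elt \<theta>) \<otimes>\<^bsub>PU21\<^esub> T_elt \<theta>) [^]\<^bsub>PU21\<^esub> (2::nat)}"

definition D_dom :: "real \<Rightarrow> (complex^3) set set" where
  "D_dom \<theta> =
     (\<Inter>k::int. \<Inter>g\<in>sphere_elts \<theta>. cl_CH2 closure_of isometric_exterior (T_conj \<theta> k g))"

definition fundamental_domain_for_cosets ::
    "(complex^3) set set \<Rightarrow> (complex^3^3) set set \<Rightarrow> (complex^3^3) set set \<Rightarrow> bool" where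
  "fundamental_domain_for_cosets D P \<Gamma> \<longleftrightarrow>
     (\<forall>g\<in>P. PU_act g ` D = D) \<and>
     CH2 \<subseteq> (\<Union>g\<in>\<Gamma>. PU_act g ` D) \<and>
     (\<forall>g\<in>\<Gamma>. \<forall>h\<in>\<Gamma>. g <#\<^bsub>PU21\<^esub> P \<noteq> h <#\<^bsub>PU21\<^esub> P \<longrightarrow>
        cl_CH2 interior_of (PU_act g ` D) \<inter> cl_CH2 interior_of (PU_act h ` D) = {})"

datatype gen = gen_S | gen_T

definition gen_elt :: "real \<Rightarrow> gen \<Rightarrow> (complex^3^3) set" where
  "gen_elt \<theta> x = (case x of gen_S \<Rightarrow> S_elt \<theta> | gen_T \<Rightarrow> T_elt \<theta>)"

definition relators :: "gen word set" where
  "relators =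
     {concat (replicate 4 [(gen_S, True)]),
      concat (replicate 4 [(gen_T, False), (gen_S, True)])}"

end

theory Submission
  imports Defs
begin

text \<open>The group is generated by the order-four elements \<open>S = I\<^sub>2I\<^sub>3\<close> and \<open>R = T\<^sup>-\<^sup>1S = I\<^sub>1I\<^sub>3\<close>, with
  \<open>T = S R\<^sup>-\<^sup>1\<close>. In the abstract free product \<open>\<int>/4 * \<int>/4\<close> the cosets of \<open>\<langle>T\<rangle>\<close> are the vertices of a tree-like
  complex of ideal squares, the squares being the translates of \<open>{S\<^sup>j q\<^sub>\<infinity>}\<close> and \<open>{R\<^sup>j q\<^sub>\<infinity>}\<close>, and the
  vertex \<open>g q\<^sub>\<infinity>\<close> has the height \<open>|\<langle>p, g q\<^sub>\<infinity>\<rangle>|\<close> over \<open>p\<close>. The isometric spheres in the definition of \<open>D\<close>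
  compare the height of \<open>q\<^sub>\<infinity>\<close> with those of the vertices sharing a square with it. The main point is that a local minimum of the height is a
  global one: two positivity statements for Hermitian forms (where the bound \<open>cos \<theta> \<ge> 1/2\<close> enters)
  show that the height cannot decrease on both sides of an edge of the complex, so that it does
  not decrease along paths leading away from a local minimum.

  Hence \<open>D\<close> is the Ford domain. Applied to a point close to \<open>q\<^sub>\<infinity>\<close> the statement separates all
  abstract cosets, which gives the presentation and discreteness; discreteness shows that
  heights attain their minimum, so the translates of \<open>D\<close> cover; and on a common open subset of two translates
  two heights agree, hence agree everywhere, so the cosets coincide.\<close>

lemma vec3_eq_iff: "p = q \<longleftrightarrow> p $ 1 = q $ 1 \<and> p $ 2 = q $ 2 \<and> p $ 3 = q $ 3" for p q :: "'a^3"
  by (simp add: vec_eq_iff forall_3)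

definition negv :: "complex^3 \<Rightarrow> bool" where
  "negv p \<longleftrightarrow> Re (herm p p) < 0"

lemma Re_herm_self: "Re (herm p p) = (cmod (p $ 2))\<^sup>2 + 2 * Re (p $ 1 * cnj (p $ 3))"
  by (simp add: herm_expand cmod_power2) (simp add: algebra_simps power2_eq_square)

subsection \<open>Heights of the vertices of a square\<close>

locale cusp_angle =
  fixes \<theta> :: real
  assumes cos_ge_half: "cos \<theta> \<ge> 1 / 2"
begin

text \<open>The index \<open>True\<close> refers to the order-four element \<open>S = I\<^sub>2I\<^sub>3\<close>, the index \<open>False\<close> to
  \<open>T\<^sup>-\<^sup>1S = I\<^sub>1I\<^sub>3\<close>; the real reflection \<open>z \<mapsto> - cnj z\<close> exchanges them.\<close>

definition E :: "bool \<Rightarrow> complex" where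
  "E \<sigma> = Complex (if \<sigma> then cos \<theta> else - cos \<theta>) (sin \<theta>)"

definition J :: "bool \<Rightarrow> complex^3^3" where
  "J \<sigma> = (if \<sigma> then I2_mat \<theta> else I1_mat \<theta>)"

lemma E_True: "E True = cis \<theta>" and E_False: "E False = - cis (- \<theta>)"
  by (simp_all add: E_def complex_eq_iff)

lemma cmod_E [simp]: "cmod (E \<sigma>) = 1"
  by (simp add: E_def cmod_def)

lemma E_cnj_E [simp]: "E \<sigma> * cnj (E \<sigma>) = 1" "cnj (E \<sigma>) * E \<sigma> = 1"
  by (simp_all add: E_def complex_eq_iff power2_eq_square[symmetric])

lemma Re_E: "Re (E \<sigma>) = (if \<sigma> then cos \<theta> else - cos \<theta>)"
  by (simp add: E_def)

text \<open>The real part is \<open>- cos (2 * \<theta>)\<close>. Both positivity statements below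
  use the restriction on the angle only through this bound.\<close>

lemma Re_E_cnj_E: "Re (E \<sigma> * cnj (E (\<not> \<sigma>))) \<le> 1 / 2"
proof -
  have "(cos \<theta>)\<^sup>2 \<ge> (1 / 2)\<^sup>2"
    using cos_ge_half by (intro power_mono) auto
  moreover have "(sin \<theta>)\<^sup>2 = 1 - (cos \<theta>)\<^sup>2" by (simp add: sin_squared_eq)
  ultimately show ?thesis
    by (cases \<sigma>) (simp_all add: E_def power2_eq_square)
qed

lemma J_mult:
  "(J \<sigma> *v p) $ 1 = - p $ 1 - 2 * cnj (E \<sigma>) * p $ 2 + 2 * p $ 3"
  "(J \<sigma> *v p) $ 2 = p $ 2 - 2 * E \<sigma> * p $ 3"
  "(J \<sigma> *v p) $ 3 = - p $ 3"
  by (cases \<sigma>; simp add: J_def I1_mat_def I2_mat_def E_True E_False matrix_vector_mult_def sum_3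
      vector_3 cis_cnj)+

lemma I3_mult:
  "(I3_mat *v p) $ 1 = p $ 3" "(I3_mat *v p) $ 2 = - p $ 2" "(I3_mat *v p) $ 3 = p $ 1"
  by (simp_all add: I3_mat_def matrix_vector_mult_def sum_3 vector_3)

lemma J_J [simp]: "J \<sigma> *v (J \<sigma> *v p) = p"
  by (simp add: vec3_eq_iff J_mult algebra_simps)

lemma I3_I3 [simp]: "I3_mat *v (I3_mat *v p) = p"
  by (simp add: vec3_eq_iff I3_mult)

text \<open>The inverses of \<open>S\<close> and \<open>T\<^sup>-\<^sup>1S\<close>.\<close>

definition Q :: "bool \<Rightarrow> complex^3 \<Rightarrow> complex^3" where
  "Q \<sigma> p = I3_mat *v (J \<sigma> *v p)"

definition P :: "bool \<Rightarrow> complex^3 \<Rightarrow> complex^3" where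
  "P \<sigma> p = J \<sigma> *v (I3_mat *v p)"

lemma P_Q [simp]: "P \<sigma> (Q \<sigma> p) = p" and Q_P [simp]: "Q \<sigma> (P \<sigma> p) = p"
  by (simp_all add: P_def Q_def)

lemma I3_Q: "I3_mat *v Q \<sigma> p = P \<sigma> (I3_mat *v p)"
  by (simp add: P_def Q_def)

lemma P_nth:
  "P \<sigma> p $ 1 = 2 * p $ 1 + 2 * cnj (E \<sigma>) * p $ 2 - p $ 3"
  "P \<sigma> p $ 2 = - 2 * E \<sigma> * p $ 1 - p $ 2"
  "P \<sigma> p $ 3 = - p $ 1"
  by (simp_all add: P_def J_mult I3_mult)

lemma Q_nth:
  "Q \<sigma> p $ 1 = - p $ 3"
  "Q \<sigma> p $ 2 = - p $ 2 + 2 * E \<sigma> * p $ 3"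
  "Q \<sigma> p $ 3 = - p $ 1 - 2 * cnj (E \<sigma>) * p $ 2 + 2 * p $ 3"
  by (simp_all add: Q_def J_mult I3_mult)

text \<open>Since \<open>P \<sigma>\<close> and \<open>Q \<sigma>\<close> are inverse to each other,
  this gives \<open>P \<sigma>\<close> fourth power one as a matrix, not merely up to a scalar; the
  relators hold exactly.\<close>

lemma Q_Q: "Q \<sigma> (Q \<sigma> p) = P \<sigma> (P \<sigma> p)"
  by (simp add: vec3_eq_iff P_nth Q_nth algebra_simps)

lemma P_fourfold: "P \<sigma> (P \<sigma> (P \<sigma> (P \<sigma> p))) = p"
  by (simp flip: Q_Q)

text \<open>The height of the vertex \<open>g q\<^sub>\<infinity>\<close> over \<open>p\<close> is \<open>|(g\<^sup>-\<^sup>1p)\<^sub>3|\<close>. The heights of the four vertices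
  \<open>P \<sigma>\<^sup>j q\<^sub>\<infinity>\<close> of a square are the moduli of \<open>p\<^sub>3\<close> (for \<open>q\<^sub>\<infinity>\<close>), \<open>p\<^sub>1\<close> (for \<open>S\<^sup>-\<^sup>1q\<^sub>\<infinity>\<close>, which lies on
  both squares), \<open>nbr \<sigma> p\<close> (the other neighbour of \<open>q\<^sub>\<infinity>\<close>) and \<open>opp \<sigma> p\<close> (the vertex opposite
  to \<open>q\<^sub>\<infinity>\<close>). The involution \<open>I\<^sub>3\<close> flips the common edge of the two squares.\<close>

definition nbr :: "bool \<Rightarrow> complex^3 \<Rightarrow> complex" where
  "nbr \<sigma> p = - p $ 1 - 2 * cnj (E \<sigma>) * p $ 2 + 2 * p $ 3"

definition opp :: "bool \<Rightarrow> complex^3 \<Rightarrow> complex" where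
  "opp \<sigma> p = 2 * p $ 1 + 2 * cnj (E \<sigma>) * p $ 2 - p $ 3"

lemma opp_I3: "opp \<sigma> (I3_mat *v p) = nbr \<sigma> p" and nbr_I3: "nbr \<sigma> (I3_mat *v p) = opp \<sigma> p"
  by (simp_all add: nbr_def opp_def I3_mult)

lemma negv_I3: "negv (I3_mat *v p) \<longleftrightarrow> negv p"
  by (simp add: negv_def Re_herm_self I3_mult) (simp add: algebra_simps)

lemma herm_J: "herm (J \<sigma> *v p) (J \<sigma> *v q) = herm p q"
  by (simp add: herm_expand J_mult algebra_simps)

lemma herm_I3: "herm (I3_mat *v p) (I3_mat *v q) = herm p q"
  by (simp add: herm_expand I3_mult)

lemma negv_nonzero: assumes "negv p" shows "p $ 3 \<noteq> 0" "p $ 1 \<noteq> 0"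
  using assms by (auto simp: negv_def Re_herm_self not_less)


subsection \<open>Local estimates\<close>

text \<open>In the limiting case \<open>\<theta> = pi / 3\<close> the Hermitian form on the left is degenerate: this is where
  the bound on \<open>\<theta>\<close> enters.\<close>

lemma form_nbr_opp:
  "(cmod (p $ 2))\<^sup>2 + 2 * Re (p $ 1 * cnj (p $ 3)) +
     ((cmod (nbr \<sigma> p))\<^sup>2 + (cmod (opp (\<not> \<sigma>) p))\<^sup>2 - (cmod (p $ 3))\<^sup>2 - (cmod (p $ 1))\<^sup>2) / 2 \<ge> 0"
    (is "?F \<ge> 0")
proof -
  define a b where "a = E \<sigma>" and "b = E (\<not> \<sigma>)"
  define x y z where "x = p $ 1" and "y = p $ 2" and "z = p $ 3"
  define \<rho> where "\<rho> = a * cnj b"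
  define g where "g = Re \<rho>"
  have a: "a * cnj a = 1" and b: "b * cnj b = 1" by (simp_all add: a_def b_def)
  have g: "g \<le> 1 / 2" using Re_E_cnj_E by (simp add: g_def \<rho>_def a_def b_def)
  have cr: "cmod \<rho> = 1" by (simp add: \<rho>_def norm_mult a_def b_def)
  have Im2: "(Im \<rho>)\<^sup>2 = 1 - g\<^sup>2"
    using cmod_power2[of \<rho>] by (simp add: cr g_def)
  have g1: "g \<ge> -1" using abs_Re_le_cmod[of \<rho>] by (simp add: cr g_def)
  \<comment> \<open>Completing the square in \<open>y\<close> produces \<open>5 * y + u\<close>; up
    to a factor, \<open>m\<close> is the coefficient of the cross term in \<open>x\<close> and
    \<open>z\<close> that is left.\<close>
  define u where "u = (a + 2 * b) * x - (2 * a + b) * z"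
  define m where "m = -1 + \<rho> + 4 * cnj \<rho>"
  have sq: "complex_of_real ((cmod w)\<^sup>2) = w * cnj w" for w by (simp only: complex_norm_square)
  have re: "complex_of_real (2 * Re w) = w + cnj w" for w
    by (simp add: complex_eq_iff)
  have "complex_of_real (10 * ?F) = complex_of_real (2 * (cmod (5 * y + u))\<^sup>2 +
      2 * (5 - 4 * g) * ((cmod x)\<^sup>2 + (cmod z)\<^sup>2) + 4 * Re (x * cnj z * m))"
  proof -
    have "complex_of_real (10 * ?F) = 10 * (y * cnj y) + 10 * (x * cnj z + cnj (x * cnj z)) +
       5 * (nbr \<sigma> p * cnj (nbr \<sigma> p) + opp (\<not> \<sigma>) p * cnj (opp (\<not> \<sigma>) p) - z * cnj z - x * cnj x)"
      by (simp only: re[symmetric] sq[symmetric] x_def y_def z_def)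
        (simp add: field_simps)
    also have "\<dots> = 2 * ((5 * y + u) * cnj (5 * y + u))
       + 2 * (5 - 2 * (\<rho> + cnj \<rho>)) * (x * cnj x + z * cnj z)
       + 2 * (x * cnj z * m + cnj (x * cnj z * m))"
      \<comment> \<open>A polynomial identity with the conjugates as independent variables, modulo
        the relations \<open>a\<close> and \<open>b\<close>.\<close>
      using a b unfolding nbr_def opp_def u_def m_def \<rho>_def a_def[symmetric] b_def[symmetric]
        x_def[symmetric] y_def[symmetric] z_def[symmetric] complex_cnj_mult complex_cnj_add
        complex_cnj_diff complex_cnj_minus complex_cnj_numeral complex_cnj_one complex_cnj_cnj
      by algebra
    also have "\<dots> = complex_of_real (2 * (cmod (5 * y + u))\<^sup>2 +
      2 * (5 - 4 * g) * ((cmod x)\<^sup>2 + (cmod z)\<^sup>2) + 4 * Re (x * cnj z * m))"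
    proof -
      have "\<rho> + cnj \<rho> = complex_of_real (2 * g)" by (simp only: re g_def)
      moreover have "x * cnj z * m + cnj (x * cnj z * m) = complex_of_real (2 * Re (x * cnj z * m))"
        by (simp only: re)
      ultimately show ?thesis
        by (simp only: sq[symmetric]) simp
    qed
    finally show ?thesis .
  qed
  then have F: "10 * ?F = 2 * (cmod (5 * y + u))\<^sup>2 +
      2 * (5 - 4 * g) * ((cmod x)\<^sup>2 + (cmod z)\<^sup>2) + 4 * Re (x * cnj z * m)"
    using of_real_eq_iff by blast
  \<comment> \<open>The remaining form in \<open>x\<close> and \<open>z\<close> is nonnegative once
    \<open>cmod m \<le> 5 - 4 * g\<close>; the difference of the squares is
    \<open>15 * (1 - 2 * g)\<close>.\<close>
  have "(cmod m)\<^sup>2 = (-1 + 5 * g)\<^sup>2 + 9 * (Im \<rho>)\<^sup>2"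
    unfolding cmod_power2 by (simp add: m_def g_def power2_eq_square algebra_simps)
  also have "\<dots> = (5 - 4 * g)\<^sup>2 - 15 * (1 - 2 * g)"
    unfolding Im2 by (simp add: power2_eq_square algebra_simps)
  also have "\<dots> \<le> (5 - 4 * g)\<^sup>2" using g by simp
  finally have m: "cmod m \<le> 5 - 4 * g" by (rule power2_le_imp_le) (use g in simp)
  have "- Re (x * cnj z * m) \<le> cmod x * cmod z * (5 - 4 * g)"
  proof -
    have "- Re (x * cnj z * m) \<le> cmod (x * cnj z * m)"
      using abs_Re_le_cmod[of "x * cnj z * m"] by linarith
    also have "\<dots> \<le> cmod x * cmod z * (5 - 4 * g)"
      using m by (simp add: norm_mult mult_left_mono)
    finally show ?thesis .
  qed
  moreover have "(5 - 4 * g) * (cmod x - cmod z)\<^sup>2 \<ge> 0" using g by simp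
  ultimately have "(5 - 4 * g) * ((cmod x)\<^sup>2 + (cmod z)\<^sup>2) + 2 * Re (x * cnj z * m) \<ge> 0"
    by (simp add: power2_eq_square algebra_simps)
  moreover have "(cmod (5 * y + u))\<^sup>2 \<ge> 0" by simp
  ultimately have "10 * ?F \<ge> 0" unfolding F by argo
  moreover have "0 \<le> r" if "0 \<le> 10 * r" for r :: real using that by simp
  ultimately show ?thesis by blast
qed

text \<open>Twice the form is an explicit sum of squared moduli, whose coefficients
  \<open>2 * (1 - 2 * g)\<close> and \<open>2 * (1 - g)\<close> are nonnegative by
  \<open>g \<le> 1 / 2\<close>.\<close>

lemma form_nbr_nbr:
  "(cmod (p $ 2))\<^sup>2 + 2 * Re (p $ 1 * cnj (p $ 3)) +
     ((cmod (nbr \<sigma> p))\<^sup>2 + (cmod (nbr (\<not> \<sigma>) p))\<^sup>2) / 2 - (cmod (p $ 3))\<^sup>2 \<ge> 0"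
    (is "?F \<ge> 0")
proof -
  define a b where "a = E \<sigma>" and "b = E (\<not> \<sigma>)"
  define x y z where "x = p $ 1" and "y = p $ 2" and "z = p $ 3"
  define \<rho> where "\<rho> = a * cnj b"
  define g where "g = Re \<rho>"
  have a: "a * cnj a = 1" and b: "b * cnj b = 1" by (simp_all add: a_def b_def)
  have g: "g \<le> 1 / 2" using Re_E_cnj_E by (simp add: g_def \<rho>_def a_def b_def)
  have sq: "complex_of_real ((cmod w)\<^sup>2) = w * cnj w" for w by (simp only: complex_norm_square)
  have re: "complex_of_real (2 * Re w) = w + cnj w" for w
    by (simp add: complex_eq_iff)
  \<comment> \<open>The mean of the two neighbour terms. Their difference is a multiple of
    \<open>y\<close>, so the parallelogram law separates the two contributions.\<close>
  define M where "M = - x - cnj (a + b) * y + 2 * z"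
  have "complex_of_real (2 * ?F) = complex_of_real (2 * (cmod (M - z))\<^sup>2 + 2 * (1 - 2 * g) * (cmod y)\<^sup>2
     + (cmod (2 * y - (a + b) * z))\<^sup>2 + 2 * (1 - g) * (cmod z)\<^sup>2)"
  proof -
    have "complex_of_real (2 * ?F) = 2 * (y * cnj y) + 2 * (x * cnj z + cnj (x * cnj z)) +
       (nbr \<sigma> p * cnj (nbr \<sigma> p) + nbr (\<not> \<sigma>) p * cnj (nbr (\<not> \<sigma>) p)) - 2 * (z * cnj z)"
      by (simp only: re[symmetric] sq[symmetric] x_def y_def z_def)
        (simp add: algebra_simps)
    also have "\<dots> = 2 * ((M - z) * cnj (M - z)) + 2 * (1 - (\<rho> + cnj \<rho>)) * (y * cnj y)
       + (2 * y - (a + b) * z) * cnj (2 * y - (a + b) * z) + (2 - (\<rho> + cnj \<rho>)) * (z * cnj z)"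
      using a b unfolding nbr_def M_def \<rho>_def a_def[symmetric] b_def[symmetric]
        x_def[symmetric] y_def[symmetric] z_def[symmetric] complex_cnj_mult complex_cnj_add
        complex_cnj_diff complex_cnj_minus complex_cnj_numeral complex_cnj_one complex_cnj_cnj
      by algebra
    also have "\<dots> = complex_of_real (2 * (cmod (M - z))\<^sup>2 + 2 * (1 - 2 * g) * (cmod y)\<^sup>2
     + (cmod (2 * y - (a + b) * z))\<^sup>2 + 2 * (1 - g) * (cmod z)\<^sup>2)"
    proof -
      have "\<rho> + cnj \<rho> = complex_of_real (2 * g)" by (simp only: re g_def)
      then show ?thesis
        by (simp only: sq[symmetric]) simp
    qed
    finally show ?thesis .
  qed
  then have F: "2 * ?F = 2 * (cmod (M - z))\<^sup>2 + 2 * (1 - 2 * g) * (cmod y)\<^sup>2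
     + (cmod (2 * y - (a + b) * z))\<^sup>2 + 2 * (1 - g) * (cmod z)\<^sup>2"
    using of_real_eq_iff by blast
  have "2 * ?F \<ge> 0"
    unfolding F using g by (intro add_nonneg_nonneg mult_nonneg_nonneg) auto
  moreover have "0 \<le> r" if "0 \<le> 2 * r" for r :: real using that by simp
  ultimately show ?thesis by blast
qed

text \<open>Let \<open>p\<close> be normalised so that the edge under consideration joins \<open>q\<^sub>\<infinity>\<close> to \<open>S\<^sup>-\<^sup>1q\<^sub>\<infinity>\<close> and is crossed
  from the square \<open>\<not> \<sigma>\<close> into the square \<open>\<sigma>\<close>. Either some other vertex of the square being left is at
  least as low as both ends of the edge (\<open>near\<close>), or the path of squares has been turning around the
  lower end, and then the Heisenberg coordinate \<open>p\<^sub>2/p\<^sub>3\<close> of \<open>p\<close> seen from that end lags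
  behind (\<open>fan\<close>). This alternative is the invariant which propagates along a path of squares.\<close>

definition near :: "bool \<Rightarrow> complex^3 \<Rightarrow> bool" where
  "near \<sigma> p \<longleftrightarrow> (\<exists>w\<in>{nbr (\<not> \<sigma>) p, opp (\<not> \<sigma>) p}. cmod w \<le> cmod (p $ 1) \<and> cmod w \<le> cmod (p $ 3))"

text \<open>The sign is that of the reflection exchanging the two indices. The threshold is the edge
  of the cylinder in \<open>opp_cylinder\<close>, and by \<open>cos \<theta> \<ge> 1 / 2\<close> it
  also keeps outside the cylinder in \<open>nbr_cylinder\<close>.\<close>

definition fan :: "bool \<Rightarrow> complex^3 \<Rightarrow> bool" where
  "fan \<sigma> p \<longleftrightarrow> cmod (p $ 3) \<le> cmod (p $ 1) \<and>
     (if \<sigma> then 1 else - 1) * Re (p $ 2 / p $ 3) \<le> cos \<theta> - 1"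

definition away :: "bool \<Rightarrow> complex^3 \<Rightarrow> bool" where
  "away \<sigma> p \<longleftrightarrow> near \<sigma> p \<or> fan \<sigma> p \<or> fan \<sigma> (I3_mat *v p)"

lemma near_I3: "near \<sigma> (I3_mat *v p) \<longleftrightarrow> near \<sigma> p"
  by (auto simp: near_def I3_mult nbr_I3 opp_I3)

lemma away_I3: "away \<sigma> (I3_mat *v p) \<longleftrightarrow> away \<sigma> p"
  by (auto simp: away_def near_I3)

text \<open>In Heisenberg coordinates \<open>z = p\<^sub>2/p\<^sub>3\<close>, the interior of a Cygan sphere lies in a vertical cylinder.\<close>

lemma nbr_cylinder:
  assumes "negv p" "cmod (nbr \<sigma> p) \<le> cmod (p $ 3)"
  shows "(cmod (p $ 2 / p $ 3 - 2 * E \<sigma>))\<^sup>2 < 2"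
proof -
  have p3: "p $ 3 \<noteq> 0" using negv_nonzero assms by blast
  define x z where "x = p $ 1 / p $ 3" and "z = p $ 2 / p $ 3"
  have x: "p $ 1 = x * p $ 3" and z: "p $ 2 = z * p $ 3"
    using p3 by (simp_all add: x_def z_def)
  have "nbr \<sigma> p = (- x - 2 * cnj (E \<sigma>) * z + 2) * p $ 3"
    by (simp add: nbr_def x z algebra_simps)
  then have n: "cmod (- x - 2 * cnj (E \<sigma>) * z + 2) \<le> 1"
    using assms(2) p3 by (simp add: norm_mult)
  have "Re (herm p p) = ((cmod z)\<^sup>2 + 2 * Re x) * (cmod (p $ 3))\<^sup>2"
  proof -
    have "p $ 1 * cnj (p $ 3) = x * complex_of_real ((cmod (p $ 3))\<^sup>2)"
      by (simp only: x complex_norm_square mult.assoc)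
    then show ?thesis
      by (simp add: Re_herm_self z norm_mult power_mult_distrib algebra_simps)
  qed
  then have neg: "(cmod z)\<^sup>2 + 2 * Re x < 0"
    using assms(1) by (simp add: negv_def mult_less_0_iff)
  \<comment> \<open>Only the real part of the normalised height is kept; adding \<open>neg\<close>
    completes the square around \<open>2 * E \<sigma>\<close>.\<close>
  have "Re (- x - 2 * cnj (E \<sigma>) * z + 2) \<le> 1"
    using n complex_Re_le_cmod order.trans by blast
  moreover have "(cmod (z - 2 * E \<sigma>))\<^sup>2 = (cmod z)\<^sup>2 - 4 * Re (cnj (E \<sigma>) * z) + 4 * (cmod (E \<sigma>))\<^sup>2"
    unfolding cmod_power2 by (simp add: power2_eq_square algebra_simps)
  ultimately show ?thesis
    using neg by (simp add: z_def[symmetric])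
qed

lemma opp_cylinder:
  assumes "negv p" "cmod (opp \<sigma> p) \<le> cmod (p $ 3)"
  shows "(cmod (p $ 2 / p $ 3 - E \<sigma>))\<^sup>2 < 1"
proof -
  have p3: "p $ 3 \<noteq> 0" using negv_nonzero assms by blast
  define x z where "x = p $ 1 / p $ 3" and "z = p $ 2 / p $ 3"
  have x: "p $ 1 = x * p $ 3" and z: "p $ 2 = z * p $ 3"
    using p3 by (simp_all add: x_def z_def)
  have "opp \<sigma> p = (2 * x + 2 * cnj (E \<sigma>) * z - 1) * p $ 3"
    by (simp add: opp_def x z algebra_simps)
  then have n: "cmod (2 * x + 2 * cnj (E \<sigma>) * z - 1) \<le> 1"
    using assms(2) p3 by (simp add: norm_mult)
  have "Re (herm p p) = ((cmod z)\<^sup>2 + 2 * Re x) * (cmod (p $ 3))\<^sup>2"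
  proof -
    have "p $ 1 * cnj (p $ 3) = x * complex_of_real ((cmod (p $ 3))\<^sup>2)"
      by (simp only: x complex_norm_square mult.assoc)
    then show ?thesis
      by (simp add: Re_herm_self z norm_mult power_mult_distrib algebra_simps)
  qed
  then have neg: "(cmod z)\<^sup>2 + 2 * Re x < 0"
    using assms(1) by (simp add: negv_def mult_less_0_iff)
  have "- Re (2 * x + 2 * cnj (E \<sigma>) * z - 1) \<le> 1"
    using n abs_Re_le_cmod[of "2 * x + 2 * cnj (E \<sigma>) * z - 1"] by linarith
  moreover have "(cmod (z - E \<sigma>))\<^sup>2 = (cmod z)\<^sup>2 - 2 * Re (cnj (E \<sigma>) * z) + (cmod (E \<sigma>))\<^sup>2"
    unfolding cmod_power2 by (simp add: power2_eq_square algebra_simps)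
  ultimately show ?thesis
    using neg by (simp add: z_def[symmetric])
qed

lemma sqrt2_bounds: "sqrt 2 < (1.415::real)"
  by (rule real_less_lsqrt) (simp_all add: power2_eq_square)

lemma Re_E_sign: "Re (E \<sigma>) = (if \<sigma> then 1 else - 1) * cos \<theta>"
  by (simp add: E_def)

text \<open>The cylinder is projected to the real axis, with a rational bound for
  \<open>sqrt 2\<close> that keeps the later comparisons linear.\<close>

lemma nbr_strip:
  assumes "negv p" "cmod (nbr \<sigma> p) \<le> cmod (p $ 3)"
  shows "(if \<sigma> then 1 else - 1) * Re (p $ 2 / p $ 3) > 2 * cos \<theta> - 1.415"
proof -
  have "\<bar>Re (p $ 2 / p $ 3 - 2 * E \<sigma>)\<bar> < sqrt 2"
    using nbr_cylinder[OF assms] abs_Re_le_cmod[of "p $ 2 / p $ 3 - 2 * E \<sigma>"]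
    by (meson order.strict_trans1 real_less_rsqrt)
  then have "\<bar>Re (p $ 2 / p $ 3) - 2 * Re (E \<sigma>)\<bar> < 1.415"
    using sqrt2_bounds by simp
  then show ?thesis unfolding abs_less_iff by (cases \<sigma>) (simp_all add: Re_E_sign)
qed

lemma opp_strip:
  assumes "negv p" "cmod (opp \<sigma> p) \<le> cmod (p $ 3)"
  shows "(if \<sigma> then 1 else - 1) * Re (p $ 2 / p $ 3) > cos \<theta> - 1"
proof -
  have "\<bar>Re (p $ 2 / p $ 3 - E \<sigma>)\<bar> < sqrt 1"
    using opp_cylinder[OF assms] abs_Re_le_cmod[of "p $ 2 / p $ 3 - E \<sigma>"]
    by (meson order.strict_trans1 real_less_rsqrt)
  then have "\<bar>Re (p $ 2 / p $ 3) - Re (E \<sigma>)\<bar> < 1"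
    by simp
  then show ?thesis unfolding abs_less_iff by (cases \<sigma>) (simp_all add: Re_E_sign)
qed

section \<open>Propagation of the invariant across an edge\<close>

lemma negv_form: "negv p \<longleftrightarrow> (cmod (p $ 2))\<^sup>2 + 2 * Re (p $ 1 * cnj (p $ 3)) < 0"
  by (simp add: negv_def Re_herm_self)

text \<open>If both neighbours were as low as \<open>q_inf\<close>, the terms that
  \<open>form_nbr_nbr\<close> adds to the negative number \<open>herm p p\<close> would be
  nonpositive.\<close>

lemma fork_nbr_nbr:
  assumes "negv p" "cmod (nbr \<sigma> p) \<le> cmod (p $ 3)"
  shows "cmod (nbr (\<not> \<sigma>) p) > cmod (p $ 3)"
proof (rule ccontr)
  assume "\<not> ?thesis"
  then have "(cmod (nbr \<sigma> p))\<^sup>2 \<le> (cmod (p $ 3))\<^sup>2" "(cmod (nbr (\<not> \<sigma>) p))\<^sup>2 \<le> (cmod (p $ 3))\<^sup>2"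
    using assms by (auto intro: power_mono)
  then show False
    using assms(1) form_nbr_nbr[of p \<sigma>] unfolding negv_form by argo
qed

lemma fork_nbr_opp:
  assumes "negv p" "cmod (nbr \<sigma> p) \<le> cmod (p $ 3)" "cmod (p $ 3) \<le> cmod (p $ 1)"
  shows "cmod (opp (\<not> \<sigma>) p) > cmod (p $ 3)"
proof (rule ccontr)
  assume "\<not> ?thesis"
  then have "(cmod (nbr \<sigma> p))\<^sup>2 \<le> (cmod (p $ 3))\<^sup>2" "(cmod (opp (\<not> \<sigma>) p))\<^sup>2 \<le> (cmod (p $ 3))\<^sup>2"
    "(cmod (p $ 3))\<^sup>2 \<le> (cmod (p $ 1))\<^sup>2"
    using assms by (auto intro: power_mono)
  then show False
    using assms(1) form_nbr_opp[of p \<sigma>] unfolding negv_form by argo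
qed

text \<open>Under \<open>near\<close>, low vertices on both sides of the edge contradict the fork
  lemmas; under \<open>fan\<close>, the Heisenberg coordinate lies outside the cylinders that a low
  vertex requires.\<close>

lemma away_far:
  assumes "negv p" "away \<sigma> p" "w \<in> {nbr \<sigma> p, opp \<sigma> p}"
  shows "min (cmod (p $ 1)) (cmod (p $ 3)) \<le> cmod w"
proof -
  \<comment> \<open>By the flip \<open>I3_mat\<close> the lower end of the edge may be taken to be
    \<open>q_inf\<close>.\<close>
  have *: "cmod (q $ 3) \<le> cmod w" 
    if q: "negv q" "away \<sigma> q" "w \<in> {nbr \<sigma> q, opp \<sigma> q}" "cmod (q $ 3) \<le> cmod (q $ 1)" for q
  proof (rule ccontr)
    assume "\<not> ?thesis"
    then have w: "cmod w < cmod (q $ 3)" by simp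
    consider "near \<sigma> q" | "fan \<sigma> q" | "fan \<sigma> (I3_mat *v q)" "cmod (q $ 3) = cmod (q $ 1)"
      using q(2,4) by (auto simp: away_def fan_def I3_mult)
    then show False
    proof cases
      case 1
      consider "cmod (nbr (\<not> \<sigma>) q) \<le> cmod (q $ 3)"
        | "cmod (opp (\<not> \<sigma>) q) \<le> cmod (q $ 3)"
        using 1 by (auto simp: near_def)
      then show False
      proof cases
        case 1
        then have "cmod (nbr \<sigma> q) > cmod (q $ 3)" "cmod (opp \<sigma> q) > cmod (q $ 3)"
          using fork_nbr_nbr[of q "\<not> \<sigma>"] fork_nbr_opp[of q "\<not> \<sigma>"] q by auto
        then show False using q w by auto
      next
        case 2
        show False
        proof (cases "w = nbr \<sigma> q")
          case True
          then show False using fork_nbr_opp[of q \<sigma>] q w 2 by auto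
        next
          case False
          \<comment> \<open>The two opposite vertices are neighbours of the other end of the edge,
            which the flip moves to \<open>q_inf\<close>. That end is at least as high, so
            \<open>fork_nbr_nbr\<close> applies there.\<close>
          let ?r = "I3_mat *v q"
          have "cmod (nbr \<sigma> ?r) \<le> cmod (?r $ 3)" "cmod (nbr (\<not> \<sigma>) ?r) \<le> cmod (?r $ 3)"
            using False q w 2 by (auto simp: nbr_I3 I3_mult)
          then show False using fork_nbr_nbr[of ?r \<sigma>] q by (auto simp: negv_I3)
        qed
      qed
    next
      case 2
      then show False
        using nbr_strip[OF q(1), of \<sigma>] opp_strip[OF q(1), of \<sigma>] q(3) w cos_ge_half
        by (auto simp: fan_def split: if_splits)
    next
      case 3
      let ?r = "I3_mat *v q"
      have "negv ?r" "w \<in> {nbr \<sigma> ?r, opp \<sigma> ?r}" "cmod w < cmod (?r $ 3)"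
        using q 3 w by (auto simp: negv_I3 nbr_I3 opp_I3 I3_mult)
      then show False
        using nbr_strip[of ?r \<sigma>] opp_strip[of ?r \<sigma>] 3 cos_ge_half
        by (auto simp: fan_def split: if_splits)
    qed
  qed
  show ?thesis
  proof (cases "cmod (p $ 3) \<le> cmod (p $ 1)")
    case True
    then show ?thesis using *[OF assms] by simp
  next
    case False
    then show ?thesis
      using *[of "I3_mat *v p"] assms by (auto simp: negv_I3 away_I3 nbr_I3 opp_I3 I3_mult)
  qed
qed

lemma nbr_Q: "nbr \<sigma> p = Q \<sigma> p $ 3" and opp_Q: "opp \<sigma> p = - Q \<sigma> (Q \<sigma> p) $ 3"
  by (simp_all add: Q_nth nbr_def opp_def algebra_simps)

lemma Q_fourfold: "Q \<sigma> (Q \<sigma> (Q \<sigma> (Q \<sigma> p))) = p"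
  by (simp only: Q_Q P_fourfold)

lemma Q_thrice: "Q \<sigma> (Q \<sigma> (Q \<sigma> p)) = P \<sigma> p"
  using P_Q[of \<sigma> "Q \<sigma> (Q \<sigma> (Q \<sigma> p))"] by (simp only: Q_fourfold)

text \<open>These are the two edges of the square that avoid \<open>q_inf\<close>. Seen from either
  of them \<open>q_inf\<close> belongs to the square being left, and as its lowest vertex it is the
  witness for \<open>near\<close>.\<close>

lemma near_across:
  assumes "cmod (p $ 3) \<le> cmod (p $ 1)" "cmod (p $ 3) \<le> cmod (nbr \<sigma> p)"
    "cmod (p $ 3) \<le> cmod (opp \<sigma> p)"
  shows "near (\<not> \<sigma>) (Q \<sigma> (Q \<sigma> p))" "near (\<not> \<sigma>) (Q \<sigma> (Q \<sigma> (Q \<sigma> p)))"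
proof -
  show "near (\<not> \<sigma>) (Q \<sigma> (Q \<sigma> p))"
    using assms unfolding near_def by (simp add: opp_Q[of \<sigma> "Q \<sigma> (Q \<sigma> p)"] Q_fourfold)
      (simp add: nbr_Q opp_Q Q_nth(1)[of \<sigma> "Q \<sigma> p"])
  have "Q \<sigma> (Q \<sigma> (Q \<sigma> p)) $ 3 = - p $ 1" by (simp add: Q_thrice P_nth)
  then show "near (\<not> \<sigma>) (Q \<sigma> (Q \<sigma> (Q \<sigma> p)))"
    using assms unfolding near_def by (simp add: nbr_Q[of \<sigma> "Q \<sigma> (Q \<sigma> (Q \<sigma> p))"] Q_fourfold)
      (simp add: nbr_Q opp_Q Q_nth(1)[of \<sigma> "Q \<sigma> (Q \<sigma> p)"])
qed

text \<open>The edges avoiding the lower end inherit \<open>near\<close>. The edge from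
  \<open>q_inf\<close> to its other neighbour continues the turn around \<open>q_inf\<close> and
  inherits \<open>fan\<close>, except in a tie.\<close>

lemma away_step_min_third:
  assumes "negv p" "away \<sigma> p" "cmod (p $ 3) \<le> cmod (p $ 1)"
  shows "away (\<not> \<sigma>) (Q \<sigma> p)" "away (\<not> \<sigma>) (Q \<sigma> (Q \<sigma> p))" "away (\<not> \<sigma>) (Q \<sigma> (Q \<sigma> (Q \<sigma> p)))"
proof -
  have far: "cmod (p $ 3) \<le> cmod (nbr \<sigma> p)" "cmod (p $ 3) \<le> cmod (opp \<sigma> p)"
    using away_far[OF assms(1,2)] assms(3) by auto
  have p3: "p $ 3 \<noteq> 0" using negv_nonzero assms by blast
  show "away (\<not> \<sigma>) (Q \<sigma> (Q \<sigma> p))" "away (\<not> \<sigma>) (Q \<sigma> (Q \<sigma> (Q \<sigma> p)))"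
    using near_across[OF assms(3) far] by (simp_all add: away_def)
  show "away (\<not> \<sigma>) (Q \<sigma> p)"
  proof (cases "cmod (p $ 1) = cmod (p $ 3)")
    case True
    \<comment> \<open>In a tie the other end of the old edge, of height \<open>cmod (p $ 1)\<close>,
      is the witness.\<close>
    then have "near (\<not> \<sigma>) (Q \<sigma> p)"
      using far unfolding near_def by (simp add: opp_Q[of \<sigma> "Q \<sigma> p"] Q_thrice P_nth)
        (simp add: nbr_Q Q_nth(1)[of \<sigma> p])
    then show ?thesis by (simp add: away_def)
  next
    case False
    then consider "fan \<sigma> p" | "cmod (nbr (\<not> \<sigma>) p) \<le> cmod (p $ 3)"
      | "cmod (opp (\<not> \<sigma>) p) \<le> cmod (p $ 3)"
      using assms by (auto simp: away_def near_def fan_def I3_mult)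
    \<comment> \<open>\<open>J \<sigma>\<close> maps the coordinate \<open>z\<close> to
      \<open>2 * E \<sigma> - z\<close>, which turns this threshold into the one in
      \<open>fan (\<not> \<sigma>)\<close>. The \<open>opp\<close> case needs
      \<open>1 - cos \<theta> \<le> 3 * cos \<theta> - 1\<close>, that is, exactly
      \<open>cos \<theta> \<ge> 1 / 2\<close>.\<close>
    then have Re: "(if \<sigma> then 1 else - 1) * Re (p $ 2 / p $ 3) \<le> 3 * cos \<theta> - 1"
    proof cases
      case 1
      then show ?thesis using cos_ge_half by (auto simp: fan_def)
    next
      case 2
      then show ?thesis
        using nbr_strip[OF assms(1) 2] cos_ge_half by (auto split: if_splits)
    next
      case 3
      then show ?thesis
        using opp_strip[OF assms(1) 3] cos_ge_half by (auto split: if_splits)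
    qed
    have "(J \<sigma> *v p) $ 2 / (J \<sigma> *v p) $ 3 = 2 * E \<sigma> - p $ 2 / p $ 3"
      using p3 by (simp add: J_mult field_simps)
    moreover have "(J \<sigma> *v p) $ 1 = nbr \<sigma> p" by (simp add: J_mult nbr_def)
    ultimately have "fan (\<not> \<sigma>) (J \<sigma> *v p)"
      using Re far by (simp add: fan_def J_mult Re_E split: if_splits)
    then show ?thesis by (simp add: away_def Q_def)
  qed
qed

lemma away_step:
  assumes "negv p" "away \<sigma> p"
  shows "away (\<not> \<sigma>) (Q \<sigma> p)" "away (\<not> \<sigma>) (Q \<sigma> (Q \<sigma> p))" "away (\<not> \<sigma>) (Q \<sigma> (Q \<sigma> (Q \<sigma> p)))"
proof -
  have "away (\<not> \<sigma>) (Q \<sigma> p) \<and> away (\<not> \<sigma>) (Q \<sigma> (Q \<sigma> p)) \<and> away (\<not> \<sigma>) (Q \<sigma> (Q \<sigma> (Q \<sigma> p)))"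
  proof (cases "cmod (p $ 3) \<le> cmod (p $ 1)")
    case True
    then show ?thesis using away_step_min_third assms by blast
  next
    case False
    let ?r = "I3_mat *v p"
    \<comment> \<open>Conjugation by the flip replaces \<open>Q \<sigma>\<close> by
      \<open>P \<sigma>\<close>, which is its cube, so the three edges are only permuted.\<close>
    have "away (\<not> \<sigma>) (I3_mat *v Q \<sigma> ?r)" "away (\<not> \<sigma>) (I3_mat *v Q \<sigma> (Q \<sigma> ?r))"
      "away (\<not> \<sigma>) (I3_mat *v Q \<sigma> (Q \<sigma> (Q \<sigma> ?r)))"
      using away_step_min_third[of ?r \<sigma>] assms False by (simp_all add: away_I3 negv_I3 I3_mult)
    then have "away (\<not> \<sigma>) (P \<sigma> p)" "away (\<not> \<sigma>) (P \<sigma> (P \<sigma> p))" "away (\<not> \<sigma>) (P \<sigma> (P \<sigma> (P \<sigma> p)))"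
      by (simp_all add: I3_Q)
    moreover have "P \<sigma> (P \<sigma> (P \<sigma> p)) = Q \<sigma> p"
      using Q_P[of \<sigma> "P \<sigma> (P \<sigma> (P \<sigma> p))"] by (simp only: P_fourfold)
    ultimately show ?thesis by (simp only: Q_thrice Q_Q) simp
  qed
  then show "away (\<not> \<sigma>) (Q \<sigma> p)" "away (\<not> \<sigma>) (Q \<sigma> (Q \<sigma> p))" "away (\<not> \<sigma>) (Q \<sigma> (Q \<sigma> (Q \<sigma> p)))"
    by simp_all
qed

end

subsection \<open>The tree of squares\<close>

definition gen_word :: "bool \<Rightarrow> gen word" where
  "gen_word \<sigma> = (if \<sigma> then [(gen_S, True)] else [(gen_T, False), (gen_S, True)])"

definition pow_word :: "bool \<Rightarrow> nat \<Rightarrow> gen word" where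
  "pow_word \<sigma> j = concat (replicate j (gen_word \<sigma>))"

definition T_word :: "int \<Rightarrow> gen word" where
  "T_word k = (if k \<ge> 0 then replicate (nat k) (gen_T, True) else replicate (nat (- k)) (gen_T, False))"

abbreviation weq :: "gen word \<Rightarrow> gen word \<Rightarrow> bool" (infix "\<simeq>" 50) where
  "u \<simeq> v \<equiv> word_eq relators u v"

lemma relators_eq: "relators = {pow_word True 4, pow_word False 4}"
  by (simp add: relators_def pow_word_def gen_word_def)

lemma pow_word_four: "pow_word \<sigma> 4 \<simeq> []"
  using word_eq.relator[of "pow_word \<sigma> 4" relators "[]" "[]"] by (cases \<sigma>) (simp_all add: relators_eq)

lemma pow_word_Suc: "pow_word \<sigma> j @ gen_word \<sigma> = pow_word \<sigma> (Suc j)"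
  "gen_word \<sigma> @ pow_word \<sigma> j = pow_word \<sigma> (Suc j)"
  by (simp_all add: pow_word_def replicate_append_same[symmetric] del: replicate_append_same)
    (induction j; simp)

lemma weq_cancel_right: "v \<simeq> [] \<Longrightarrow> u @ v \<simeq> u"
  using word_eq_append_left[of relators v "[]" u] by simp

lemma T_word_snoc: "T_word k @ [(gen_T, b)] \<simeq> T_word (k + (if b then 1 else - 1))"
proof -
  consider "b" "k \<ge> 0" | "\<not> b" "k \<le> 0" | "b" "k < 0" | "\<not> b" "k > 0" by linarith
  then show ?thesis
  proof cases
    case 1
    then have "T_word k @ [(gen_T, b)] = T_word (k + (if b then 1 else - 1))"
      by (simp add: T_word_def nat_add_distrib replicate_append_same)
    then show ?thesis by (simp add: word_eq.refl)
  next
    case 2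
    then have "T_word k @ [(gen_T, b)] = T_word (k + (if b then 1 else - 1))"
    proof -
      have "nat (- (k - 1)) = Suc (nat (- k))" using 2 by simp
      then show ?thesis using 2 by (cases "k = 0") (simp_all add: T_word_def replicate_append_same)
    qed
    then show ?thesis by (simp add: word_eq.refl)
  next
    case 3
    then obtain n where n: "k = - int n - 1"
      using that[of "nat (- k - 1)"] by simp
    then have "T_word k = replicate n (gen_T, False) @ [(gen_T, False)]"
      "T_word (k + 1) = replicate n (gen_T, False)"
      by (auto simp: T_word_def nat_add_distrib replicate_append_same)
    then show ?thesis
      using 3 word_eq.cancel[of relators "replicate n (gen_T, False)" gen_T False "[]"] by simp
  next
    case 4
    then obtain n where n: "k = int n + 1"
      using that[of "nat (k - 1)"] by simp
    then have "T_word k = replicate n (gen_T, True) @ [(gen_T, True)]"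
      "T_word (k - 1) = replicate n (gen_T, True)"
      by (auto simp: T_word_def nat_add_distrib replicate_append_same)
    then show ?thesis
      using 4 word_eq.cancel[of relators "replicate n (gen_T, True)" gen_T True "[]"] by simp
  qed
qed

text \<open>\<open>reach \<sigma> w\<close>: the edge from \<open>w q\<^sub>\<infinity>\<close> to \<open>w S\<^sup>-\<^sup>1q\<^sub>\<infinity>\<close>, crossed into the square \<open>w{P \<sigma>\<^sup>j q\<^sub>\<infinity>}\<close>, points
  away from \<open>q\<^sub>\<infinity>\<close> in the tree of squares and is not incident to \<open>q\<^sub>\<infinity>\<close>.\<close>

inductive reach :: "bool \<Rightarrow> gen word \<Rightarrow> bool" where
  root: "j \<in> {2, 3} \<Longrightarrow> reach (\<not> \<sigma>) (T_word k @ pow_word \<sigma> j)"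
| step: "reach \<sigma> w \<Longrightarrow> j \<in> {1, 2, 3} \<Longrightarrow> reach (\<not> \<sigma>) (w @ pow_word \<sigma> j)"

text \<open>Normal forms modulo the relators. The words \<open>T^k S\<close> stand apart because
  their edge ends at \<open>T^k q_inf = q_inf\<close>, whereas \<open>reach\<close> excludes edges
  incident to \<open>q_inf\<close>.\<close>

definition covered :: "gen word \<Rightarrow> bool" where
  "covered w \<longleftrightarrow> (\<exists>w'. w \<simeq> w' \<and>
     ((\<exists>k. w' = T_word k) \<or> (\<exists>k. w' = T_word k @ gen_word True) \<or> (\<exists>\<sigma>. reach \<sigma> w')))"

lemma coveredI:
  "w \<simeq> T_word k \<Longrightarrow> covered w" "w \<simeq> T_word k @ gen_word True \<Longrightarrow> covered w"
  "w \<simeq> w' \<Longrightarrow> reach \<sigma> w' \<Longrightarrow> covered w"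
  by (auto simp: covered_def)

lemma covered_cong: "u \<simeq> v \<Longrightarrow> covered v \<Longrightarrow> covered u"
  unfolding covered_def using word_eq.trans[of relators u v] by blast

lemma T_word_gen_False: "T_word k @ gen_word False \<simeq> T_word (k - 1) @ gen_word True"
  using word_eq_append_right[OF T_word_snoc[of k False], of "gen_word True"]
  by (simp add: gen_word_def)

text \<open>A new syllable either starts the next square or raises the exponent of the last
  syllable; at exponent four a relator deletes that syllable and the shorter normal form
  remains.\<close>

lemma covered_gen:
  assumes "covered w"
  shows "covered (w @ gen_word \<sigma>)"
proof -
  have reach_case: "covered (w' @ gen_word \<sigma>)" if "reach \<sigma>' w'" for \<sigma>' w'
  proof (cases "\<sigma> = \<sigma>'")
    case True
    then show ?thesis
      using reach.step[OF that, of 1] by (intro coveredI(3)[OF word_eq.refl]) (simp add: pow_word_def)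
  next
    case False
    from that show ?thesis
    proof cases
      case (root j \<sigma>'' k)
      with False have s: "\<sigma>'' = \<sigma>" by auto
      consider "j = 2" | "j = 3" using root by auto
      then show ?thesis
      proof cases
        case 1
        then have "reach (\<not> \<sigma>) (w' @ gen_word \<sigma>)"
          using reach.root[of 3 \<sigma> k] root s pow_word_Suc(1)[of \<sigma> 2] by simp
        then show ?thesis using coveredI(3) word_eq.refl by blast
      next
        case 2
        then have "w' @ gen_word \<sigma> = T_word k @ pow_word \<sigma> 4"
          using root s pow_word_Suc(1)[of \<sigma> 3] by simp
        then show ?thesis using weq_cancel_right[OF pow_word_four] coveredI(1) by metis
      qed
    next
      case (step \<sigma>'' v j)
      with False have s: "\<sigma>'' = \<sigma>" by auto
      consider "j \<in> {1, 2}" | "j = 3" using step by auto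
      then show ?thesis
      proof cases
        case 1
        then have "reach (\<not> \<sigma>) (w' @ gen_word \<sigma>)"
          using reach.step[of \<sigma> v "Suc j"] step s pow_word_Suc(1)[of \<sigma> j] by auto
        then show ?thesis using coveredI(3) word_eq.refl by blast
      next
        case 2
        then have "w' @ gen_word \<sigma> = v @ pow_word \<sigma> 4"
          using step s pow_word_Suc(1)[of \<sigma> 3] by simp
        then show ?thesis
          using weq_cancel_right[OF pow_word_four[of \<sigma>], of v] coveredI(3) step(3) by metis
      qed
    qed
  qed
  have T_case: "covered (T_word k @ gen_word \<sigma>)" for k
    using T_word_gen_False[of k] by (cases \<sigma>) (auto intro: coveredI(2) word_eq.refl)
  have TS_case: "covered (T_word k @ gen_word True @ gen_word \<sigma>)" for k
  proof (cases \<sigma>)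
    case True
    have "reach False (T_word k @ pow_word True 2)" using reach.root[of 2 True k] by simp
    then show ?thesis
      using True coveredI(3)[OF word_eq.refl] by (simp add: pow_word_def numeral_2_eq_2)
  next
    case False
    have "reach True (T_word (k + 1) @ pow_word False 2)" using reach.root[of 2 False "k + 1"] by simp
    \<comment> \<open>\<open>T^k S = T^(k+1) (T^-1 S)\<close>, so the appended factor turns a second
      time in the square of index \<open>False\<close>.\<close>
    moreover have "T_word k @ gen_word True @ gen_word \<sigma> \<simeq> T_word (k + 1) @ pow_word False 2"
      using word_eq_append_right[OF word_eq.sym[OF T_word_gen_False[of "k + 1"]], of "gen_word False"] False
      by (simp add: pow_word_def numeral_2_eq_2)
    ultimately show ?thesis using coveredI(3) by blast
  qed
  obtain w' where w': "w \<simeq> w'"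
    "(\<exists>k. w' = T_word k) \<or> (\<exists>k. w' = T_word k @ gen_word True) \<or> (\<exists>\<sigma>. reach \<sigma> w')"
    using assms by (auto simp: covered_def)
  then have "covered (w' @ gen_word \<sigma>)"
    using reach_case T_case TS_case by auto
  then show ?thesis
    using covered_cong word_eq_append_right[OF w'(1)] by blast
qed

lemma covered_pow: "covered w \<Longrightarrow> covered (w @ pow_word \<sigma> j)"
proof (induction j)
  case 0
  then show ?case by (simp add: pow_word_def)
next
  case (Suc j)
  then show ?case using covered_gen[of "w @ pow_word \<sigma> j" \<sigma>] by (simp add: pow_word_Suc(1))
qed

lemma S_inverse_word: "[(gen_S, False)] \<simeq> pow_word True 3"
proof -
  have "[(gen_S, False)] \<simeq> [(gen_S, False)] @ pow_word True 4"
    using weq_cancel_right[OF pow_word_four] word_eq.sym by blast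
  also have "[(gen_S, False)] @ pow_word True 4 = [] @ [(gen_S, False), (gen_S, \<not> False)] @ pow_word True 3"
    by (simp add: pow_word_def gen_word_def numeral_eq_Suc)
  finally show ?thesis
    using word_eq.trans[OF _ word_eq.cancel[of relators "[]" gen_S False "pow_word True 3"]] by simp
qed

lemma T_inverse_word: "[(gen_T, False)] \<simeq> gen_word False @ pow_word True 3"
proof -
  have "gen_word False @ pow_word True 3 \<simeq> gen_word False @ [(gen_S, False)]"
    by (intro word_eq_append_left word_eq.sym[OF S_inverse_word])
  also have "gen_word False @ [(gen_S, False)] = [(gen_T, False)] @ [(gen_S, True), (gen_S, \<not> True)] @ []"
    by (simp add: gen_word_def)
  finally show ?thesis
    using word_eq.trans[OF _ word_eq.cancel[of relators "[(gen_T, False)]" gen_S True "[]"]]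
    by (simp add: word_eq.sym)
qed

lemma T_letter_word: "[(gen_T, True)] \<simeq> gen_word True @ pow_word False 3"
proof -
  have "[(gen_T, True)] \<simeq> [(gen_T, True)] @ pow_word False 4"
    using weq_cancel_right[OF pow_word_four] word_eq.sym by blast
  also have "[(gen_T, True)] @ pow_word False 4
      = [] @ [(gen_T, True), (gen_T, \<not> True)] @ gen_word True @ pow_word False 3"
    by (simp add: pow_word_def gen_word_def numeral_eq_Suc)
  finally show ?thesis
    using word_eq.trans[OF _ word_eq.cancel[of relators "[]" gen_T True "gen_word True @ pow_word False 3"]]
    by simp
qed

text \<open>Modulo the relators every letter is a product of nonnegative powers of \<open>S\<close>
  and \<open>T^-1 S\<close>, so closure under appending these two suffices.\<close>

lemma covered: "covered w"
proof (induction w rule: rev_induct)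
  case Nil
  show ?case by (rule coveredI(1)[of _ 0]) (simp add: T_word_def word_eq.refl)
next
  case (snoc l w)
  obtain x b where l: "l = (x, b)" by force
  have "\<exists>v. [l] \<simeq> v \<and> covered (w @ v)"
  proof (cases x)
    case gen_S
    then show ?thesis
      using l snoc S_inverse_word covered_gen[of w True] covered_pow[of w True 3]
      by (cases b) (auto simp: gen_word_def intro: word_eq.refl)
  next
    case gen_T
    have "covered (w @ gen_word False @ pow_word True 3)" "covered (w @ gen_word True @ pow_word False 3)"
      using snoc covered_pow[of "w @ gen_word False" True 3] covered_pow[of "w @ gen_word True" False 3]
        covered_gen by auto
    then show ?thesis using gen_T l T_inverse_word T_letter_word by (cases b) auto
  qed
  then show ?case using covered_cong word_eq_append_left by blast
qed

section \<open>Action of words on vectors and height bounds along paths\<close>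

context cusp_angle begin

fun letter_mat :: "gen \<times> bool \<Rightarrow> complex^3^3" where
  "letter_mat (gen_S, True) = J True ** I3_mat"
| "letter_mat (gen_S, False) = I3_mat ** J True"
| "letter_mat (gen_T, True) = J True ** J False"
| "letter_mat (gen_T, False) = J False ** J True"

definition word_mat :: "gen word \<Rightarrow> complex^3^3" where
  "word_mat w = foldr (\<lambda>l A. letter_mat l ** A) w (mat 1)"

text \<open>\<open>pull w\<close> is the action of \<open>w\<^sup>-\<^sup>1\<close>, so the height of \<open>w q\<^sub>\<infinity>\<close> over \<open>p\<close> is \<open>|(pull w p)\<^sub>3|\<close>.\<close>

definition pull :: "gen word \<Rightarrow> complex^3 \<Rightarrow> complex^3" where
  "pull w p = fold (\<lambda>(x, b) p. letter_mat (x, \<not> b) *v p) w p"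

lemma pull_Nil [simp]: "pull [] p = p" and pull_append [simp]: "pull (u @ v) p = pull v (pull u p)"
  by (simp_all add: pull_def)

lemma letter_mat_mult [simp]:
  "letter_mat (gen_S, True) *v p = P True p" "letter_mat (gen_S, False) *v p = Q True p"
  "letter_mat (gen_T, True) *v p = J True *v (J False *v p)"
  "letter_mat (gen_T, False) *v p = J False *v (J True *v p)"
  by (simp_all add: P_def Q_def flip: matrix_vector_mul_assoc)

declare letter_mat.simps [simp del]

lemma letter_mat_inverse: "letter_mat (x, \<not> b) *v (letter_mat (x, b) *v p) = p"
  by (cases x; cases b) simp_all

lemma pull_gen_word: "pull (gen_word \<sigma>) p = Q \<sigma> p"
  by (cases \<sigma>) (simp_all add: pull_def gen_word_def Q_def)

lemma pull_pow_word: "pull (pow_word \<sigma> j) p = (Q \<sigma> ^^ j) p"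
  by (induction j arbitrary: p) (simp_all add: pow_word_def pull_gen_word funpow_swap1)

lemma word_mat_Nil [simp]: "word_mat [] = mat 1"
  by (simp add: word_mat_def)

lemma word_mat_append: "word_mat (u @ v) = word_mat u ** word_mat v"
  by (induction u) (simp_all add: word_mat_def matrix_mul_assoc)

lemma word_mat_Cons: "word_mat (l # w) = letter_mat l ** word_mat w"
  by (simp add: word_mat_def)

lemma word_mat_pull [simp]: "word_mat w *v pull w p = p"
proof (induction w arbitrary: p)
  case (Cons l w)
  obtain x b where l: "l = (x, b)" by force
  have "word_mat (l # w) *v pull (l # w) p = letter_mat l *v (word_mat w *v pull w (letter_mat (x, \<not> b) *v p))"
    by (simp add: word_mat_Cons pull_def l matrix_vector_mul_assoc)
  then show ?case using letter_mat_inverse[of x "\<not> b" p] by (simp add: Cons l)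
qed simp

lemma pull_word_mat [simp]: "pull w (word_mat w *v p) = p"
proof (induction w arbitrary: p)
  case (Cons l w)
  obtain x b where l: "l = (x, b)" by force
  have "pull (l # w) (word_mat (l # w) *v p) = pull w (letter_mat (x, \<not> b) *v (letter_mat l *v (word_mat w *v p)))"
    by (simp add: word_mat_Cons pull_def l flip: matrix_vector_mul_assoc)
  then show ?case by (simp add: Cons l letter_mat_inverse)
qed simp

lemma pull_weq: "u \<simeq> v \<Longrightarrow> pull u p = pull v p"
proof (induction arbitrary: p rule: word_eq.induct)
  case (cancel u x b v)
  have "pull [(x, b), (x, \<not> b)] q = q" for q
    using letter_mat_inverse[of x "\<not> b" q] by (simp add: pull_def)
  then show ?case by (simp del: append_Cons append_Nil)
next
  case (relator r u v)
  then obtain \<sigma> where "r = pow_word \<sigma> 4" by (auto simp: relators_eq)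
  then have "pull r q = q" for q by (simp add: pull_pow_word numeral_eq_Suc Q_fourfold)
  then show ?case by simp
qed auto

lemma word_mat_weq: assumes "u \<simeq> v" shows "word_mat u = word_mat v"
proof -
  have "word_mat u *v p = word_mat v *v p" for p
    using word_mat_pull[of u "word_mat v *v p"] pull_weq[OF assms] by (metis pull_word_mat)
  then show ?thesis by (simp add: matrix_eq)
qed

lemma herm_letter_mat: "herm (letter_mat l *v p) (letter_mat l *v q) = herm p q"
  by (cases l rule: letter_mat.cases) (simp_all add: P_def Q_def herm_J herm_I3)

lemma herm_word_mat: "herm (word_mat w *v p) (word_mat w *v q) = herm p q"
  by (induction w) (simp_all add: word_mat_Cons herm_letter_mat flip: matrix_vector_mul_assoc)

lemma herm_pull: "herm (pull w p) q = herm p (word_mat w *v q)"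
  using herm_word_mat[of w "pull w p" q] by simp

lemma herm_pull_pull: "herm (pull w p) (pull w q) = herm p q"
  by (simp add: herm_pull)

lemma negv_pull [simp]: "negv (pull w p) \<longleftrightarrow> negv p"
  by (simp add: negv_def herm_pull_pull)

text \<open>\<open>T\<close> keeps the height of \<open>q_inf\<close> and translates the Heisenberg
  coordinate \<open>p $ 2 / p $ 3\<close> by a real number.\<close>

lemma pull_T_word:
  "pull (T_word k) p $ 3 = p $ 3" "pull (T_word k) p $ 2 = p $ 2 - 4 * of_int k * cos \<theta> * p $ 3"
proof -
  have EE: "E True - E False = 2 * cos \<theta>" by (simp add: E_def complex_eq_iff)
  have t: "(J \<sigma> *v (J (\<not> \<sigma>) *v p)) $ 3 = p $ 3"
    "(J \<sigma> *v (J (\<not> \<sigma>) *v p)) $ 2 = p $ 2 + 2 * (E \<sigma> - E (\<not> \<sigma>)) * p $ 3" for \<sigma> p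
    by (simp_all add: J_mult algebra_simps)
  have *: "pull (replicate n (gen_T, b)) p $ 3 = p $ 3 \<and>
    pull (replicate n (gen_T, b)) p $ 2 = p $ 2 - (if b then 1 else - 1) * 4 * of_nat n * cos \<theta> * p $ 3" for n b
  proof (induction n arbitrary: p)
    case (Suc n)
    have "pull (replicate (Suc n) (gen_T, b)) p = pull (replicate n (gen_T, b)) (J (\<not> b) *v (J b *v p))"
      by (cases b) (simp_all add: pull_def)
    then show ?case
      using Suc[of "J (\<not> b) *v (J b *v p)"] t[of "\<not> b" p] EE
      by (cases b) (simp_all add: algebra_simps)
  qed simp
  show "pull (T_word k) p $ 3 = p $ 3" "pull (T_word k) p $ 2 = p $ 2 - 4 * of_int k * cos \<theta> * p $ 3"
    using *[of "nat k" True] *[of "nat (- k)" False] by (auto simp: T_word_def)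
qed

text \<open>All vertices sharing a square with \<open>q\<^sub>\<infinity>\<close> have height at least \<open>m\<close> over \<open>p\<close>.\<close>

definition local_ge :: "real \<Rightarrow> complex^3 \<Rightarrow> bool" where
  "local_ge m p \<longleftrightarrow> (\<forall>k. m \<le> cmod (pull (T_word k) p $ 1) \<and>
     (\<forall>\<sigma>. m \<le> cmod (nbr \<sigma> (pull (T_word k) p)) \<and> m \<le> cmod (opp \<sigma> (pull (T_word k) p))))"

text \<open>Induction along the path of squares, bounding both ends of the current edge. At the root
  \<open>q_inf\<close> is lowest in its square, so \<open>near_across\<close> starts the invariant;
  \<open>away_far\<close> and \<open>away_step\<close> carry it on.\<close>

lemma reach_ge:
  assumes "negv p" "local_ge m p" "cmod (p $ 3) \<le> m" "reach \<sigma> w"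
  shows "away \<sigma> (pull w p) \<and> m \<le> cmod (pull w p $ 1) \<and> m \<le> cmod (pull w p $ 3)"
  using assms(4)
proof induction
  case (root j \<sigma> k)
  define q where "q = pull (T_word k) p"
  have m: "m \<le> cmod (q $ 1)" "m \<le> cmod (nbr \<sigma> q)" "m \<le> cmod (opp \<sigma> q)"
    using assms(2) by (simp_all add: local_ge_def q_def)
  have "cmod (q $ 3) \<le> m" using assms(3) by (simp add: q_def pull_T_word)
  then have n: "near (\<not> \<sigma>) (Q \<sigma> (Q \<sigma> q))" "near (\<not> \<sigma>) (Q \<sigma> (Q \<sigma> (Q \<sigma> q)))"
    using near_across[of q \<sigma>] m by auto
  have "pull (T_word k @ pow_word \<sigma> j) p = (if j = 2 then Q \<sigma> (Q \<sigma> q) else Q \<sigma> (Q \<sigma> (Q \<sigma> q)))"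
    using root by (auto simp: pull_pow_word q_def numeral_eq_Suc)
  moreover have "m \<le> cmod (Q \<sigma> (Q \<sigma> q) $ 1)" "m \<le> cmod (Q \<sigma> (Q \<sigma> q) $ 3)"
    using m by (simp_all add: Q_nth(1)[of \<sigma> "Q \<sigma> q"] opp_Q nbr_Q)
  moreover have "m \<le> cmod (Q \<sigma> (Q \<sigma> (Q \<sigma> q)) $ 1)" "m \<le> cmod (Q \<sigma> (Q \<sigma> (Q \<sigma> q)) $ 3)"
    using m by (simp add: Q_nth(1)[of \<sigma> "Q \<sigma> (Q \<sigma> q)"] opp_Q, simp add: Q_thrice P_nth m)
  ultimately show ?case using n by (auto simp: away_def)
next
  case (step \<sigma> w j)
  define q where "q = pull w p"
  have q: "negv q" "away \<sigma> q" "m \<le> cmod (q $ 1)" "m \<le> cmod (q $ 3)"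
    using step assms(1) by (simp_all add: q_def)
  have m: "m \<le> cmod (nbr \<sigma> q)" "m \<le> cmod (opp \<sigma> q)"
    using away_far[OF q(1,2)] q(3,4) by (force intro: order.trans)+
  have "pull (w @ pow_word \<sigma> j) p \<in> {Q \<sigma> q, Q \<sigma> (Q \<sigma> q), Q \<sigma> (Q \<sigma> (Q \<sigma> q))}"
    using step by (auto simp: pull_pow_word q_def numeral_eq_Suc)
  moreover have "m \<le> cmod (Q \<sigma> q $ 1)" "m \<le> cmod (Q \<sigma> q $ 3)"
    using q m by (simp add: Q_nth(1), simp add: nbr_Q)
  moreover have "m \<le> cmod (Q \<sigma> (Q \<sigma> q) $ 1)" "m \<le> cmod (Q \<sigma> (Q \<sigma> q) $ 3)"
    using m by (simp_all add: Q_nth(1)[of \<sigma> "Q \<sigma> q"] opp_Q nbr_Q)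
  moreover have "m \<le> cmod (Q \<sigma> (Q \<sigma> (Q \<sigma> q)) $ 1)" "m \<le> cmod (Q \<sigma> (Q \<sigma> (Q \<sigma> q)) $ 3)"
    using m q by (simp add: Q_nth(1)[of \<sigma> "Q \<sigma> (Q \<sigma> q)"] opp_Q, simp add: Q_thrice P_nth q)
  ultimately show ?case using away_step[OF q(1,2)] by auto
qed

text \<open>A local bound on the heights holds for every vertex other than \<open>q_inf\<close>. It
  serves with \<open>m\<close> the height of \<open>q_inf\<close> for the domain, and with
  \<open>m = 2\<close> at \<open>base\<close> for the presentation and discreteness.\<close>

lemma local_to_global:
  assumes "negv p" "local_ge m p" "cmod (p $ 3) \<le> m"
  shows "(\<exists>k. w \<simeq> T_word k) \<or> m \<le> cmod (pull w p $ 3)"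
proof -
  obtain w' where w': "w \<simeq> w'"
    "(\<exists>k. w' = T_word k) \<or> (\<exists>k. w' = T_word k @ gen_word True) \<or> (\<exists>\<sigma>. reach \<sigma> w')"
    using covered[of w] unfolding covered_def by blast
  have "m \<le> cmod (pull (T_word k @ gen_word True) p $ 3)" for k
    using assms(2) by (simp add: local_ge_def pull_gen_word flip: nbr_Q)
  then show ?thesis
    using w' reach_ge[OF assms] by (auto simp: pull_weq[OF w'(1)])
qed

end

subsection \<open>Discreteness and existence of lowest vertices\<close>

lemma norm_vec3_le: "norm x \<le> norm (x $ 1) + norm (x $ 2) + norm (x $ 3)" for x :: "complex^3"
proof -
  have "norm x \<le> (\<Sum>i\<in>UNIV. norm (x $ i))"
    unfolding norm_vec_def by (rule L2_set_le_sum) simp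
  then show ?thesis by (simp add: sum_3)
qed

lemma herm_axis: "herm z (axis 1 1) = z $ 3" "herm z (axis 2 1) = z $ 2" "herm z (axis 3 1) = z $ 1"
  by (simp_all add: herm_expand axis_def)

lemma norm_axis_one [simp]: "norm (axis i (1 :: complex) :: complex^3) = 1"
  by (simp add: norm_vec_def L2_set_def axis_def if_distrib[of cmod] if_distrib[of "\<lambda>x. x\<^sup>2"] cong: if_cong)

lemma cmod_herm_le: "cmod (herm z w) \<le> 3 * norm z * norm w"
proof -
  have *: "cmod (z $ i * cnj (w $ j)) \<le> norm z * norm w" for i j
    by (simp add: norm_mult mult_mono Finite_Cartesian_Product.norm_nth_le)
  have "cmod (herm z w) \<le> cmod (z $ 3 * cnj (w $ 1)) + cmod (z $ 2 * cnj (w $ 2)) + cmod (z $ 1 * cnj (w $ 3))"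
    unfolding herm_expand
    using norm_triangle_ineq[of "z $ 3 * cnj (w $ 1) + z $ 2 * cnj (w $ 2)" "z $ 1 * cnj (w $ 3)"]
      norm_triangle_ineq[of "z $ 3 * cnj (w $ 1)" "z $ 2 * cnj (w $ 2)"] by linarith
  then show ?thesis using *[of 3 1] *[of 2 2] *[of 1 3] by linarith
qed

lemma norm_matrix_vector_le:
  fixes A :: "complex^3^3"
  assumes "\<And>i j. cmod (A $ i $ j) \<le> B"
  shows "norm (A *v x) \<le> 9 * B * norm x"
proof -
  have B: "B \<ge> 0" using assms[of 1 1] norm_ge_zero order.trans by blast
  have "cmod ((A *v x) $ i) \<le> 3 * (B * norm x)" for i
  proof -
    have "cmod ((A *v x) $ i) \<le> (\<Sum>j\<in>UNIV. cmod (A $ i $ j * x $ j))"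
      unfolding matrix_vector_mult_def by (simp add: norm_sum)
    also have "\<dots> \<le> (\<Sum>j\<in>(UNIV::3 set). B * norm x)"
      using assms B by (intro sum_mono)
        (simp add: norm_mult mult_mono Finite_Cartesian_Product.norm_nth_le)
    finally show ?thesis by (simp add: sum_3)
  qed
  from this[of 1] this[of 2] this[of 3] show ?thesis
    using norm_vec3_le[of "A *v x"] by (simp add: algebra_simps)
qed

text \<open>The signature is (2,1), so the orthogonal complement of a negative vector is positive
  definite and contains no nonzero null vector.\<close>

lemma herm_null_eq_0:
  assumes "Re (herm p p) < 0" "herm v v = 0" "herm p v = 0"
  shows "v = 0"
proof -
  have p3: "p $ 3 \<noteq> 0" using assms(1) by (auto simp: Re_herm_self not_less)
  have v: "(cmod (v $ 2))\<^sup>2 + 2 * Re (v $ 1 * cnj (v $ 3)) = 0"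
    using assms(2) Re_herm_self[of v] by simp
  show ?thesis
  proof (cases "v $ 3 = 0")
    case True
    then have "v $ 2 = 0" using v by simp
    then show ?thesis using True p3 assms(3) by (simp add: herm_expand vec3_eq_iff)
  next
    case False
    define a b c d where "a = p $ 1 / p $ 3" and "b = p $ 2 / p $ 3" and "c = v $ 1 / v $ 3"
      and "d = v $ 2 / v $ 3"
    have eqs: "p $ 1 = a * p $ 3" "p $ 2 = b * p $ 3" "v $ 1 = c * v $ 3" "v $ 2 = d * v $ 3"
      using p3 False by (simp_all add: a_def b_def c_def d_def)
    have norm: "Re (x * (w * cnj w)) = Re x * (cmod w)\<^sup>2" for x w
      by (simp add: cmod_power2) (simp add: power2_eq_square algebra_simps)
    have "((cmod b)\<^sup>2 + 2 * Re a) * (cmod (p $ 3))\<^sup>2 < 0"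
      using assms(1) by (simp only: Re_herm_self eqs norm norm_mult power_mult_distrib distrib_right mult.assoc)
    then have 1: "(cmod b)\<^sup>2 + 2 * Re a < 0" by (simp add: mult_less_0_iff)
    have "((cmod d)\<^sup>2 + 2 * Re c) * (cmod (v $ 3))\<^sup>2 = 0"
      using v by (simp only: eqs norm norm_mult power_mult_distrib distrib_right mult.assoc)
    then have 2: "(cmod d)\<^sup>2 + 2 * Re c = 0" using False by simp
    have "(cnj c + b * cnj d + a) * (p $ 3 * cnj (v $ 3)) = herm p v"
      by (simp add: herm_expand eqs algebra_simps)
    then have "cnj c + b * cnj d + a = 0" using assms(3) p3 False by simp
    then have "Re c + Re (b * cnj d) + Re a = 0" by (simp add: complex_eq_iff)
    moreover have "Re (b * cnj d) \<le> cmod b * cmod d"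
      by (metis complex_Re_le_cmod complex_mod_cnj norm_mult)
    moreover have "(cmod b - cmod d)\<^sup>2 \<ge> 0" by simp
    ultimately show ?thesis using 1 2 by (simp add: power2_eq_square algebra_simps)
  qed
qed

lemma continuous_on_herm_right: "continuous_on S (\<lambda>v. herm p v)"
  unfolding herm_expand by (intro continuous_intros)

lemma continuous_on_herm_self: "continuous_on S (\<lambda>v. herm v v)"
  unfolding herm_expand by (intro continuous_intros)

lemma herm_scale: "herm (c *s z) w = c * herm z w" "herm z (c *s w) = cnj c * herm z w"
  by (simp_all add: herm_expand algebra_simps)

text \<open>The modulus of \<open>herm p\<close> has a positive minimum on the compact set of unit
  null vectors; homogeneity does the rest.\<close>

lemma null_vector_bound:
  assumes "Re (herm p p) < 0"
  obtains c where "c > 0" "\<And>v. herm v v = 0 \<Longrightarrow> c * norm v \<le> cmod (herm p v)"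
proof -
  define K where "K = {v :: complex^3. norm v = 1 \<and> herm v v = 0}"
  have "closed {v :: complex^3. herm v v = 0}"
    using continuous_closed_preimage_constant[OF continuous_on_herm_self[of UNIV] closed_UNIV, of 0]
    by simp
  moreover have "K = sphere 0 1 \<inter> {v. herm v v = 0}" by (auto simp: K_def)
  ultimately have K: "compact K" by (simp add: compact_Int_closed)
  have q: "(1 / norm q_inf_lift) *\<^sub>R q_inf_lift \<in> K"
  proof -
    have "norm q_inf_lift \<noteq> 0" by (simp add: q_inf_lift_def vec3_eq_iff vector_3)
    moreover have "herm (r *\<^sub>R q_inf_lift) (r *\<^sub>R q_inf_lift) = 0" for r :: real
      by (simp add: herm_expand q_inf_lift_def vector_3)
    ultimately show ?thesis by (simp add: K_def)
  qed
  have "continuous_on K (\<lambda>v. cmod (herm p v))"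
    by (intro continuous_on_norm continuous_on_herm_right)
  then obtain v0 where v0: "v0 \<in> K" "\<And>v. v \<in> K \<Longrightarrow> cmod (herm p v0) \<le> cmod (herm p v)"
    using continuous_attains_inf[OF K] q by blast
  have "v0 \<noteq> 0" "herm v0 v0 = 0" using v0(1) by (auto simp: K_def)
  then have pos: "cmod (herm p v0) > 0" using herm_null_eq_0[OF assms] by auto
  have "cmod (herm p v0) * norm v \<le> cmod (herm p v)" if "herm v v = 0" for v
  proof (cases "v = 0")
    case False
    define r where "r = 1 / norm v"
    have r: "r > 0" using False by (simp add: r_def)
    have sc: "r *\<^sub>R v = complex_of_real r *s v" 
      by (simp add: vec3_eq_iff) (simp add: scaleR_conv_of_real)
    have "norm (r *\<^sub>R v) = 1" using False by (simp add: r_def)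
    moreover have "herm (r *\<^sub>R v) (r *\<^sub>R v) = 0" using that by (simp add: sc herm_scale)
    ultimately have "r *\<^sub>R v \<in> K" by (simp add: K_def)
    then have "cmod (herm p v0) \<le> r * cmod (herm p v)"
      using v0(2)[of "r *\<^sub>R v"] r by (simp add: sc herm_scale norm_mult)
    then show ?thesis using False by (simp add: r_def field_simps)
  qed simp
  then show ?thesis using pos that by blast
qed

definition inverse_word :: "'x word \<Rightarrow> 'x word" where
  "inverse_word u = rev (map (\<lambda>(x, b). (x, \<not> b)) u)"

lemma inverse_word_left: "word_eq R (inverse_word u @ u) []"
  unfolding inverse_word_def by (rule word_eq_inverse)

lemma inverse_word_inverse [simp]: "inverse_word (inverse_word u) = u"
  by (induction u) (auto simp: inverse_word_def rev_map)

lemma inverse_word_right: "word_eq R (u @ inverse_word u) []"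
  using inverse_word_left[of R "inverse_word u"] by simp

section \<open>Separation of words at a high base point, and lowest vertices\<close>

context cusp_angle begin

lemma pull_inverse_word: "pull (inverse_word w) p = word_mat w *v p"
  using pull_weq[OF inverse_word_left[of relators w], of p] word_mat_pull[of w "pull (inverse_word w) p"]
  by simp

lemma weq_inverse_cancel: "inverse_word b @ a \<simeq> [] \<Longrightarrow> a \<simeq> b"
proof -
  assume "inverse_word b @ a \<simeq> []"
  then have "b @ (inverse_word b @ a) \<simeq> b @ []" by (rule word_eq_append_left)
  moreover have "(b @ inverse_word b) @ a \<simeq> [] @ a"
    by (rule word_eq_append_right[OF inverse_word_right])
  ultimately show ?thesis by (metis append.assoc append_Nil append_Nil2 word_eq.sym word_eq.trans)
qed

text \<open>A lift of the point \<open>(z, t, u) = (0, 0, 4)\<close>, which is above all the isometric spheres.\<close>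

definition base :: "complex^3" where
  "base = vector [- 2, 0, 1]"

lemma base_nth [simp]: "base $ 1 = - 2" "base $ 2 = 0" "base $ 3 = 1"
  by (simp_all add: base_def vector_3)

lemma Re_herm_base: "Re (herm base base) = - 4" and negv_base: "negv base"
  by (simp_all add: Re_herm_self negv_def)

text \<open>Completing squares with \<open>Re (herm q q) = - 4\<close> already makes the real parts
  at least 2 in modulus.\<close>

lemma local_ge_base: "local_ge 2 base"
  unfolding local_ge_def
proof (intro allI conjI)
  fix k \<sigma>
  define q where "q = pull (T_word k) base"
  have q3: "q $ 3 = 1" by (simp add: q_def pull_T_word)
  have "herm q q = herm base base" by (simp add: q_def herm_pull_pull)
  then have "Re (herm q q) = - 4" using Re_herm_base by simp
  then have q1: "2 * Re (q $ 1) = - 4 - (cmod (q $ 2))\<^sup>2"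
    using Re_herm_self[of q] q3 by simp
  have "- Re (q $ 1) \<ge> 2" using q1 zero_le_power2[of "cmod (q $ 2)"] by linarith
  then show "2 \<le> cmod (q $ 1)" using abs_Re_le_cmod[of "q $ 1"] by linarith
  have "(cmod (q $ 2 - 2 * E \<sigma>))\<^sup>2 = (cmod (q $ 2))\<^sup>2 - 4 * Re (cnj (E \<sigma>) * q $ 2) + 4 * (cmod (E \<sigma>))\<^sup>2"
    unfolding cmod_power2 by (simp add: power2_eq_square algebra_simps)
  then have "2 * Re (nbr \<sigma> q) = (cmod (q $ 2 - 2 * E \<sigma>))\<^sup>2 + 4"
    using q1 by (simp add: nbr_def q3 cmod_E)
  moreover have "(cmod (q $ 2 - 2 * E \<sigma>))\<^sup>2 \<ge> 0" by simp
  ultimately show "2 \<le> cmod (nbr \<sigma> q)" using abs_Re_le_cmod[of "nbr \<sigma> q"] by linarith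
  have "(cmod (q $ 2 - E \<sigma>))\<^sup>2 = (cmod (q $ 2))\<^sup>2 - 2 * Re (cnj (E \<sigma>) * q $ 2) + (cmod (E \<sigma>))\<^sup>2"
    unfolding cmod_power2 by (simp add: power2_eq_square algebra_simps)
  then have "- Re (opp \<sigma> q) = (cmod (q $ 2 - E \<sigma>))\<^sup>2 + 4"
    using q1 by (simp add: opp_def q3 cmod_E)
  moreover have "(cmod (q $ 2 - E \<sigma>))\<^sup>2 \<ge> 0" by simp
  ultimately show "2 \<le> cmod (opp \<sigma> q)" using abs_Re_le_cmod[of "opp \<sigma> q"] by linarith
qed

lemma pull_base_ge:
  assumes "cmod (pull w base $ 3) < 2"
  obtains k where "w \<simeq> T_word k"
  using local_to_global[OF negv_base local_ge_base, of w] assms by auto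

text \<open>The gap between height 1 at \<open>q_inf\<close> and height 2 elsewhere turns a
  numerical estimate into an equivalence with some \<open>T^k\<close>; the translation length
  \<open>4 * cos \<theta> \<ge> 2\<close> then forces \<open>k = 0\<close>.\<close>

lemma pull_base_trivial:
  assumes "cmod (pull w base $ 3) < 2" "cmod (pull w base $ 2) < 2"
  shows "w \<simeq> []"
proof -
  obtain k where k: "w \<simeq> T_word k" using pull_base_ge[OF assms(1)] .
  have "pull w base $ 2 = - complex_of_real (4 * of_int k * cos \<theta>)"
    by (simp add: pull_weq[OF k] pull_T_word)
  then have "cmod (pull w base $ 2) = 4 * \<bar>of_int k\<bar> * cos \<theta>"
    using cos_ge_half by (simp only: norm_minus_cancel norm_of_real) (simp add: abs_mult)
  moreover have "4 * \<bar>of_int k\<bar> * cos \<theta> \<ge> 4 * \<bar>of_int k\<bar> * (1 / 2)"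
    using cos_ge_half by (intro mult_left_mono) auto
  ultimately have "\<bar>of_int k :: real\<bar> < 1" using assms(2) by linarith
  then have "k = 0" by linarith
  then show ?thesis using k by (simp add: T_word_def)
qed

text \<open>If the matrices are close, \<open>a^-1 b\<close> moves \<open>base\<close> so little
  that \<open>pull_base_trivial\<close> applies.\<close>

lemma word_mat_separated:
  assumes B: "\<And>i j. cmod (word_mat a $ i $ j) \<le> B" and d: "dist (word_mat a) (word_mat b) * (729 * (B + 1)) < 1"
  shows "a \<simeq> b"
proof -
  have B0: "B \<ge> 0" using B[of 1 1] norm_ge_zero order.trans by blast
  define D where "D = dist (word_mat a) (word_mat b)"
  define v where "v = (word_mat b - word_mat a) *v base"
  have "cmod ((word_mat b - word_mat a) $ i $ j) \<le> D" for i j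
  proof -
    have "cmod ((word_mat b - word_mat a) $ i $ j) \<le> norm ((word_mat b - word_mat a) $ i)"
      by (rule Finite_Cartesian_Product.norm_nth_le)
    also have "\<dots> \<le> norm (word_mat b - word_mat a)" by (rule Finite_Cartesian_Product.norm_nth_le)
    finally show ?thesis by (simp add: D_def dist_norm norm_minus_commute)
  qed
  then have "norm v \<le> 9 * D * norm base" unfolding v_def by (rule norm_matrix_vector_le)
  also have "\<dots> \<le> 9 * D * 3"
    using norm_vec3_le[of base] by (intro mult_left_mono) (simp_all add: D_def)
  finally have v: "norm v \<le> 27 * D" by simp
  have small: "cmod (herm (pull a v) e) < 1" if "norm e \<le> 1" for e
  proof -
    have "norm (word_mat a *v e) \<le> 9 * B * norm e" by (rule norm_matrix_vector_le[OF B])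
    also have "\<dots> \<le> 9 * B * 1" using that B0 by (intro mult_left_mono) auto
    finally have e: "norm (word_mat a *v e) \<le> 9 * B" by simp
    have "cmod (herm (pull a v) e) = cmod (herm v (word_mat a *v e))" by (simp add: herm_pull)
    also have "\<dots> \<le> 3 * norm v * norm (word_mat a *v e)" by (rule cmod_herm_le)
    \<comment> \<open>The factor 729 is \<open>3 * 27 * 9\<close>, from \<open>cmod_herm_le\<close>,
      the bound on \<open>v\<close> and the matrix bound.\<close>
    also have "\<dots> \<le> (3 * (27 * D)) * (9 * B)"
      using v e by (intro mult_mono) (auto simp: D_def)
    also have "\<dots> \<le> D * (729 * (B + 1))"
      by (simp add: D_def algebra_simps)
    finally show ?thesis using d by (simp add: D_def)
  qed
  have "word_mat b *v base = word_mat a *v base + v"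
    by (simp add: v_def matrix_vector_mult_diff_rdistrib)
  moreover have "pull a (x + y) = pull a x + pull a y" for x y
    using pull_word_mat[of a "pull a x + pull a y"] by (simp add: matrix_vector_right_distrib)
  ultimately have "pull (inverse_word b @ a) base = base + pull a v"
    by (simp add: pull_inverse_word)
  moreover have "cmod (pull a v $ 3) < 1"
    using small[of "axis 1 1"] by (simp add: herm_axis)
  moreover have "cmod (pull a v $ 2) < 1"
    using small[of "axis 2 1"] by (simp add: herm_axis)
  ultimately have "inverse_word b @ a \<simeq> []"
    using norm_triangle_ineq[of 1 "pull a v $ 3"] by (intro pull_base_trivial) auto
  then show ?thesis by (rule weq_inverse_cancel)
qed

lemma finite_bounded_word_mats:
  "finite {word_mat w | w. \<forall>i j. cmod (word_mat w $ i $ j) \<le> B}" (is "finite ?X")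
proof (cases "B \<ge> 0")
  case True
  have "uniform_discrete ?X"
    unfolding uniform_discrete_def
  proof (intro exI[of _ "1 / (729 * (B + 1))"] conjI ballI impI)
    show "1 / (729 * (B + 1)) > 0" using True by simp
    fix X Y assume X: "X \<in> ?X" and Y: "Y \<in> ?X" and d: "dist X Y < 1 / (729 * (B + 1))"
    from X Y obtain a b where "X = word_mat a" "\<forall>i j. cmod (word_mat a $ i $ j) \<le> B" "Y = word_mat b"
      by blast
    moreover from d have "dist X Y * (729 * (B + 1)) < 1" using True by (simp add: field_simps)
    ultimately show "X = Y" using word_mat_separated word_mat_weq by blast
  qed
  moreover have "bounded ?X"
  proof -
    have "norm A \<le> 9 * B" if "\<And>i j. cmod (A $ i $ j) \<le> B" for A :: "complex^3^3"
    proof -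
      have "norm A \<le> (\<Sum>i\<in>UNIV. norm (A $ i))"
        unfolding norm_vec_def by (rule L2_set_le_sum) simp
      also have "\<dots> \<le> (\<Sum>i\<in>(UNIV::3 set). 3 * B)"
      proof (rule sum_mono)
        fix i show "norm (A $ i) \<le> 3 * B"
          using norm_vec3_le[of "A $ i"] that[of i 1] that[of i 2] that[of i 3] by linarith
      qed
      finally show ?thesis by (simp add: sum_3)
    qed
    then show ?thesis unfolding bounded_iff by blast
  qed
  ultimately show ?thesis using uniform_discrete_finite_iff by blast
next
  case False
  then have "?X = {}" using norm_ge_zero order.trans by blast
  then show ?thesis by (simp only: finite.emptyI)
qed

text \<open>A bound on \<open>pull w p\<close> bounds the pairing of \<open>p\<close> with the
  images of null vectors under \<open>word_mat w\<close>, hence these images by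
  \<open>null_vector_bound\<close>, and so all columns.\<close>

lemma finite_word_mats_pull_bounded:
  assumes "negv p"
  shows "finite {word_mat w | w. \<forall>i. cmod (pull w p $ i) \<le> K}"
proof -
  obtain c where c: "c > 0" "\<And>v. herm v v = 0 \<Longrightarrow> c * norm v \<le> cmod (herm p v)"
    using null_vector_bound assms unfolding negv_def by blast
  \<comment> \<open>The second basis vector is not null; it is written through the null vectors as
    \<open>u + (1 / 2) *s e1 - e3\<close>.\<close>
  define e1 e3 u :: "complex^3" where "e1 = axis 1 1" and "e3 = axis 3 1"
    and "u = vector [- 1 / 2, 1, 1]"
  have null: "herm e1 e1 = 0" "herm e3 e3 = 0" "herm u u = 0"
    by (simp_all add: e1_def e3_def u_def herm_expand axis_def vector_3)
  have nu: "norm e1 \<le> 3" "norm e3 \<le> 3" "norm u \<le> 3"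
    using norm_vec3_le[of u] by (simp_all add: e1_def e3_def u_def vector_3)
  define B where "B = 3 * (27 * K / c)"
  have "cmod (word_mat w $ i $ j) \<le> B" if w: "\<forall>i. cmod (pull w p $ i) \<le> K" for w i j
  proof -
    have np: "norm (pull w p) \<le> 3 * K"
      using norm_vec3_le[of "pull w p"] w[rule_format, of 1] w[rule_format, of 2] w[rule_format, of 3]
      by linarith
    have col: "norm (word_mat w *v e) \<le> 27 * K / c" if "herm e e = 0" "norm e \<le> 3" for e
    proof -
      have "K \<ge> 0" using np norm_ge_zero[of "pull w p"] by linarith
      have "c * norm (word_mat w *v e) \<le> cmod (herm p (word_mat w *v e))"
        using that by (intro c(2)) (simp add: herm_word_mat)
      also have "\<dots> \<le> 3 * norm (pull w p) * norm e" by (simp add: cmod_herm_le flip: herm_pull)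
      also have "\<dots> \<le> 3 * (3 * K) * 3" using np that \<open>K \<ge> 0\<close> by (intro mult_mono) auto
      finally show ?thesis using c(1) by (simp add: field_simps)
    qed
    have "axis 2 1 = u + (1 / 2) *s e1 - e3"
      by (simp add: vec3_eq_iff u_def e1_def e3_def axis_def vector_3)
    then have "word_mat w *v axis 2 1 = word_mat w *v u + (1 / 2) *s (word_mat w *v e1) - word_mat w *v e3"
      by (simp only: matrix_vector_right_distrib matrix_vector_mult_diff_distrib vector_scalar_commute)
    moreover have "norm ((1 / 2 :: complex) *s (word_mat w *v e1)) = norm (word_mat w *v e1) / 2"
    proof -
      have "(1 / 2 :: complex) *s (word_mat w *v e1) = (1 / 2 :: real) *\<^sub>R (word_mat w *v e1)"
        by (simp add: vec3_eq_iff) (simp add: scaleR_conv_of_real)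
      then show ?thesis by simp
    qed
    ultimately have "norm (word_mat w *v axis 2 1)
        \<le> norm (word_mat w *v u) + norm (word_mat w *v e1) / 2 + norm (word_mat w *v e3)"
      using norm_triangle_ineq4[of "word_mat w *v u + (1 / 2) *s (word_mat w *v e1)" "word_mat w *v e3"]
        norm_triangle_ineq[of "word_mat w *v u" "(1 / 2) *s (word_mat w *v e1)"] by simp
    then have "norm (word_mat w *v axis 2 1) \<le> B" "norm (word_mat w *v e1) \<le> B"
      "norm (word_mat w *v e3) \<le> B"
      unfolding B_def using col[OF null(1) nu(1)] col[OF null(2) nu(2)] col[OF null(3) nu(3)]
        norm_ge_zero[of "word_mat w *v e1"] by linarith+
    then have "norm (word_mat w *v axis j 1) \<le> B"
      using exhaust_3[of j] by (auto simp: e1_def e3_def)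
    moreover have "(word_mat w *v axis j 1) $ i = word_mat w $ i $ j"
      using exhaust_3[of j] by (auto simp: matrix_vector_mult_def axis_def sum_3)
    ultimately show ?thesis
      using Finite_Cartesian_Product.norm_nth_le[of "word_mat w *v axis j 1" i] by simp
  qed
  then have "{word_mat w | w. \<forall>i. cmod (pull w p $ i) \<le> K} \<subseteq> {word_mat w | w. \<forall>i j. cmod (word_mat w $ i $ j) \<le> B}"
    by blast
  then show ?thesis using finite_bounded_word_mats finite_subset by blast
qed

text \<open>\<open>\<langle>T\<rangle>\<close> is infinite, so finiteness is available only after a
  power of \<open>T\<close> brings the point into a region bounded in terms of its height. The
  constant is \<open>2 * 6 + 3\<close>, from \<open>y \<le> 6 * h\<close> and
  \<open>x \<le> 2 * y + 3 * h\<close>.\<close>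

lemma not_local_ge:
  assumes "negv p" "\<not> local_ge (cmod (p $ 3)) p"
  obtains k v where "\<And>i. cmod (pull (T_word k) p $ i) \<le> 15 * cmod (p $ 3)"
    "cmod (pull (T_word k @ v) p $ 3) < cmod (p $ 3)"
proof -
  obtain k \<sigma> where k: "cmod (pull (T_word k) p $ 1) < cmod (p $ 3) \<or>
      cmod (nbr \<sigma> (pull (T_word k) p)) < cmod (p $ 3) \<or> cmod (opp \<sigma> (pull (T_word k) p)) < cmod (p $ 3)"
    using assms(2) unfolding local_ge_def not_le[symmetric] by blast
  define q where "q = pull (T_word k) p"
  define h x y where "h = cmod (p $ 3)" and "x = cmod (q $ 1)" and "y = cmod (q $ 2)"
  have q: "negv q" "cmod (q $ 3) = h" using assms(1) by (simp_all add: q_def h_def pull_T_word)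
  have y2: "y\<^sup>2 \<le> 2 * x * h"
  proof -
    have "y\<^sup>2 < - 2 * Re (q $ 1 * cnj (q $ 3))" using q(1) by (simp add: negv_form y_def)
    moreover have "\<bar>Re (q $ 1 * cnj (q $ 3))\<bar> \<le> x * h"
      using abs_Re_le_cmod[of "q $ 1 * cnj (q $ 3)"] by (simp only: norm_mult complex_mod_cnj q x_def)
    ultimately show ?thesis by linarith
  qed
  have h: "h > 0" using negv_nonzero assms(1) by (simp add: h_def)
  have quad: "y \<le> 6 * h" if "x \<le> 2 * y + 3 * h"
  proof (rule ccontr)
    assume "\<not> ?thesis"
    then have "y > 6 * h" by simp
    then have "y * y > 6 * h * y" "6 * h * h \<le> h * y" using h by auto
    moreover have "2 * x * h \<le> 2 * (2 * y + 3 * h) * h" "h * h > 0" using that h by simp_all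
    ultimately show False using y2 by (simp add: power2_eq_square algebra_simps)
  qed
  have "x \<le> 2 * y + 3 * h \<and> (\<exists>v. cmod (pull v q $ 3) < h)"
  proof -
    consider "x < h" | "cmod (nbr \<sigma> q) < h" | "cmod (opp \<sigma> q) < h"
      using k by (auto simp: q_def x_def h_def)
    then show ?thesis
    proof cases
      case 1
      have "cmod (pull [(gen_S, False)] q $ 3) < h"
        using 1 by (simp add: pull_def P_nth x_def)
      moreover have "y \<ge> 0" by (simp add: y_def)
      ultimately show ?thesis using 1 h by (intro conjI exI) auto
    next
      case 2
      have "q $ 1 = - nbr \<sigma> q - 2 * cnj (E \<sigma>) * q $ 2 + 2 * q $ 3" by (simp add: nbr_def)
      then have "x \<le> cmod (nbr \<sigma> q) + 2 * y + 2 * h"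
        unfolding x_def using norm_triangle_ineq[of "- nbr \<sigma> q - 2 * cnj (E \<sigma>) * q $ 2" "2 * q $ 3"]
          norm_triangle_ineq4[of "- nbr \<sigma> q" "2 * cnj (E \<sigma>) * q $ 2"]
        by (simp add: norm_mult y_def q)
      then show ?thesis
        using 2 by (intro conjI exI[of _ "gen_word \<sigma>"]) (auto simp: pull_gen_word simp flip: nbr_Q)
    next
      case 3
      have "2 * q $ 1 = opp \<sigma> q - 2 * cnj (E \<sigma>) * q $ 2 + q $ 3" by (simp add: opp_def)
      then have "cmod (2 * q $ 1) \<le> cmod (opp \<sigma> q) + 2 * y + h"
        using norm_triangle_ineq[of "opp \<sigma> q - 2 * cnj (E \<sigma>) * q $ 2" "q $ 3"]
          norm_triangle_ineq4[of "opp \<sigma> q" "2 * cnj (E \<sigma>) * q $ 2"]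
        by (simp add: norm_mult y_def q)
      then have "2 * x \<le> cmod (opp \<sigma> q) + 2 * y + h" by (simp add: norm_mult x_def)
      moreover have "y \<ge> 0" by (simp add: y_def)
      ultimately show ?thesis
        using 3 h by (intro conjI exI[of _ "pow_word \<sigma> 2"])
          (auto simp: pull_pow_word opp_Q numeral_2_eq_2)
    qed
  qed
  then obtain v where v: "x \<le> 2 * y + 3 * h" "cmod (pull v q $ 3) < h" by blast
  have "cmod (q $ i) \<le> 15 * h" for i
  proof -
    have "x \<le> 15 * h" "y \<le> 15 * h" "h \<le> 15 * h" using quad[OF v(1)] v(1) h by linarith+
    then show ?thesis using exhaust_3[of i] q(2) by (auto simp: x_def y_def)
  qed
  then show ?thesis using that[of k v] v by (simp add: q_def h_def)
qed

text \<open>Otherwise every vertex not higher than \<open>q_inf\<close> has a strictly lower one,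
  although by \<open>not_local_ge\<close> the heights involved already occur in a finite
  set.\<close>

lemma exists_local_min:
  assumes "negv p"
  obtains w where "local_ge (cmod (pull w p $ 3)) (pull w p)"
proof (rule ccontr)
  assume "\<not> thesis"
  then have no: "\<not> local_ge (cmod (pull w p $ 3)) (pull w p)" for w using that by blast
  define W where "W = {w. \<forall>i. cmod (pull w p $ i) \<le> 15 * cmod (p $ 3)}"
  \<comment> \<open>Heights depend only on the matrix, so finiteness of the set of matrices suffices
    although many words share one.\<close>
  have val: "cmod (pull w p $ 3) = cmod (herm p (word_mat w *v axis 1 1))" for w
  proof -
    have "pull w p $ 3 = herm (pull w p) (axis 1 1)" by (simp add: herm_axis)
    then show ?thesis by (simp add: herm_pull)
  qed
  have "finite ((\<lambda>A. cmod (herm p (A *v axis 1 1))) ` {word_mat w | w. \<forall>i. cmod (pull w p $ i) \<le> 15 * cmod (p $ 3)})"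
    by (rule finite_imageI[OF finite_word_mats_pull_bounded[OF assms]])
  moreover have "(\<lambda>w. cmod (pull w p $ 3)) ` W \<subseteq>
      (\<lambda>A. cmod (herm p (A *v axis 1 1))) ` {word_mat w | w. \<forall>i. cmod (pull w p $ i) \<le> 15 * cmod (p $ 3)}"
    by (auto simp: val W_def)
  ultimately have fin: "finite ((\<lambda>w. cmod (pull w p $ 3)) ` W)" by (rule rev_finite_subset)
  \<comment> \<open>Appending a power of \<open>T\<close> changes the frame but not the vertex, so
    the height stays and the word enters \<open>W\<close>.\<close>
  have lower: "\<exists>w'\<in>W. \<exists>v. cmod (pull w' p $ 3) = cmod (pull w p $ 3) \<and> cmod (pull (w' @ v) p $ 3) < cmod (pull w p $ 3)"
    if le: "cmod (pull w p $ 3) \<le> cmod (p $ 3)" for w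
  proof -
    obtain k v where kv: "\<And>i. cmod (pull (T_word k) (pull w p) $ i) \<le> 15 * cmod (pull w p $ 3)"
      "cmod (pull (T_word k @ v) (pull w p) $ 3) < cmod (pull w p $ 3)"
      using not_local_ge[of "pull w p"] no assms by auto
    have "cmod (pull (T_word k) (pull w p) $ i) \<le> 15 * cmod (p $ 3)" for i
      using kv(1)[of i] le by linarith
    then have "w @ T_word k \<in> W" by (simp add: W_def)
    then show ?thesis
      using kv(2) by (intro bexI[of _ "w @ T_word k"] exI[of _ v]) (auto simp: pull_T_word)
  qed
  have ne: "W \<noteq> {}" using lower[of "[]"] by auto
  define m where "m = Min ((\<lambda>w. cmod (pull w p $ 3)) ` W)"
  have "m \<in> (\<lambda>w. cmod (pull w p $ 3)) ` W" unfolding m_def using fin ne by (intro Min_in) auto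
  then obtain w where w: "w \<in> W" "cmod (pull w p $ 3) = m" by auto
  obtain w0 where w0: "w0 \<in> W" "cmod (pull w0 p $ 3) = cmod (p $ 3)" using lower[of "[]"] by auto
  have min: "m \<le> cmod (pull w' p $ 3)" if "w' \<in> W" for w'
    unfolding m_def using fin that by (intro Min_le) auto
  have "m \<le> cmod (p $ 3)" using min[OF w0(1)] w0(2) by simp
  then obtain w1 v where "cmod (pull (w1 @ v) p $ 3) < m" using lower[of w] w by auto
  moreover from this obtain w2 where "w2 \<in> W" "cmod (pull w2 p $ 3) = cmod (pull (w1 @ v) p $ 3)"
    using lower[of "w1 @ v"] \<open>m \<le> cmod (p $ 3)\<close> by auto
  ultimately show False using min by force
qed

end

subsection \<open>The group and its presentation\<close>

lemma SU21_sel [simp]: "mult SU21 = (**)" "one SU21 = mat 1"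
  by (simp_all add: SU21_def)

lemma PU_class_eq: "PU_class A = {mat c ** A | c. c ^ 3 = 1}"
  by (auto simp: PU_class_def r_coset_def SU21_scalars_def)

lemma PU_class_self: "A \<in> PU_class A"
  unfolding PU_class_eq by (intro CollectI exI[of _ 1]) simp

lemma carrier_PU21: "carrier PU21 = PU_class ` carrier SU21"
  by (auto simp: PU21_def PU_class_def[abs_def] FactGroup_def RCOSETS_def)

lemma PU_class_mult:
  "A \<in> carrier SU21 \<Longrightarrow> B \<in> carrier SU21 \<Longrightarrow> PU_class A \<otimes>\<^bsub>PU21\<^esub> PU_class B = PU_class (A ** B)"
  using hom_mult[OF normal.r_coset_hom_Mod[OF normal_SU21_scalars]]
  by (simp add: PU21_def PU_class_def)

lemma PU_class_one: "PU_class (mat 1) = \<one>\<^bsub>PU21\<^esub>"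
  using hom_one[OF normal.r_coset_hom_Mod[OF normal_SU21_scalars] group_SU21 group_PU21[unfolded PU21_def]]
  by (simp add: PU21_def PU_class_def)

lemma cube_root_of_unity_norm: "c ^ 3 = 1 \<Longrightarrow> cmod c = 1"
  using power_eq_iff_eq_base[of 3 "cmod c" 1] norm_power[of c 3] by simp

lemma mat_scale_mult: "(mat c ** A) *v x = c *s (A *v x)" for A :: "complex^3^3"
  by (simp add: mat_mult_left vec3_eq_iff matrix_vector_mult_def sum_3 algebra_simps)

context cusp_angle begin

lemma letter_mat_in_SU21: "letter_mat l \<in> carrier SU21"
proof -
  interpret group SU21 by (rule group_SU21)
  have J: "J \<sigma> \<in> carrier SU21" for \<sigma> using I_mats_in_SU21 by (simp add: J_def)
  show ?thesis
    using m_closed[OF J I_mats_in_SU21(3)] m_closed[OF I_mats_in_SU21(3) J] m_closed[OF J J]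
    by (cases l rule: letter_mat.cases) (simp_all add: letter_mat.simps)
qed

lemma word_mat_in_SU21: "word_mat w \<in> carrier SU21"
proof (induction w)
  case Nil
  show ?case using monoid.one_closed[OF group.is_monoid[OF group_SU21]] by simp
next
  case (Cons l w)
  then show ?case
    using monoid.m_closed[OF group.is_monoid[OF group_SU21] letter_mat_in_SU21] by (simp add: word_mat_Cons)
qed

definition word_elt :: "gen word \<Rightarrow> (complex^3^3) set" where
  "word_elt w = PU_class (word_mat w)"

lemma word_elt_in_PU21: "word_elt w \<in> carrier PU21"
  using word_mat_in_SU21 by (auto simp: word_elt_def carrier_PU21)

lemma word_elt_append: "word_elt u \<otimes>\<^bsub>PU21\<^esub> word_elt v = word_elt (u @ v)"
  by (simp add: word_elt_def PU_class_mult word_mat_in_SU21 word_mat_append)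

lemma word_elt_Nil: "word_elt [] = \<one>\<^bsub>PU21\<^esub>"
  by (simp add: word_elt_def PU_class_one)

lemma word_elt_weq: "u \<simeq> v \<Longrightarrow> word_elt u = word_elt v"
  by (simp add: word_elt_def word_mat_weq)

lemma inv_word_elt: "inv\<^bsub>PU21\<^esub> (word_elt w) = word_elt (inverse_word w)"
proof (rule group.inv_equality[OF group_PU21])
  show "word_elt (inverse_word w) \<otimes>\<^bsub>PU21\<^esub> word_elt w = \<one>\<^bsub>PU21\<^esub>"
    using word_elt_weq[OF inverse_word_left[of relators w]] by (simp add: word_elt_append word_elt_Nil)
qed (rule word_elt_in_PU21)+

lemma S_elt_word: "S_elt \<theta> = word_elt [(gen_S, True)]" and T_elt_word: "T_elt \<theta> = word_elt [(gen_T, True)]"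
  by (simp_all add: S_elt_def T_elt_def word_elt_def word_mat_def letter_mat.simps J_def)

lemma T_elt_pow: "T_elt \<theta> [^]\<^bsub>PU21\<^esub> k = word_elt (T_word k)" for k :: int
proof -
  interpret group PU21 by (rule group_PU21)
  have n: "word_elt [l] [^]\<^bsub>PU21\<^esub> n = word_elt (replicate n l)" for l n
    by (induction n) (simp_all add: word_elt_Nil word_elt_append replicate_append_same)
  have "inverse_word (replicate n (gen_T, True)) = replicate n (gen_T, False)" for n
    by (simp add: inverse_word_def)
  then show ?thesis
    by (auto simp: T_word_def int_pow_def2 n T_elt_word inv_word_elt)
qed

lemma Gamma_grp_eq: "Gamma_grp \<theta> = range word_elt"
proof
  show "Gamma_grp \<theta> \<subseteq> range word_elt"
  proof
    fix g assume "g \<in> Gamma_grp \<theta>"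
    then show "g \<in> range word_elt"
      unfolding Gamma_grp_def
    proof (induction rule: generate.induct)
      case one
      show ?case by (metis rangeI word_elt_Nil)
    next
      case (incl h)
      then show ?case by (auto simp: S_elt_word T_elt_word)
    next
      case (inv h)
      then show ?case by (auto simp: S_elt_word T_elt_word inv_word_elt)
    next
      case (eng h1 h2)
      then show ?case by (auto simp: word_elt_append)
    qed
  qed
  have letter: "word_elt [l] \<in> Gamma_grp \<theta>" for l
  proof -
    obtain x b where l: "l = (x, b)" by force
    have "word_elt [(x, False)] = inv\<^bsub>PU21\<^esub> (word_elt [(x, True)])"
      by (simp add: inv_word_elt inverse_word_def)
    moreover have "word_elt [(x, True)] \<in> {S_elt \<theta>, T_elt \<theta>}"
      by (cases x) (simp_all add: S_elt_word T_elt_word)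
    ultimately show ?thesis
      unfolding Gamma_grp_def l by (cases b) (auto intro: generate.incl generate.inv)
  qed
  have "word_elt w \<in> Gamma_grp \<theta>" for w
  proof (induction w)
    case Nil
    show ?case unfolding word_elt_Nil Gamma_grp_def by (rule generate.one)
  next
    case (Cons l w)
    then show ?case
      using letter[of l] generate.eng word_elt_append[of "[l]" w] unfolding Gamma_grp_def by fastforce
  qed
  then show "range word_elt \<subseteq> Gamma_grp \<theta>" by blast
qed

lemma generate_T: "generate PU21 {T_elt \<theta>} = range (\<lambda>k. word_elt (T_word k))"
proof -
  have "T_elt \<theta> \<in> carrier PU21" by (simp add: T_elt_word word_elt_in_PU21)
  then show ?thesis
    unfolding group.generate_pow[OF group_PU21 \<open>T_elt \<theta> \<in> carrier PU21\<close>] T_elt_pow by blast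
qed

text \<open>Faithfulness. Equality in PU(2,1) leaves a scalar \<open>c\<close> of modulus one, which
  does not affect the moduli tested by \<open>pull_base_trivial\<close>.\<close>

lemma word_elt_eqD:
  assumes "word_elt u = word_elt v"
  shows "u \<simeq> v"
proof -
  obtain c where c: "word_mat v = mat c ** word_mat u" "cmod c = 1"
    using assms PU_class_self[of "word_mat v"] cube_root_of_unity_norm unfolding word_elt_def PU_class_eq[of "word_mat u"]
    by auto
  have lin: "pull u (d *s x) = d *s pull u x" for d x
    using pull_word_mat[of u "d *s pull u x"] by (simp add: vector_scalar_commute)
  have "pull (inverse_word v @ u) base = c *s base"
    by (simp add: pull_inverse_word c(1) mat_scale_mult lin)
  then have "inverse_word v @ u \<simeq> []"
    using c(2) by (intro pull_base_trivial) simp_all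
  then show ?thesis by (rule weq_inverse_cancel)
qed

lemma Gamma_presentation:
  "has_presentation (PU21\<lparr>carrier := Gamma_grp \<theta>\<rparr>) (gen_elt \<theta>) relators"
  unfolding has_presentation_def
proof (intro exI[of _ "\<lambda>A. the_elem (word_elt ` A)"] conjI allI)
  \<comment> \<open>\<open>word_elt\<close> is constant on a class of words, so its image there is a
    singleton.\<close>
  let ?\<phi> = "\<lambda>A. the_elem (word_elt ` A)"
  have \<phi>: "?\<phi> (word_class relators u) = word_elt u" for u
  proof -
    have "word_elt ` word_class relators u = {word_elt u}"
      using word_elt_weq[of u] word_eq.refl[of relators u] unfolding word_class_def by blast
    then show ?thesis by simp
  qed
  have carr: "carrier (presented_group relators) = range (word_class relators)"
    by (simp add: presented_group_def)
  have "?\<phi> \<in> hom (presented_group relators) (PU21\<lparr>carrier := Gamma_grp \<theta>\<rparr>)"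
    by (auto simp: hom_def carr \<phi> Gamma_grp_eq presented_group_mult word_elt_append)
  moreover have "bij_betw ?\<phi> (carrier (presented_group relators)) (Gamma_grp \<theta>)"
    unfolding bij_betw_def carr
    by (auto simp: inj_on_def \<phi> Gamma_grp_eq word_class_eq_iff word_elt_eqD) (metis \<phi> rangeI image_eqI)
  ultimately show "?\<phi> \<in> iso (presented_group relators) (PU21\<lparr>carrier := Gamma_grp \<theta>\<rparr>)"
    by (simp add: iso_def)
  fix x
  show "?\<phi> (word_class relators [(x, True)]) = gen_elt \<theta> x"
    by (cases x) (simp_all add: \<phi> gen_elt_def S_elt_word T_elt_word)
qed

lemma topspace_PU21: "topspace PU21_topology = carrier PU21"
  by (simp add: PU21_topology_def topspace_quotient_topology carrier_PU21)

lemma Gamma_discrete: "discrete_subgroup (Gamma_grp \<theta>)"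
  unfolding discrete_subgroup_def
proof
  show "subgroup (Gamma_grp \<theta>) PU21"
    unfolding Gamma_grp_def
    using word_elt_in_PU21 by (intro group.generate_is_subgroup[OF group_PU21]) (auto simp: S_elt_word T_elt_word)
  have sub: "Gamma_grp \<theta> \<subseteq> carrier PU21" by (auto simp: Gamma_grp_eq word_elt_in_PU21)
  have "openin (subtopology PU21_topology (Gamma_grp \<theta>)) {g}" if g: "g \<in> Gamma_grp \<theta>" for g
  proof -
    obtain a where a: "g = word_elt a" using g by (auto simp: Gamma_grp_eq)
    \<comment> \<open>An open condition, invariant under scalars, saying that \<open>a^-1 B\<close>
      moves \<open>base\<close> little; by \<open>pull_base_trivial\<close> only \<open>g\<close>
      satisfies it within the group.\<close>
    define cond where "cond B \<longleftrightarrow> cmod (pull a (B *v base) $ 3) < 2 \<and> cmod (pull a (B *v base) $ 2) < 2" for B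
    define U where "U = PU_class ` {B \<in> carrier SU21. cond B}"
    have lin: "pull a (d *s x) = d *s pull a x" for d x
      using pull_word_mat[of a "d *s pull a x"] by (simp add: vector_scalar_commute)
    have inv: "cond B' \<longleftrightarrow> cond B" if "PU_class B' = PU_class B" for B B'
    proof -
      have "B' \<in> PU_class B" using that PU_class_self[of B'] by simp
      then obtain c where "B' = mat c ** B" "cmod c = 1"
        using cube_root_of_unity_norm unfolding PU_class_eq by blast
      then show ?thesis by (simp add: cond_def mat_scale_mult lin norm_mult)
    qed
    have pre: "{B \<in> carrier SU21. PU_class B \<in> U} = {B \<in> carrier SU21. cond B}"
      unfolding U_def using inv by blast
    have cont: "continuous_on UNIV (\<lambda>B. pull a (B *v base) $ i)" for i
    proof -
      have "pull a v = word_mat (inverse_word a) *v v" for v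
        using pull_inverse_word[of "inverse_word a" v] by simp
      then show ?thesis
        unfolding matrix_vector_mult_def by (simp, intro continuous_intros)
    qed
    have "open {B. cond B}"
      unfolding cond_def by (intro open_Collect_conj open_Collect_less continuous_on_norm cont continuous_intros)
    then have "openin (top_of_set (carrier SU21)) {B \<in> carrier SU21. cond B}"
      by (simp add: openin_open Collect_conj_eq) blast
    then have U: "openin PU21_topology U"
      unfolding PU21_topology_def openin_quotient_topology
      using pre by (auto simp: U_def)
    have "U \<inter> Gamma_grp \<theta> = {g}"
    proof (intro equalityI subsetI)
      fix h assume h: "h \<in> U \<inter> Gamma_grp \<theta>"
      then obtain b where b: "h = word_elt b" by (auto simp: Gamma_grp_eq)
      from h obtain B where "PU_class (word_mat b) = PU_class B" "cond B"
        unfolding U_def b word_elt_def by blast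
      then have "cond (word_mat b)" using inv by blast
      then have "inverse_word b @ a \<simeq> []"
        by (intro pull_base_trivial) (simp_all add: cond_def pull_inverse_word)
      then show "h \<in> {g}" using word_elt_weq[OF weq_inverse_cancel] a b by simp
    next
      fix h assume "h \<in> {g}"
      then show "h \<in> U \<inter> Gamma_grp \<theta>"
        using g word_mat_in_SU21[of a] by (auto simp: a U_def word_elt_def cond_def)
    qed
    then show ?thesis unfolding openin_subtopology by (intro exI[of _ U]) (simp add: U)
  qed
  moreover have "topspace (subtopology PU21_topology (Gamma_grp \<theta>)) = Gamma_grp \<theta>"
    unfolding topspace_subtopology topspace_PU21 using sub by blast
  ultimately have "discrete_topology (Gamma_grp \<theta>) = subtopology PU21_topology (Gamma_grp \<theta>)"
    unfolding discrete_topology_unique by blast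
  then show "subtopology PU21_topology (Gamma_grp \<theta>) = discrete_topology (Gamma_grp \<theta>)" by (simp only:)
qed

end

subsection \<open>Isometric spheres and their exteriors\<close>

lemma cline_eqD:
  assumes "cline v = cline w" "v \<noteq> 0"
  obtains c where "c \<noteq> 0" "v = c *s w"
proof -
  have "v \<in> cline v" unfolding cline_def by (intro CollectI exI[of _ 1]) simp
  then have "v \<in> cline w" by (simp only: assms(1))
  then obtain c where c: "v = c *s w" by (auto simp: cline_def)
  moreover have "c \<noteq> 0" using c assms(2) by auto
  ultimately show ?thesis using that by blast
qed

lemma cline_scale: assumes "c \<noteq> 0" shows "cline (c *s v) = cline v"
proof (intro equalityI subsetI)
  fix x assume "x \<in> cline v"
  then obtain d where "x = d *s v" by (auto simp: cline_def)
  then have "x = (d / c) *s (c *s v)" using assms by (simp add: vector_smult_assoc)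
  then show "x \<in> cline (c *s v)" unfolding cline_def by blast
qed (auto simp: cline_def vector_smult_assoc)

definition nonposv :: "complex^3 \<Rightarrow> bool" where
  "nonposv v \<longleftrightarrow> v \<noteq> 0 \<and> Re (herm v v) \<le> 0"

lemma herm_self_real: "Im (herm v v) = 0"
  by (simp add: herm_expand)

lemma herm_self_scale: "herm (c *s v) (c *s v) = complex_of_real ((cmod c)\<^sup>2) * herm v v"
  by (simp only: herm_scale complex_norm_square mult_ac)

lemma nonposv_scale: "c \<noteq> 0 \<Longrightarrow> nonposv (c *s v) \<longleftrightarrow> nonposv v"
proof -
  assume c: "c \<noteq> 0"
  have "Re (herm (c *s v) (c *s v)) = (cmod c)\<^sup>2 * Re (herm v v)"
    unfolding herm_self_scale by simp
  then show ?thesis using c by (simp add: nonposv_def mult_le_0_iff)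
qed

lemma closed_ball_eq: "CH2 \<union> bd_CH2 = cline ` Collect nonposv"
proof -
  have "herm v v = 0 \<longleftrightarrow> Re (herm v v) = 0" for v
    using herm_self_real[of v] by (simp add: complex_eq_iff)
  moreover have "v \<noteq> 0" if "Re (herm v v) < 0" for v using that by (auto simp: herm_expand)
  ultimately show ?thesis
    unfolding CH2_def bd_CH2_def nonposv_def by (auto simp: le_less)
qed

lemma CH2_eq: "CH2 = cline ` Collect negv"
  by (auto simp: CH2_def negv_def)

lemma q_inf_lift_nth [simp]: "q_inf_lift $ 1 = 1" "q_inf_lift $ 2 = 0" "q_inf_lift $ 3 = 0"
  by (simp_all add: q_inf_lift_def vector_3)

lemma herm_q_inf: "herm v q_inf_lift = v $ 3"
  by (simp add: herm_expand)

lemma hlift_nth [simp]: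
  "hlift z t u $ 1 = (- complex_of_real ((cmod z)\<^sup>2) - complex_of_real u + \<i> * complex_of_real t) / 2"
  "hlift z t u $ 2 = z" "hlift z t u $ 3 = 1"
  by (simp_all add: hlift_def vector_3)

lemma hlift_nonzero: "hlift z t u \<noteq> 0"
  by (metis hlift_nth(3) zero_index zero_neq_one)

lemma nonposv_hlift: "nonposv (hlift z t u) \<longleftrightarrow> u \<ge> 0"
  by (simp add: nonposv_def herm_hlift_self hlift_nonzero)

lemma nonposv_q_inf: "nonposv q_inf_lift"
  by (simp add: nonposv_def vec3_eq_iff herm_expand)

lemma hpoint_eq_iff: "hpoint z t u = hpoint z' t' u' \<longleftrightarrow> z = z' \<and> t = t' \<and> u = u'"
proof
  assume "hpoint z t u = hpoint z' t' u'"
  then obtain c where c: "hlift z t u = c *s hlift z' t' u'"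
    unfolding hpoint_def using cline_eqD hlift_nonzero by metis
  have "hlift z t u $ 3 = c * hlift z' t' u' $ 3" by (simp only: c vector_smult_component)
  then have "c = 1" by simp
  then have eq: "hlift z t u = hlift z' t' u'" using c by simp
  then have z: "z = z'" using hlift_nth(2) by metis
  have "hlift z t u $ 1 = hlift z' t' u' $ 1" using eq by simp
  then show "z = z' \<and> t = t' \<and> u = u'" using z by (simp add: complex_eq_iff)
qed auto

lemma nonposv_cases:
  assumes "nonposv v"
  obtains (inf) c where "c \<noteq> 0" "v = c *s q_inf_lift"
  | (fin) c z t u where "c \<noteq> 0" "u \<ge> 0" "v = c *s hlift z t u"
proof (cases "v $ 3 = 0")
  case True
  then have "v $ 2 = 0" using assms by (simp add: nonposv_def Re_herm_self)
  then have "v = v $ 1 *s q_inf_lift" using True by (simp add: vec3_eq_iff)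
  then show ?thesis using inf assms by (metis nonposv_def vector_smult_lzero)
next
  case False
  define x z where "x = v $ 1 / v $ 3" and "z = v $ 2 / v $ 3"
  define u t where "u = - (cmod z)\<^sup>2 - 2 * Re x" and "t = 2 * Im x"
  have "(- complex_of_real ((cmod z)\<^sup>2) - complex_of_real u + \<i> * complex_of_real t) / 2 = x"
    by (simp add: u_def t_def complex_eq_iff)
  then have v: "v = v $ 3 *s hlift z t u"
    using False by (simp add: vec3_eq_iff) (simp add: x_def z_def)
  then have "nonposv (hlift z t u)" using assms nonposv_scale[OF False] by metis
  then show ?thesis using fin[OF False _ v] by (simp add: nonposv_hlift)
qed

lemma null_vector_form:
  assumes "herm b b = 0" "b $ 3 \<noteq> 0"
  obtains w s where "b = b $ 3 *s hlift w s 0"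
proof -
  have "nonposv b" using assms by (auto simp: nonposv_def)
  then show ?thesis
  proof (cases rule: nonposv_cases)
    case (inf c)
    then show ?thesis using assms by simp
  next
    case (fin c z t u)
    then have c: "c = b $ 3" by simp
    have "complex_of_real ((cmod c)\<^sup>2) * - complex_of_real u = 0"
      using assms(1) unfolding fin(3) herm_self_scale herm_hlift_self by simp
    then have "u = 0" using fin(1) by simp
    then show ?thesis using that fin(3) c by metis
  qed
qed

section \<open>Topology of the closed ball in terms of lifts\<close>

lemma open_nonzero_lines: "openin (top_of_set (UNIV - {0 :: complex^3})) A \<longleftrightarrow> open A \<and> 0 \<notin> A"
proof -
  have "open (UNIV - {0 :: complex^3})" by (simp add: open_delete)
  then show ?thesis by (auto simp: openin_open_eq)
qed

lemma openin_CP2: "openin CP2 U \<longleftrightarrow> U \<subseteq> cline ` (UNIV - {0}) \<and> open {v. v \<noteq> 0 \<and> cline v \<in> U}"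
  by (simp add: CP2_def openin_quotient_topology open_nonzero_lines)

lemma topspace_CP2: "topspace CP2 = cline ` (UNIV - {0})"
  by (simp add: CP2_def topspace_quotient_topology)

lemma topspace_cl_CH2: "topspace cl_CH2 = CH2 \<union> bd_CH2"
  unfolding cl_CH2_def topspace_subtopology topspace_CP2 closed_ball_eq
  by (auto simp: nonposv_def)

lemma openin_cl_CH2_lift:
  assumes "openin cl_CH2 U"
  obtains W where "open W" "\<And>v. nonposv v \<Longrightarrow> cline v \<in> U \<longleftrightarrow> v \<in> W"
proof -
  obtain V where V: "openin CP2 V" "U = V \<inter> (CH2 \<union> bd_CH2)"
    using assms by (auto simp: cl_CH2_def openin_subtopology)
  show ?thesis
  proof
    show "open {v. v \<noteq> 0 \<and> cline v \<in> V}" using V(1) by (simp add: openin_CP2)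
    show "cline v \<in> U \<longleftrightarrow> v \<in> {v. v \<noteq> 0 \<and> cline v \<in> V}" if "nonposv v" for v
      using that unfolding V(2) closed_ball_eq by (auto simp: nonposv_def)
  qed
qed

text \<open>For \<open>b\<close> a lift of \<open>g\<^sup>-\<^sup>1(q\<^sub>\<infinity>)\<close>, \<open>side (<) b\<close> is the exterior of the isometric sphere of \<open>g\<close> and
  \<open>side (\<le>) b\<close> its closure.\<close>

definition side :: "(real \<Rightarrow> real \<Rightarrow> bool) \<Rightarrow> complex^3 \<Rightarrow> (complex^3) set set" where
  "side r b = cline ` {v. nonposv v \<and> r (cmod (v $ 3)) (cmod (herm v b))}"

lemma closedin_side: "closedin cl_CH2 (side (\<le>) b)"
proof -
  define V where "V = cline ` {v. v \<noteq> 0 \<and> cmod (herm v b) < cmod (v $ 3)}"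
  have mem: "cline v \<in> V \<longleftrightarrow> cmod (herm v b) < cmod (v $ 3)" if v: "v \<noteq> 0" for v
  proof
    assume "cline v \<in> V"
    then obtain w where "cline v = cline w" "cmod (herm w b) < cmod (w $ 3)" by (auto simp: V_def)
    moreover from this obtain c where "c \<noteq> 0" "v = c *s w" using cline_eqD v by metis
    ultimately show "cmod (herm v b) < cmod (v $ 3)" by (simp add: herm_scale norm_mult)
  qed (use v in \<open>auto simp: V_def\<close>)
  have "{v. v \<noteq> 0 \<and> cline v \<in> V} = {v. cmod (herm v b) < cmod (v $ 3)}"
  proof -
    have "v \<noteq> 0" if "cmod (herm v b) < cmod (v $ 3)" for v using that by auto
    then show ?thesis using mem by blast
  qed
  moreover have "open {v. cmod (herm v b) < cmod (v $ 3)}"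
    unfolding herm_expand by (intro open_Collect_less continuous_intros)
  ultimately have "openin CP2 V" unfolding openin_CP2 V_def by auto
  then have "openin cl_CH2 ((CH2 \<union> bd_CH2) \<inter> V)"
    by (auto simp: cl_CH2_def openin_subtopology_Int2)
  moreover have "(CH2 \<union> bd_CH2) - side (\<le>) b = (CH2 \<union> bd_CH2) \<inter> V"
  proof -
    have "cline v \<in> side (\<le>) b \<longleftrightarrow> \<not> cmod (herm v b) < cmod (v $ 3)" if v: "nonposv v" for v
    proof
      assume "cline v \<in> side (\<le>) b"
      then obtain w where "cline v = cline w" "cmod (w $ 3) \<le> cmod (herm w b)" by (auto simp: side_def)
      moreover from this obtain c where "c \<noteq> 0" "v = c *s w" using cline_eqD v by (metis nonposv_def)
      ultimately show "\<not> cmod (herm v b) < cmod (v $ 3)" by (simp add: herm_scale norm_mult)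
    qed (use v in \<open>auto simp: side_def\<close>)
    then show ?thesis using mem unfolding closed_ball_eq by (auto simp: nonposv_def)
  qed
  moreover have "side (\<le>) b \<subseteq> CH2 \<union> bd_CH2" unfolding closed_ball_eq side_def by auto
  ultimately show ?thesis by (simp add: closedin_def topspace_cl_CH2)
qed

lemma cline_in_side:
  assumes "nonposv v" "r = (<) \<or> r = (\<le>)"
  shows "cline v \<in> side r b \<longleftrightarrow> r (cmod (v $ 3)) (cmod (herm v b))"
proof
  assume "cline v \<in> side r b"
  then obtain w where "cline v = cline w" "r (cmod (w $ 3)) (cmod (herm w b))" by (auto simp: side_def)
  moreover from this obtain c where "c \<noteq> 0" "v = c *s w" using cline_eqD assms by (metis nonposv_def)
  ultimately show "r (cmod (v $ 3)) (cmod (herm v b))"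
    using assms(2) by (auto simp: herm_scale norm_mult)
qed (use assms in \<open>auto simp: side_def\<close>)

lemma cygan_fun_center: "cygan_fun w s w s u = \<bar>u\<bar>"
  by (simp add: cygan_fun_def)

lemma cygan_fun_mono:
  assumes "u \<ge> 0" "u < u'"
  shows "cygan_fun w s z t u < cygan_fun w s z t u'"
proof -
  have "((cmod (z - w))\<^sup>2 + u)\<^sup>2 < ((cmod (z - w))\<^sup>2 + u')\<^sup>2"
    using assms by (intro power_strict_mono) auto
  then show ?thesis
    unfolding cygan_fun_def cmod_def by simp
qed

lemma cmod_herm_hlift_scaled: "cmod (herm (c *s hlift z t u) (d *s hlift w s 0)) = cmod c * cmod d * cygan_fun w s z t u / 2"
  by (simp add: herm_scale norm_mult cmod_herm_hlift)

text \<open>Raising \<open>u\<close> strictly increases \<open>cygan_fun\<close>, so each finite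
  point of the closed side is a limit of exterior points on the vertical line above it.\<close>

lemma closure_side:
  assumes b: "herm b b = 0" "b $ 3 \<noteq> 0"
  shows "cl_CH2 closure_of side (<) b = side (\<le>) b"
proof
  have "side (<) b \<subseteq> side (\<le>) b" by (auto simp: side_def)
  then show "cl_CH2 closure_of side (<) b \<subseteq> side (\<le>) b"
    by (rule closure_of_minimal[OF _ closedin_side])
  show "side (\<le>) b \<subseteq> cl_CH2 closure_of side (<) b"
  proof
    fix p assume p: "p \<in> side (\<le>) b"
    then obtain v where v: "p = cline v" "nonposv v" "cmod (v $ 3) \<le> cmod (herm v b)"
      by (auto simp: side_def)
    obtain w s where w: "b = b $ 3 *s hlift w s 0" using null_vector_form[OF b] .
    from v(2) show "p \<in> cl_CH2 closure_of side (<) b"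
    proof (cases rule: nonposv_cases)
      case (inf c)
      then have "cmod (v $ 3) < cmod (herm v b)"
        using b(2) by (simp add: herm_expand)
      then have "p \<in> side (<) b" using v by (auto simp: side_def)
      moreover have "side (<) b \<subseteq> topspace cl_CH2" unfolding topspace_cl_CH2 closed_ball_eq side_def by auto
      ultimately show ?thesis using closure_of_subset by blast
    next
      case (fin c z t u)
      have ph: "p = cline (hlift z t u)" using v fin by (simp add: cline_scale)
      have le: "1 \<le> cmod (b $ 3) * cygan_fun w s z t u / 2"
      proof -
        have "cmod c * 1 \<le> cmod c * (cmod (b $ 3) * cygan_fun w s z t u / 2)"
          using v(3) unfolding fin(3) by (subst (asm) w) (simp add: cmod_herm_hlift_scaled)
        then show ?thesis using fin(1) by (simp only: mult_le_cancel_left) simp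
      qed
      show ?thesis
        unfolding in_closure_of
      proof (intro conjI allI impI)
        show "p \<in> topspace cl_CH2" unfolding topspace_cl_CH2 closed_ball_eq using v by auto
        fix U assume U: "p \<in> U \<and> openin cl_CH2 U"
        then obtain W where W: "open W" "\<And>v. nonposv v \<Longrightarrow> cline v \<in> U \<longleftrightarrow> v \<in> W"
          using openin_cl_CH2_lift by metis
        have "hlift z t u \<in> W" using U W(2)[of "hlift z t u"] fin by (simp add: ph nonposv_hlift)
        moreover have "continuous_on UNIV (\<lambda>r. hlift z t r)"
        proof -
          have "hlift z t 0 + (- r / 2) *\<^sub>R q_inf_lift = hlift z t r" for r
            by (simp add: vec3_eq_iff) (simp add: scaleR_conv_of_real field_simps)
          moreover have "continuous_on UNIV (\<lambda>r. hlift z t 0 + (- r / 2) *\<^sub>R q_inf_lift)"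
            by (intro continuous_intros) auto
          ultimately show ?thesis by (simp only:)
        qed
        ultimately have "open ((\<lambda>r. hlift z t r) -` W)" "u \<in> (\<lambda>r. hlift z t r) -` W"
          using W(1) by (auto intro: open_vimage)
        then obtain e where e: "e > 0" "ball u e \<subseteq> (\<lambda>r. hlift z t r) -` W"
          using open_contains_ball by blast
        define u' where "u' = u + e / 2"
        have u': "u' > u" "u' \<ge> 0" "hlift z t u' \<in> W"
        proof -
          have "u' \<in> ball u e" using e(1) by (simp add: u'_def dist_real_def)
          then show "hlift z t u' \<in> W" using e(2) by blast
        qed (use e(1) fin(2) in \<open>simp_all add: u'_def\<close>)
        have "cmod (b $ 3) * cygan_fun w s z t u / 2 < cmod (b $ 3) * cygan_fun w s z t u' / 2"
          using cygan_fun_mono[OF fin(2) u'(1)] b(2) by simp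
        then have "cmod (hlift z t u' $ 3) < cmod (herm (hlift z t u') b)"
          using le by (subst w) (simp add: herm_scale norm_mult cmod_herm_hlift)
        then have "cline (hlift z t u') \<in> side (<) b"
          using u'(2) by (auto simp: side_def nonposv_hlift)
        moreover have "cline (hlift z t u') \<in> U" using W(2) u' by (simp add: nonposv_hlift)
        ultimately show "\<exists>y. y \<in> side (<) b \<and> y \<in> U" by blast
      qed
    qed
  qed
qed

text \<open>On a lift with third coordinate 1 the pairing with \<open>b\<close> has modulus
  \<open>cmod d * cygan_fun w s z t u / 2\<close>; comparison with 1 gives the radius.\<close>

lemma cygan_side:
  assumes b: "b = d *s hlift w s 0" "d \<noteq> 0" and r: "r\<^sup>2 = 2 / cmod d"
  shows "cygan_sphere w s r = {cline v | v. nonposv v \<and> cmod (v $ 3) = cmod (herm v b)}"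
    and "cygan_exterior w s r = side (<) b"
proof -
  have h: "cmod (herm (hlift z t u) b) = cmod d * cygan_fun w s z t u / 2" for z t u
    using cmod_herm_hlift_scaled[of 1 z t u d w s] by (simp add: b(1))
  have on_out: "cmod (herm (hlift z t u) b) = 1 \<longleftrightarrow> cygan_fun w s z t u = r\<^sup>2"
    "1 < cmod (herm (hlift z t u) b) \<longleftrightarrow> r\<^sup>2 < cygan_fun w s z t u" for z t u
    unfolding h r using b(2) by (simp_all add: field_simps)
  have q_pos: "cmod (herm q_inf_lift b) > 0"
    using b by (simp add: herm_expand)
  have scale: "cmod (herm (c *s v) b) = cmod c * cmod (herm v b)" for c v
    by (simp add: herm_scale norm_mult)
  show "cygan_sphere w s r = {cline v | v. nonposv v \<and> cmod (v $ 3) = cmod (herm v b)}"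
  proof (intro equalityI subsetI)
    fix p assume "p \<in> cygan_sphere w s r"
    then obtain z t u where p: "u \<ge> 0" "cygan_fun w s z t u = r\<^sup>2" "p = cline (hlift z t u)"
      unfolding cygan_sphere_def hpoint_def by blast
    have "nonposv (hlift z t u) \<and> cmod (hlift z t u $ 3) = cmod (herm (hlift z t u) b)"
      using p on_out(1)[of z t u] by (simp add: nonposv_hlift)
    then show "p \<in> {cline v | v. nonposv v \<and> cmod (v $ 3) = cmod (herm v b)}"
      using p(3) by blast
  next
    fix p assume "p \<in> {cline v | v. nonposv v \<and> cmod (v $ 3) = cmod (herm v b)}"
    then obtain v where v: "p = cline v" "nonposv v" "cmod (v $ 3) = cmod (herm v b)" by blast
    from v(2) show "p \<in> cygan_sphere w s r"
    proof (cases rule: nonposv_cases)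
      case (inf c)
      then show ?thesis using v(3) q_pos by (simp add: scale)
    next
      case (fin c z t u)
      then have "cmod (herm (hlift z t u) b) = 1" using v(3) by (simp add: scale)
      then have "cygan_fun w s z t u = r\<^sup>2" using on_out(1) by blast
      moreover have "p = hpoint z t u" using v(1) fin by (simp add: hpoint_def cline_scale)
      ultimately show ?thesis using fin(2) unfolding cygan_sphere_def by blast
    qed
  qed
  show "cygan_exterior w s r = side (<) b"
  proof (intro equalityI subsetI)
    fix p assume "p \<in> cygan_exterior w s r"
    then consider "p = q_inf" | z t u where "u \<ge> 0" "cygan_fun w s z t u > r\<^sup>2" "p = cline (hlift z t u)"
      unfolding cygan_exterior_def hpoint_def by blast
    then show "p \<in> side (<) b"
    proof cases
      case 1
      then show ?thesis
        using cline_in_side[OF nonposv_q_inf, of "(<)" b] q_pos by (simp add: q_inf_def)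
    next
      case 2
      then show ?thesis
        using cline_in_side[of "hlift z t u" "(<)" b] on_out(2)[of z t u] by (simp add: nonposv_hlift)
    qed
  next
    fix p assume "p \<in> side (<) b"
    then obtain v where v: "p = cline v" "nonposv v" "cmod (v $ 3) < cmod (herm v b)"
      unfolding side_def by blast
    from v(2) show "p \<in> cygan_exterior w s r"
    proof (cases rule: nonposv_cases)
      case (inf c)
      then show ?thesis using v by (simp add: cygan_exterior_def q_inf_def cline_scale)
    next
      case (fin c z t u)
      then have "1 < cmod (herm (hlift z t u) b)" using v(3) by (simp add: scale)
      then have "r\<^sup>2 < cygan_fun w s z t u" using on_out(2) by blast
      moreover have "p = hpoint z t u" using v(1) fin by (simp add: hpoint_def cline_scale)
      ultimately show ?thesis using fin(2) unfolding cygan_exterior_def by blast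
    qed
  qed
qed

lemma matrix_inv_eqI:
  fixes A B :: "'a::semiring_1^'n^'n"
  assumes "A ** B = mat 1" "B ** A = mat 1"
  shows "matrix_inv A = B"
proof -
  have "A ** matrix_inv A = mat 1 \<and> matrix_inv A ** A = mat 1"
    unfolding matrix_inv_def by (rule someI[of _ B]) (use assms in simp)
  then show ?thesis using assms by (metis matrix_mul_assoc matrix_mul_lid matrix_mul_rid)
qed

lemma PU_act_cline: "PU_act (PU_class A) (cline v) = cline (A *v v)"
proof -
  have "(mat c ** A) *v (d *s v) = (c * d) *s (A *v v)" for c d
    by (simp add: mat_scale_mult vector_scalar_commute vector_smult_assoc)
  then have "PU_act (PU_class A) (cline v) = {(c * d) *s (A *v v) | c d. c ^ 3 = 1}"
    unfolding PU_act_def PU_class_eq cline_def by (auto simp: image_iff) metis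
  also have "\<dots> = cline (A *v v)"
    unfolding cline_def by (auto, metis mult_1 power_one)
  finally show ?thesis .
qed

section \<open>Isometric spheres of group elements\<close>

context cusp_angle begin

lemma matrix_inv_scaled_word_mat:
  assumes "c ^ 3 = 1"
  shows "matrix_inv (mat c ** word_mat w) = mat (inverse c) ** word_mat (inverse_word w)"
proof -
  have c: "c \<noteq> 0" using assms by auto
  have w: "word_mat w ** word_mat (inverse_word w) = mat 1" "word_mat (inverse_word w) ** word_mat w = mat 1"
    using word_mat_weq[OF inverse_word_left[of relators w]] word_mat_weq[OF inverse_word_right[of relators w]]
    by (simp_all add: word_mat_append)
  have comm: "A ** mat d = mat d ** A" for A :: "complex^3^3" and d
    by (simp add: mat_mult_left mat_mult_right)
  have "mat d ** A ** (mat e ** B) = mat d ** mat e ** (A ** B)" for d e and A B :: "complex^3^3"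
  proof -
    have "mat d ** A ** (mat e ** B) = mat d ** (A ** mat e) ** B" by (simp only: matrix_mul_assoc)
    then show ?thesis by (simp only: comm[of A e] matrix_mul_assoc)
  qed
  then have "mat c ** word_mat w ** (mat (inverse c) ** word_mat (inverse_word w)) = mat 1"
    "mat (inverse c) ** word_mat (inverse_word w) ** (mat c ** word_mat w) = mat 1"
    using c w by (simp_all add: mat_mult_mat)
  then show ?thesis by (rule matrix_inv_eqI)
qed

lemma isometric_exterior_word_elt:
  assumes "pull w q_inf_lift $ 3 \<noteq> 0"
  shows "isometric_exterior (word_elt w) = side (<) (pull w q_inf_lift)"
proof -
  define b where "b = pull w q_inf_lift"
  have b0: "herm b b = 0" unfolding b_def herm_pull_pull by (simp add: herm_q_inf)
  have b3: "b $ 3 \<noteq> 0" using assms by (simp add: b_def)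
  obtain w0 s0 where w0: "b = b $ 3 *s hlift w0 s0 0" using null_vector_form[OF b0 b3] .
  have bw: "word_mat (inverse_word w) *v q_inf_lift = b"
    using pull_inverse_word[of "inverse_word w" q_inf_lift] by (simp add: b_def)
  have act: "PU_act (inv\<^bsub>PU21\<^esub> word_elt w) q_inf = hpoint w0 s0 0"
  proof -
    have "PU_act (inv\<^bsub>PU21\<^esub> word_elt w) q_inf = cline b"
      unfolding inv_word_elt unfolding word_elt_def q_inf_def PU_act_cline bw ..
    also have "\<dots> = hpoint w0 s0 0"
      unfolding hpoint_def by (subst w0) (rule cline_scale[OF b3])
    finally show ?thesis .
  qed
  have iso: "isometric_sphere (word_elt w) = {cline v | v. nonposv v \<and> cmod (v $ 3) = cmod (herm v b)}"
  proof -
    have "(\<forall>A\<in>word_elt w. \<forall>x\<in>cline v. cmod (herm x q_inf_lift) = cmod (herm x (matrix_inv A *v q_inf_lift)))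
        \<longleftrightarrow> cmod (v $ 3) = cmod (herm v b)" for v
    proof -
      have "cmod (herm x (matrix_inv A *v q_inf_lift)) = cmod (herm x b)" if A: "A \<in> word_elt w" for A x
      proof -
        obtain c where c: "A = mat c ** word_mat w" "c ^ 3 = 1" using A by (auto simp: word_elt_def PU_class_eq)
        have "matrix_inv A *v q_inf_lift = inverse c *s b"
          using c by (simp add: matrix_inv_scaled_word_mat mat_scale_mult bw)
        moreover have "cmod c = 1" using cube_root_of_unity_norm c by blast
        ultimately show ?thesis by (simp add: herm_scale norm_mult norm_inverse)
      qed
      moreover have "word_mat w \<in> word_elt w" unfolding word_elt_def by (rule PU_class_self)
      ultimately have "(\<forall>A\<in>word_elt w. \<forall>x\<in>cline v. cmod (herm x q_inf_lift) = cmod (herm x (matrix_inv A *v q_inf_lift)))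
        \<longleftrightarrow> (\<forall>x\<in>cline v. cmod (x $ 3) = cmod (herm x b))" by (auto simp: herm_q_inf)
      also have "\<dots> \<longleftrightarrow> (\<forall>c. cmod c * cmod (v $ 3) = cmod c * cmod (herm v b))"
        by (auto simp: cline_def herm_scale norm_mult)
      also have "\<dots> \<longleftrightarrow> cmod (v $ 3) = cmod (herm v b)"
        by (metis mult_1 norm_one)
      finally show ?thesis .
    qed
    then show ?thesis unfolding isometric_sphere_def closed_ball_eq by blast
  qed
  define r0 where "r0 = sqrt (2 / cmod (b $ 3))"
  have r0: "r0\<^sup>2 = 2 / cmod (b $ 3)" "r0 > 0" using b3 by (simp_all add: r0_def)
  note cs = cygan_side[OF w0 b3 r0(1)]
  show ?thesis
    unfolding b_def[symmetric]
  proof (intro equalityI subsetI)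
    fix p assume "p \<in> side (<) b"
    then have "p \<in> cygan_exterior w0 s0 r0" by (simp only: cs(2))
    moreover have "isometric_sphere (word_elt w) = cygan_sphere w0 s0 r0" by (simp only: cs(1) iso)
    ultimately show "p \<in> isometric_exterior (word_elt w)"
      using act r0(2) unfolding isometric_exterior_def
      by (intro CollectI exI[of _ w0] exI[of _ s0] exI[of _ r0] conjI)
  next
    fix p assume "p \<in> isometric_exterior (word_elt w)"
    then obtain w' s' r' where p: "r' > 0" "hpoint w0 s0 0 = hpoint w' s' 0"
      "isometric_sphere (word_elt w) = cygan_sphere w' s' r'" "p \<in> cygan_exterior w' s' r'"
      unfolding isometric_exterior_def act by blast
    have ws: "w' = w0" "s' = s0" using p(2) by (auto simp: hpoint_eq_iff)
    \<comment> \<open>The point of the sphere vertically above its centre determines the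
      radius.\<close>
    have "hpoint w0 s0 (r'\<^sup>2) \<in> cygan_sphere w0 s0 r'"
      unfolding cygan_sphere_def
      by (intro CollectI exI[of _ w0] exI[of _ s0] exI[of _ "r'\<^sup>2"] conjI) (simp_all add: cygan_fun_center)
    then have "hpoint w0 s0 (r'\<^sup>2) \<in> cygan_sphere w0 s0 r0" using p(3) iso cs(1) ws by simp
    then have "r'\<^sup>2 = r0\<^sup>2" unfolding cygan_sphere_def by (auto simp: hpoint_eq_iff cygan_fun_center)
    then have "r' = r0" using p(1) r0(2) by (metis less_imp_le power2_eq_imp_eq)
    then show "p \<in> side (<) b" using p(4) cs(2) ws by simp
  qed
qed

end

subsection \<open>The fundamental domain\<close>

lemma inverse_word_T_word: "inverse_word (T_word k) = T_word (- k)"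
  by (simp add: inverse_word_def T_word_def)

lemma T_word_add: "T_word j @ T_word k \<simeq> T_word (j + k)"
proof -
  have *: "T_word j @ replicate n (gen_T, b) \<simeq> T_word (j + (if b then int n else - int n))" for n b
  proof (induction n)
    case (Suc n)
    have "T_word j @ replicate (Suc n) (gen_T, b) = (T_word j @ replicate n (gen_T, b)) @ [(gen_T, b)]"
      by (simp add: replicate_append_same)
    moreover have "(j + (if b then int n else - int n)) + (if b then 1 else - 1) = j + (if b then int (Suc n) else - int (Suc n))"
      by simp
    ultimately show ?case
      using word_eq.trans[OF word_eq_append_right[OF Suc, of "[(gen_T, b)]"] T_word_snoc] by (simp only:)
  qed (simp add: word_eq.refl)
  show ?thesis
    using *[of "nat k" True] *[of "nat (- k)" False] by (auto simp: T_word_def[of k])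
qed

lemma weq_move_left: "inverse_word a @ b \<simeq> w \<Longrightarrow> b \<simeq> a @ w"
proof -
  assume "inverse_word a @ b \<simeq> w"
  then have "a @ (inverse_word a @ b) \<simeq> a @ w" by (rule word_eq_append_left)
  moreover have "(a @ inverse_word a) @ b \<simeq> [] @ b"
    by (rule word_eq_append_right[OF inverse_word_right])
  ultimately show ?thesis by (metis append.assoc append_Nil word_eq.sym word_eq.trans)
qed

text \<open>Allows passing from a boundary point to nearby points of \<open>CH2\<close> inside an
  open set, since the minimality statement needs negative vectors.\<close>

lemma nonposv_direction:
  assumes "nonposv v"
  obtains d where "\<And>r. r > 0 \<Longrightarrow> negv (v + r *\<^sub>R d)"
  using assms
proof (cases rule: nonposv_cases)
  case (inf c)
  have "negv (v + r *\<^sub>R (- c *s axis 3 1))" if "r > 0" for r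
  proof -
    have "negv (v + r *\<^sub>R (- c *s axis 3 1)) \<longleftrightarrow> r * (cmod c)\<^sup>2 > 0"
      unfolding negv_def Re_herm_self inf(2) cmod_power2
      by (simp add: axis_def power2_eq_square algebra_simps) linarith
    then show ?thesis using that inf(1) by simp
  qed
  then show ?thesis using that by blast
next
  case (fin c z t u)
  have "negv (v + r *\<^sub>R (- (c / 2) *s q_inf_lift))" if "r > 0" for r
  proof -
    have "v + r *\<^sub>R (- (c / 2) *s q_inf_lift) = c *s hlift z t (u + r)"
      by (simp add: fin(3) vec3_eq_iff) (simp add: scaleR_conv_of_real field_simps)
    moreover have "Re (herm (c *s hlift z t (u + r)) (c *s hlift z t (u + r))) = - ((cmod c)\<^sup>2 * (u + r))"
      unfolding herm_self_scale herm_hlift_self by (simp add: algebra_simps)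
    ultimately show ?thesis using fin that by (simp add: negv_def)
  qed
  then show ?thesis using that by blast
qed

lemma equal_norms_on_open:
  fixes \<alpha> \<beta> :: "complex^3 \<Rightarrow> complex"
  assumes W: "open W" "v \<in> W" and eq: "\<And>v. v \<in> W \<Longrightarrow> cmod (\<alpha> v) = cmod (\<beta> v)"
    and lin: "linear \<alpha>" "linear \<beta>"
  shows "cmod (\<alpha> x) = cmod (\<beta> x)"
proof -
  \<comment> \<open>compare at \<open>v \<plusminus> r x\<close> and use the parallelogram law\<close>
  have par: "(cmod (a + b))\<^sup>2 + (cmod (a - b))\<^sup>2 = 2 * (cmod a)\<^sup>2 + 2 * (cmod b)\<^sup>2" for a b
    unfolding cmod_power2 by (simp add: power2_eq_square algebra_simps)
  have cont: "isCont (\<lambda>r. v + r *\<^sub>R x) 0" "isCont (\<lambda>r. v - r *\<^sub>R x) 0"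
    by (intro continuous_intros)+
  then have "\<forall>\<^sub>F r in at (0 :: real). v + r *\<^sub>R x \<in> W" "\<forall>\<^sub>F r in at (0 :: real). v - r *\<^sub>R x \<in> W"
    using topological_tendstoD[OF cont(1)[unfolded isCont_def] W(1)]
      topological_tendstoD[OF cont(2)[unfolded isCont_def] W(1)] W(2) by simp_all
  then have "\<forall>\<^sub>F r in at (0 :: real). v + r *\<^sub>R x \<in> W \<and> v - r *\<^sub>R x \<in> W \<and> r \<noteq> 0"
    by (intro eventually_conj eventually_neq_at_within)
  then obtain r where r: "v + r *\<^sub>R x \<in> W" "v - r *\<^sub>R x \<in> W" "r \<noteq> 0"
    using eventually_happens by fastforce
  have sum: "(cmod (f (v + r *\<^sub>R x)))\<^sup>2 + (cmod (f (v - r *\<^sub>R x)))\<^sup>2 = 2 * (cmod (f v))\<^sup>2 + 2 * (r\<^sup>2 * (cmod (f x))\<^sup>2)"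
    if "linear f" for f :: "complex^3 \<Rightarrow> complex"
    using par[of "f v" "r *\<^sub>R f x"]
    by (simp add: linear_add[OF that] linear_diff[OF that] linear_scale[OF that] power_mult_distrib)
  have "r\<^sup>2 * (cmod (\<alpha> x))\<^sup>2 = r\<^sup>2 * (cmod (\<beta> x))\<^sup>2"
    using sum[OF lin(1)] sum[OF lin(2)] unfolding eq[OF r(1)] eq[OF r(2)] eq[OF W(2)] by linarith
  then have "(cmod (\<alpha> x))\<^sup>2 = (cmod (\<beta> x))\<^sup>2" using r(3) by simp
  then show ?thesis by (rule power2_eq_imp_eq) simp_all
qed

context cusp_angle begin

lemma pull_eq_mult: "pull w v = word_mat (inverse_word w) *v v"
  using pull_inverse_word[of "inverse_word w" v] by simp

lemma pull_scale: "pull w (c *s v) = c *s pull w v"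
  by (simp add: pull_eq_mult vector_scalar_commute)

lemma linear_pull_nth: "linear (\<lambda>v. pull w v $ i)"
proof
  show "pull w (r *\<^sub>R v) $ i = r *\<^sub>R (pull w v $ i)" for r v
  proof -
    have "r *\<^sub>R v = complex_of_real r *s v"
      by (simp add: vec3_eq_iff) (simp add: scaleR_conv_of_real)
    then show ?thesis by (simp add: pull_scale scaleR_conv_of_real)
  qed
qed (simp add: pull_eq_mult matrix_vector_right_distrib)

lemma nonposv_pull: "nonposv (pull w v) \<longleftrightarrow> nonposv v"
proof -
  have "pull w v = 0 \<longleftrightarrow> v = 0"
    using word_mat_pull[of w v] by (auto simp: pull_eq_mult)
  then show ?thesis by (simp add: nonposv_def herm_pull_pull)
qed

lemma pull_T_word_q_inf: "pull (T_word k) q_inf_lift = q_inf_lift"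
proof -
  \<comment> \<open>Pairing with \<open>base\<close> yields the first coordinate, which
    \<open>pull_T_word\<close> does not give.\<close>
  have "herm (pull (T_word k) q_inf_lift) (pull (T_word k) base) = herm q_inf_lift base"
    by (rule herm_pull_pull)
  then show ?thesis by (simp add: vec3_eq_iff herm_expand pull_T_word)
qed

section \<open>The domain described by heights\<close>

definition sphere_words :: "gen word set" where
  "sphere_words = {[(gen_S, True)], [(gen_S, False)], [(gen_S, True), (gen_S, True)],
     [(gen_S, False), (gen_T, True), (gen_S, False), (gen_T, True)]}"

lemma sphere_elts_words: "sphere_elts \<theta> = word_elt ` sphere_words"
proof -
  interpret group PU21 by (rule group_PU21)
  show ?thesis
    by (simp add: sphere_elts_def sphere_words_def S_elt_word T_elt_word inv_word_elt word_elt_append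
        inverse_word_def numeral_2_eq_2 word_elt_in_PU21)
qed

lemma T_conj_word: "T_conj \<theta> k (word_elt x) = word_elt (T_word k @ x @ T_word (- k))"
  by (simp add: T_conj_def T_elt_pow word_elt_append)

lemma sphere_word_third:
  "(word_mat [(gen_S, True)] *v u) $ 3 = - u $ 1"
  "(word_mat [(gen_S, False)] *v u) $ 3 = nbr True u"
  "(word_mat [(gen_S, True), (gen_S, True)] *v u) $ 3 = - opp True u"
  "(word_mat [(gen_S, False), (gen_T, True), (gen_S, False), (gen_T, True)] *v u) $ 3 = - opp False u"
proof -
  have Q: "Q True (J True *v (J False *v p)) = Q False p" for p by (simp add: Q_def)
  show "(word_mat [(gen_S, True)] *v u) $ 3 = - u $ 1"
    "(word_mat [(gen_S, False)] *v u) $ 3 = nbr True u"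
    "(word_mat [(gen_S, True), (gen_S, True)] *v u) $ 3 = - opp True u"
    "(word_mat [(gen_S, False), (gen_T, True), (gen_S, False), (gen_T, True)] *v u) $ 3 = - opp False u"
    by (simp_all add: word_mat_Cons P_nth(3)[of True u] nbr_Q opp_Q Q Q_Q flip: matrix_vector_mul_assoc)
qed

lemma sphere_word_height:
  "herm v (pull (T_word k @ x @ T_word (- k)) q_inf_lift) = (word_mat x *v pull (T_word k) v) $ 3"
proof -
  let ?w = "T_word k @ x @ T_word (- k)"
  have "herm v (pull ?w q_inf_lift) = herm (word_mat ?w *v v) (word_mat ?w *v pull ?w q_inf_lift)"
    by (simp only: herm_word_mat)
  also have "\<dots> = (word_mat ?w *v v) $ 3" by (simp only: word_mat_pull herm_q_inf)
  also have "word_mat ?w *v v = pull (T_word (- k)) (word_mat x *v pull (T_word k) v)"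
    by (simp add: word_mat_append pull_eq_mult inverse_word_T_word flip: matrix_vector_mul_assoc)
  finally show ?thesis by (simp add: pull_T_word)
qed

lemma closure_isometric_exterior:
  assumes x: "x \<in> sphere_words"
  shows "cl_CH2 closure_of isometric_exterior (T_conj \<theta> k (word_elt x))
      = side (\<le>) (pull (T_word k @ x @ T_word (- k)) q_inf_lift)" (is "_ = side _ ?b")
proof -
  have "?b $ 3 = pull x q_inf_lift $ 3" by (simp add: pull_T_word pull_T_word_q_inf)
  also have "\<dots> = (word_mat (inverse_word x) *v q_inf_lift) $ 3" by (simp add: pull_eq_mult)
  also have "\<dots> \<noteq> 0"
  proof -
    have PQ: "J False *v (J True *v P True p) = P False p" for p
      by (simp add: P_def)
    show ?thesis
      using x by (auto simp: sphere_words_def inverse_word_def sphere_word_third word_mat_Cons PQ P_nth Q_nth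
          nbr_def opp_def simp flip: matrix_vector_mul_assoc)
  qed
  finally have b3: "?b $ 3 \<noteq> 0" .
  have b0: "herm ?b ?b = 0" unfolding herm_pull_pull by (simp add: herm_q_inf)
  show ?thesis
    unfolding T_conj_word isometric_exterior_word_elt[OF b3] by (rule closure_side[OF b0 b3])
qed

text \<open>The four families of spheres compare the height of \<open>q_inf\<close> with those of
  all vertices sharing a square with it.\<close>

lemma D_dom_eq: "D_dom \<theta> = cline ` {v. nonposv v \<and> local_ge (cmod (v $ 3)) v}"
proof -
  have D: "D_dom \<theta> = (\<Inter>k. \<Inter>x\<in>sphere_words. side (\<le>) (pull (T_word k @ x @ T_word (- k)) q_inf_lift))"
    unfolding D_dom_def sphere_elts_words by (simp add: closure_isometric_exterior)
  \<comment> \<open>The neighbour of index \<open>False\<close> is a \<open>T\<close>-translate of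
    the one of index \<open>True\<close>, so four families cover all five kinds of vertex.\<close>
  have nbr_F: "nbr False (pull (T_word k) v) = nbr True (pull (T_word (k - 1)) v)" for k v
    using pull_weq[OF T_word_gen_False[of k], of v] by (simp add: nbr_Q pull_gen_word)
  have mem: "cline v \<in> D_dom \<theta> \<longleftrightarrow> local_ge (cmod (v $ 3)) v" if v: "nonposv v" for v
  proof -
    have "cline v \<in> D_dom \<theta> \<longleftrightarrow> (\<forall>k. \<forall>x\<in>sphere_words. cmod (v $ 3) \<le> cmod ((word_mat x *v pull (T_word k) v) $ 3))"
      unfolding D by (simp add: cline_in_side[OF v] sphere_word_height del: pull_append)
    also have "\<dots> \<longleftrightarrow> (\<forall>k. cmod (v $ 3) \<le> cmod (pull (T_word k) v $ 1) \<and>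
        cmod (v $ 3) \<le> cmod (nbr True (pull (T_word k) v)) \<and>
        cmod (v $ 3) \<le> cmod (opp True (pull (T_word k) v)) \<and>
        cmod (v $ 3) \<le> cmod (opp False (pull (T_word k) v)))"
      unfolding sphere_words_def ball_simps sphere_word_third norm_minus_cancel by simp
    also have "\<dots> \<longleftrightarrow> local_ge (cmod (v $ 3)) v"
      unfolding local_ge_def all_bool_eq nbr_F by blast
    finally show ?thesis .
  qed
  have "D_dom \<theta> \<subseteq> cline ` Collect nonposv"
    unfolding D sphere_words_def side_def by auto
  then show ?thesis using mem by blast
qed

lemma D_dom_pull:
  assumes "cline v \<in> PU_act (word_elt w) ` D_dom \<theta>" "nonposv v"
  shows "local_ge (cmod (pull w v $ 3)) (pull w v)"
proof -
  obtain x where x: "nonposv x" "local_ge (cmod (x $ 3)) x" "cline v = cline (word_mat w *v x)"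
    using assms(1) by (auto simp: D_dom_eq word_elt_def PU_act_cline)
  obtain c where c: "c \<noteq> 0" "v = c *s (word_mat w *v x)"
    using cline_eqD x(3) assms(2) by (metis nonposv_def)
  have v: "pull w v = c *s x" by (simp add: c pull_scale)
  have "nbr \<sigma> (c *s u) = c * nbr \<sigma> u" "opp \<sigma> (c *s u) = c * opp \<sigma> u" for \<sigma> u
    by (simp_all add: nbr_def opp_def algebra_simps)
  then show ?thesis
    using x(2) c(1) unfolding v local_ge_def by (simp add: pull_scale norm_mult)
qed

lemma D_dom_invariant: "PU_act (word_elt (T_word j)) ` D_dom \<theta> = D_dom \<theta>"
proof -
  have loc: "local_ge m (pull (T_word j) v)" if "local_ge m v" for m v j
    using that pull_weq[OF T_word_add[of j]] unfolding local_ge_def by (metis pull_append)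
  have sub: "PU_act (word_elt (T_word j)) ` D_dom \<theta> \<subseteq> D_dom \<theta>" for j
  proof
    fix p assume "p \<in> PU_act (word_elt (T_word j)) ` D_dom \<theta>"
    then obtain v where v: "nonposv v" "local_ge (cmod (v $ 3)) v" "p = cline (word_mat (T_word j) *v v)"
      by (auto simp: D_dom_eq word_elt_def PU_act_cline)
    have "word_mat (T_word j) *v v = pull (T_word (- j)) v"
      by (simp add: pull_eq_mult inverse_word_T_word)
    then show "p \<in> D_dom \<theta>"
      using v loc[OF v(2), of "- j"] by (auto simp: D_dom_eq nonposv_pull pull_T_word)
  qed
  have "p \<in> PU_act (word_elt (T_word j)) ` D_dom \<theta>" if p: "p \<in> D_dom \<theta>" for p
  proof -
    obtain v where v: "p = cline v" using p by (auto simp: D_dom_eq)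
    have "PU_act (word_elt (T_word (- j))) p = cline (pull (T_word j) v)"
      by (simp add: v word_elt_def PU_act_cline pull_eq_mult inverse_word_T_word)
    then have "PU_act (word_elt (T_word j)) (PU_act (word_elt (T_word (- j))) p) = p"
      by (simp add: v word_elt_def PU_act_cline)
    moreover have "PU_act (word_elt (T_word (- j))) p \<in> D_dom \<theta>" using sub[of "- j"] p by blast
    ultimately show ?thesis by (metis imageI)
  qed
  then show ?thesis using sub[of j] by blast
qed

lemma D_dom_covers: "CH2 \<subseteq> (\<Union>g\<in>Gamma_grp \<theta>. PU_act g ` D_dom \<theta>)"
proof
  fix p assume "p \<in> CH2"
  then obtain v where v: "p = cline v" "negv v" by (auto simp: CH2_eq)
  obtain w where w: "local_ge (cmod (pull w v $ 3)) (pull w v)" using exists_local_min[OF v(2)] .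
  have "nonposv v" using v(2) by (auto simp: nonposv_def negv_def herm_expand)
  then have "cline (pull w v) \<in> D_dom \<theta>" using w by (auto simp: D_dom_eq nonposv_pull)
  moreover have "PU_act (word_elt w) (cline (pull w v)) = p"
    by (simp add: word_elt_def PU_act_cline v)
  ultimately show "p \<in> (\<Union>g\<in>Gamma_grp \<theta>. PU_act g ` D_dom \<theta>)"
    unfolding Gamma_grp_eq by blast
qed

lemma height_le_of_local_ge:
  assumes "negv v" "local_ge (cmod (pull a v $ 3)) (pull a v)"
  shows "cmod (pull a v $ 3) \<le> cmod (pull b v $ 3)"
proof -
  have "pull (inverse_word a @ b) (pull a v) = pull b v" by (simp add: pull_inverse_word)
  then show ?thesis
    using local_to_global[of "pull a v" "cmod (pull a v $ 3)" "inverse_word a @ b"] assms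
    by (auto dest: pull_weq[of _ _ "pull a v"] simp: pull_T_word)
qed

text \<open>On a common open set both heights are globally minimal, hence equal there and, being
  moduli of linear functions, everywhere.\<close>

lemma D_dom_disjoint:
  assumes "p \<in> cl_CH2 interior_of (PU_act (word_elt a) ` D_dom \<theta>)"
    "p \<in> cl_CH2 interior_of (PU_act (word_elt b) ` D_dom \<theta>)"
  obtains k where "b \<simeq> a @ T_word k"
proof -
  define U where "U = cl_CH2 interior_of (PU_act (word_elt a) ` D_dom \<theta>) \<inter> cl_CH2 interior_of (PU_act (word_elt b) ` D_dom \<theta>)"
  have U: "openin cl_CH2 U" "p \<in> U"
    "U \<subseteq> PU_act (word_elt a) ` D_dom \<theta>" "U \<subseteq> PU_act (word_elt b) ` D_dom \<theta>"
    using assms interior_of_subset unfolding U_def by fastforce+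
  obtain W where W: "open W" "\<And>v. nonposv v \<Longrightarrow> cline v \<in> U \<longleftrightarrow> v \<in> W"
    using openin_cl_CH2_lift[OF U(1)] by metis
  have "p \<in> topspace cl_CH2" using U(1,2) openin_subset by blast
  then obtain v0 where v0: "nonposv v0" "p = cline v0" by (auto simp: topspace_cl_CH2 closed_ball_eq)
  obtain d where d: "\<And>r. r > 0 \<Longrightarrow> negv (v0 + r *\<^sub>R d)" using nonposv_direction[OF v0(1)] by blast
  have v0W: "v0 \<in> W" using W(2) v0 U(2) by blast
  have "((\<lambda>r. v0 + r *\<^sub>R d) \<longlongrightarrow> v0 + 0 *\<^sub>R d) (at_right 0)"
    by (intro tendsto_intros)
  then have "\<forall>\<^sub>F r in at_right (0 :: real). v0 + r *\<^sub>R d \<in> W"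
    using topological_tendstoD[OF _ W(1)] v0W by simp
  then have "\<forall>\<^sub>F r in at_right (0 :: real). v0 + r *\<^sub>R d \<in> W \<and> r > 0"
    by (intro eventually_conj eventually_at_right_less)
  then obtain r where r: "v0 + r *\<^sub>R d \<in> W" "r > 0"
    using eventually_happens by fastforce
  define W' where "W' = W \<inter> Collect negv"
  have "open (Collect negv)"
    unfolding negv_def herm_expand by (intro open_Collect_less continuous_intros)
  then have W': "open W'" "v0 + r *\<^sub>R d \<in> W'"
    using W(1) r d by (auto simp: W'_def)
  have eq: "cmod (pull a v $ 3) = cmod (pull b v $ 3)" if "v \<in> W'" for v
  proof -
    have v: "negv v" "nonposv v" using that by (auto simp: W'_def nonposv_def negv_def herm_expand)
    have "cline v \<in> U" using W(2)[OF v(2)] that by (simp add: W'_def)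
    then have "local_ge (cmod (pull a v $ 3)) (pull a v)" "local_ge (cmod (pull b v $ 3)) (pull b v)"
      using D_dom_pull[OF _ v(2)] U(3,4) by blast+
    then show ?thesis using height_le_of_local_ge[OF v(1)] by (intro antisym) auto
  qed
  \<comment> \<open>At the translate of \<open>base\<close> by \<open>a\<close> the first height is
    1, below the gap at 2, so \<open>a\<close> and \<open>b\<close> give the same vertex.\<close>
  have "cmod (pull a (word_mat a *v base) $ 3) = cmod (pull b (word_mat a *v base) $ 3)"
    by (rule equal_norms_on_open[OF W' eq linear_pull_nth linear_pull_nth])
  then have "cmod (pull (inverse_word a @ b) base $ 3) < 2"
    by (simp add: pull_inverse_word)
  then obtain k where "inverse_word a @ b \<simeq> T_word k" using pull_base_ge by blast
  then show ?thesis using that weq_move_left by blast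
qed

lemma D_dom_fundamental:
  "fundamental_domain_for_cosets (D_dom \<theta>) (generate PU21 {T_elt \<theta>}) (Gamma_grp \<theta>)"
  unfolding fundamental_domain_for_cosets_def
proof (intro conjI ballI impI)
  show "PU_act g ` D_dom \<theta> = D_dom \<theta>" if "g \<in> generate PU21 {T_elt \<theta>}" for g
    using that D_dom_invariant by (auto simp: generate_T)
  show "CH2 \<subseteq> (\<Union>g\<in>Gamma_grp \<theta>. PU_act g ` D_dom \<theta>)" by (rule D_dom_covers)
  fix g h
  assume gh: "g \<in> Gamma_grp \<theta>" "h \<in> Gamma_grp \<theta>"
    and neq: "g <#\<^bsub>PU21\<^esub> generate PU21 {T_elt \<theta>} \<noteq> h <#\<^bsub>PU21\<^esub> generate PU21 {T_elt \<theta>}"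
  obtain a b where ab: "g = word_elt a" "h = word_elt b" using gh by (auto simp: Gamma_grp_eq)
  have coset: "word_elt w <#\<^bsub>PU21\<^esub> generate PU21 {T_elt \<theta>} = range (\<lambda>k. word_elt (w @ T_word k))" for w
    by (auto simp: l_coset_def generate_T word_elt_append)
  have "range (\<lambda>j. word_elt (b @ T_word j)) = range (\<lambda>j. word_elt (a @ T_word j))" if "b \<simeq> a @ T_word k" for k
  proof -
    have "word_elt (b @ T_word j) = word_elt (a @ T_word (k + j))" for j
    proof -
      have "b @ T_word j \<simeq> a @ (T_word k @ T_word j)"
        using word_eq_append_right[OF that, of "T_word j"] by simp
      moreover have "a @ (T_word k @ T_word j) \<simeq> a @ T_word (k + j)"
        by (rule word_eq_append_left[OF T_word_add])
      ultimately show ?thesis using word_elt_weq word_eq.trans by blast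
    qed
    moreover have "range (\<lambda>j. word_elt (a @ T_word (k + j))) = range (\<lambda>j. word_elt (a @ T_word j))"
    proof -
      have "range (\<lambda>j. word_elt (a @ T_word (k + j))) = (\<lambda>j. word_elt (a @ T_word j)) ` range (\<lambda>j. k + j)"
        by (simp only: image_image)
      also have "range (\<lambda>j. k + j) = UNIV" by (rule surj_plus)
      finally show ?thesis .
    qed
    ultimately show ?thesis by simp
  qed
  then show "cl_CH2 interior_of (PU_act g ` D_dom \<theta>) \<inter> cl_CH2 interior_of (PU_act h ` D_dom \<theta>) = {}"
    using neq D_dom_disjoint unfolding ab coset by blast
qed

end

theorem theorem4p17:
  fixes \<theta> :: real
  assumes "\<theta> \<in> {0..pi / 3}"
  shows "fundamental_domain_for_cosets (D_dom \<theta>) (generate PU21 {T_elt \<theta>}) (Gamma_grp \<theta>) \<and>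
         discrete_subgroup (Gamma_grp \<theta>) \<and>
         has_presentation (PU21\<lparr>carrier := Gamma_grp \<theta>\<rparr>) (gen_elt \<theta>) relators"
proof -
  have "cos \<theta> \<ge> cos (pi / 3)" using assms by (intro cos_monotone_0_pi_le) auto
  then interpret cusp_angle \<theta> by unfold_locales (simp add: cos_60)
  show ?thesis using D_dom_fundamental Gamma_discrete Gamma_presentation by blast
qed

end
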